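(* Let $Y$ be an observation from the degree corrected two-star ERGM $\mathbb{P}_{n,\theta,\bm\beta}$ on $\{-1,1\}^{\binom n2}$. Assume either $\beta_0=0$ and $0<\theta<1/2$, or $\beta_0\neq0$ and $\theta>0$ (with $\theta,\beta_0$ fixed and known). Consider testing $\mathcal{H}_0:\bm\beta=\beta_0\mathbf 1$ against $\mathcal{H}_1:\bm\beta\in\Xi(s,A)$ with $s=n^b$, $A=n^t$ for fixed $b\in(0,1)$ and $t<0$. (a) If $b\ge\frac12$ and $b+t<0$, all tests are asymptotically powerless. (b) If $b\ge\frac12$ and $b+t>0$, then for any sequence $L_n$ with $n\ll L_n\ll nsA$ the conditionally centered sum test $$T_n(Y)=\mathbf 1\Big\{\sum_{e\in\mathcal{E}}\big[Y_e-\mathbb{E}_{n,\theta,\beta_0\mathbf 1}(Y_e\,|\,Y_f:f\ne e)\big]>L_n\Big\}$$ is asymptotically powerful. (c) If $b<\frac12$ and $t+\frac12\le0$, all tests are asymptotically powerless. (d) If $b<\frac12$ and $t+\frac12>0$, then there is a constant $C$ such that the conditionally centered max test $$T_n(Y)=\mathbf 1\Big\{\max_{i\in[n]}\sum_{e\ni i}\big[Y_e-\mathbb{E}_{n,\theta,\beta_0\mathbf 1}(Y_e\,|\,Y_f:f\ne e)\big]>C\sqrt{n\log n}\Big\}$$ is asymptotically powerful.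
   Context: $\mathcal{E}=\{(i,j):1\le i<j\le n\}$; $Y$ is a symmetric $n\times n$ matrix with $Y_{ij}\in\{-1,1\}$ for $i\ne j$ and $Y_{ii}=0$; for $e=(i,j)\in\mathcal{E}$, $Y_e=Y_{ij}$, and $e\ni i$ means $i$ is an endpoint of $e$. Set $k_i=\sum_{j=1}^nY_{ij}$. The degree corrected two-star ERGM is $$\mathbb{P}_{n,\theta,\bm\beta}(Y)=\frac1{Z_n(\bm\beta,\theta)}\exp\Big\{\frac{\theta}{n-1}\Big(\frac12\sum_{i=1}^nk_i^2-\frac{n(n-1)}2\Big)+\frac12\sum_{i=1}^n\beta_ik_i\Big\},\quad\bm\beta\in\mathbb{R}^n,$$ with $Z_n$ the normalizing constant and $\mathbb{E}_{n,\theta,\bm\beta}$ the expectation. The alternative is $$\Xi(s,A)=\{\bm\beta=\beta_0\mathbf 1+\bm\mu:\ |\mathrm{supp}(\bm\mu)|\ge s,\ \min_{i\in\mathrm{supp}(\bm\mu)}\mu_i\ge A\},$$ where $\mathbf 1$ is the all-ones vector (and $\mathbf 1\{\cdot\}$ is an indicator). A (non-randomized) test is a function $T_n$ of $Y$ with values in $\{0,1\}$; its risk is $$R(T_n)=\mathbb{P}_{n,\theta,\beta_0\mathbf 1}(T_n=1)+\sup_{\bm\beta\in\Xi(s,A)}\mathbb{P}_{n,\theta,\bm\beta}(T_n=0).$$ A sequence of tests $\{T_n\}$ is called asymptotically powerful if $\lim_{n\to\infty}R(T_n)=0$, and asymptotically powerless if $\lim_{n\to\infty}R(T_n)=1$.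 $a_n\ll b_n$ means $a_n/b_n\to0$.
   Formalization: "All tests are asymptotically powerless" is read as: liminf R(T_n) ≥ 1 for every sequence of tests, and lim R(T_n) = 1 if eventually R(T_n) ≤ 1 (rejecting unless Y is all ones has risk tending to 2). In (b), L_n is assumed eventually positive. *)

theory Defs
  imports "HOL-Probability.Probability"
begin

section \<open>The degree corrected two-star ERGM\<close>

text \<open>Vertices are \<open>1, \<dots>, n\<close>. A matrix is a function on \<open>nat \<times> nat\<close> that vanishes outside
  \<open>{1..n} \<times> {1..n}\<close>, so that an observation \<open>Y\<close> is determined by its edge values
  and there are finitely many observations. Of a parameter vector \<open>\<beta> :: nat \<Rightarrow> real\<close> only the
  coordinates in \<open>{1..n}\<close> are ever used.\<close>

type_synonym config = "nat \<Rightarrow> nat \<Rightarrow> real"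

definition configs :: "nat \<Rightarrow> config set" where
  "configs n = {Y. (\<forall>i j. Y i j = Y j i) \<and>
     (\<forall>i j. if i \<in> {1..n} \<and> j \<in> {1..n} \<and> i \<noteq> j then Y i j \<in> {-1, 1} else Y i j = 0)}"

definition edges :: "nat \<Rightarrow> (nat \<times> nat) set" where
  "edges n = {(i, j). 1 \<le> i \<and> i < j \<and> j \<le> n}"

definition edge_val :: "config \<Rightarrow> nat \<times> nat \<Rightarrow> real" where
  "edge_val Y e = Y (fst e) (snd e)"

definition incident_edges :: "nat \<Rightarrow> nat \<Rightarrow> (nat \<times> nat) set" where
  "incident_edges n i = {e \<in> edges n. i = fst e \<or> i = snd e}"

definition deg :: "nat \<Rightarrow> config \<Rightarrow> nat \<Rightarrow> real" where
  "deg n Y i = (\<Sum>j=1..n. Y i j)"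

definition two_star_weight :: "nat \<Rightarrow> real \<Rightarrow> (nat \<Rightarrow> real) \<Rightarrow> config \<Rightarrow> real" where
  "two_star_weight n \<theta> \<beta> Y =
     exp (\<theta> / (real n - 1) * (1/2 * (\<Sum>i=1..n. (deg n Y i)\<^sup>2) - real n * (real n - 1) / 2)
          + 1/2 * (\<Sum>i=1..n. \<beta> i * deg n Y i))"

definition two_star_Z :: "nat \<Rightarrow> real \<Rightarrow> (nat \<Rightarrow> real) \<Rightarrow> real" where
  "two_star_Z n \<theta> \<beta> = (\<Sum>Y\<in>configs n. two_star_weight n \<theta> \<beta> Y)"

definition two_star_pmf :: "nat \<Rightarrow> real \<Rightarrow> (nat \<Rightarrow> real) \<Rightarrow> config pmf" where
  "two_star_pmf n \<theta> \<beta> =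
     embed_pmf (\<lambda>Y. if Y \<in> configs n then two_star_weight n \<theta> \<beta> Y / two_star_Z n \<theta> \<beta> else 0)"

lemma finite_configs: "finite (configs n)"
proof -
  let ?V = "{1..n} \<times> {1..n}"
  let ?F = "\<lambda>g i j. if (i, j) \<in> ?V then g (i, j) else (0::real)"
  have "configs n \<subseteq> ?F ` (?V \<rightarrow>\<^sub>E {-1, 0, 1})"
  proof
    fix Y assume Y: "Y \<in> configs n"
    let ?g = "restrict (\<lambda>(i, j). Y i j) ?V"
    have "?g \<in> ?V \<rightarrow>\<^sub>E {-1, 0, 1}"
      using Y by (auto simp: configs_def split: if_splits)
    moreover have "Y = ?F ?g"
      using Y by (auto simp: configs_def fun_eq_iff split: if_splits)
    ultimately show "Y \<in> ?F ` (?V \<rightarrow>\<^sub>E {-1, 0, 1})" by blast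
  qed
  moreover have "finite (?V \<rightarrow>\<^sub>E {-1, 0, 1::real})"
    by (intro finite_PiE) auto
  ultimately show ?thesis by (meson finite_imageI finite_subset)
qed

lemma configs_nonempty: "configs n \<noteq> {}"
proof -
  have "(\<lambda>i j. if i \<in> {1..n} \<and> j \<in> {1..n} \<and> i \<noteq> j then 1 else 0) \<in> configs n"
    by (auto simp: configs_def)
  then show ?thesis by blast
qed

lemma two_star_Z_pos: "two_star_Z n \<theta> \<beta> > 0"
  unfolding two_star_Z_def
  by (rule sum_pos) (auto simp: finite_configs configs_nonempty two_star_weight_def)

lemma pmf_two_star:
  "pmf (two_star_pmf n \<theta> \<beta>) Y =
     (if Y \<in> configs n then two_star_weight n \<theta> \<beta> Y / two_star_Z n \<theta> \<beta> else 0)"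
proof -
  let ?f = "\<lambda>Y. if Y \<in> configs n then two_star_weight n \<theta> \<beta> Y / two_star_Z n \<theta> \<beta> else 0"
  have nonneg: "0 \<le> ?f Y" for Y
    using two_star_Z_pos[of n \<theta> \<beta>] by (simp add: two_star_weight_def)
  have "(\<integral>\<^sup>+Y. ennreal (?f Y) \<partial>count_space UNIV) = (\<Sum>Y\<in>configs n. ennreal (?f Y))"
    by (rule nn_integral_count_space') (auto simp: finite_configs)
  also have "\<dots> = ennreal (\<Sum>Y\<in>configs n. ?f Y)"
    using nonneg by (rule sum_ennreal)
  also have "(\<Sum>Y\<in>configs n. ?f Y) = 1"
    using two_star_Z_pos[of n \<theta> \<beta>]
    by (simp add: sum_divide_distrib[symmetric] two_star_Z_def)
  finally show ?thesis
    unfolding two_star_pmf_def using nonneg by (subst pmf_embed_pmf) auto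
qed

lemma set_pmf_two_star: "set_pmf (two_star_pmf n \<theta> \<beta>) = configs n"
  using two_star_Z_pos[of n \<theta> \<beta>]
  by (auto simp: set_pmf_iff pmf_two_star two_star_weight_def split: if_splits)

text \<open>\<open>edge_cond_exp n \<theta> \<beta> e Y\<close> is the value at \<open>Y\<close> of the conditional expectation of the \<open>e\<close>-th
  edge variable given all other edge variables. For \<open>Y \<in> configs n\<close> the conditioning event
  has positive probability, so \<open>cond_pmf\<close> is the elementary conditional distribution.\<close>

definition edge_cond_exp ::
    "nat \<Rightarrow> real \<Rightarrow> (nat \<Rightarrow> real) \<Rightarrow> nat \<times> nat \<Rightarrow> config \<Rightarrow> real" where
  "edge_cond_exp n \<theta> \<beta> e Y =
     measure_pmf.expectation
       (cond_pmf (two_star_pmf n \<theta> \<beta>)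
          {Y'. \<forall>f\<in>edges n - {e}. edge_val Y' f = edge_val Y f})
       (\<lambda>Y'. edge_val Y' e)"

section \<open>Hypotheses, tests and risk\<close>

definition supp :: "nat \<Rightarrow> (nat \<Rightarrow> real) \<Rightarrow> nat set" where
  "supp n \<mu> = {i \<in> {1..n}. \<mu> i \<noteq> 0}"

definition Xi :: "nat \<Rightarrow> real \<Rightarrow> real \<Rightarrow> real \<Rightarrow> (nat \<Rightarrow> real) set" where
  "Xi n \<beta>0 s A =
     {\<lambda>i. \<beta>0 + \<mu> i | \<mu>. real (card (supp n \<mu>)) \<ge> s \<and> Min (\<mu> ` supp n \<mu>) \<ge> A}"

definition tests :: "nat \<Rightarrow> (config \<Rightarrow> nat) set" where
  "tests n = configs n \<rightarrow> {0, 1}"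

definition risk ::
    "nat \<Rightarrow> real \<Rightarrow> real \<Rightarrow> real \<Rightarrow> real \<Rightarrow> (config \<Rightarrow> nat) \<Rightarrow> real" where
  "risk n \<theta> \<beta>0 s A T =
     measure_pmf.prob (two_star_pmf n \<theta> (\<lambda>_. \<beta>0)) {Y. T Y = 1}
     + (SUP \<beta>\<in>Xi n \<beta>0 s A. measure_pmf.prob (two_star_pmf n \<theta> \<beta>) {Y. T Y = 0})"

definition asymp_powerful ::
    "real \<Rightarrow> real \<Rightarrow> (nat \<Rightarrow> real) \<Rightarrow> (nat \<Rightarrow> real) \<Rightarrow> (nat \<Rightarrow> config \<Rightarrow> nat) \<Rightarrow> bool" where
  "asymp_powerful \<theta> \<beta>0 s A T \<longleftrightarrow> (\<lambda>n. risk n \<theta> \<beta>0 (s n) (A n) (T n)) \<longlonglongrightarrow> 0"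

definition asymp_powerless ::
    "real \<Rightarrow> real \<Rightarrow> (nat \<Rightarrow> real) \<Rightarrow> (nat \<Rightarrow> real) \<Rightarrow> (nat \<Rightarrow> config \<Rightarrow> nat) \<Rightarrow> bool" where
  "asymp_powerless \<theta> \<beta>0 s A T \<longleftrightarrow> (\<lambda>n. risk n \<theta> \<beta>0 (s n) (A n) (T n)) \<longlonglongrightarrow> 1"

text \<open>Some tests have risk above that of the constant tests, which is 1: rejecting unless all
  edge values are 1 has risk tending to 2, since \<open>Xi\<close> contains vectors with arbitrarily large
  entries. So risk tending to 1 cannot hold for literally every sequence of tests.
  The statement that all tests are powerless is therefore read as: no sequence of tests
  asymptotically beats risk 1, and every sequence of tests that is (eventually) no worse than
  a constant test is asymptotically powerless.\<close>

definition all_tests_asymp_powerless ::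
    "real \<Rightarrow> real \<Rightarrow> (nat \<Rightarrow> real) \<Rightarrow> (nat \<Rightarrow> real) \<Rightarrow> bool" where
  "all_tests_asymp_powerless \<theta> \<beta>0 s A \<longleftrightarrow>
     (\<forall>T. (\<forall>n. T n \<in> tests n) \<longrightarrow>
        1 \<le> liminf (\<lambda>n. ereal (risk n \<theta> \<beta>0 (s n) (A n) (T n))) \<and>
        ((\<forall>\<^sub>F n in sequentially. risk n \<theta> \<beta>0 (s n) (A n) (T n) \<le> 1) \<longrightarrow>
           asymp_powerless \<theta> \<beta>0 s A T))"

definition cond_centered_sum_test ::
    "real \<Rightarrow> real \<Rightarrow> (nat \<Rightarrow> real) \<Rightarrow> nat \<Rightarrow> config \<Rightarrow> nat" where
  "cond_centered_sum_test \<theta> \<beta>0 L n Y =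
     of_bool ((\<Sum>e\<in>edges n. edge_val Y e - edge_cond_exp n \<theta> (\<lambda>_. \<beta>0) e Y) > L n)"

definition cond_centered_max_test ::
    "real \<Rightarrow> real \<Rightarrow> real \<Rightarrow> nat \<Rightarrow> config \<Rightarrow> nat" where
  "cond_centered_max_test \<theta> \<beta>0 C n Y =
     of_bool ((MAX i\<in>{1..n}. \<Sum>e\<in>incident_edges n i.
                 edge_val Y e - edge_cond_exp n \<theta> (\<lambda>_. \<beta>0) e Y)
              > C * sqrt (real n * ln (real n)))"

definition much_less :: "(nat \<Rightarrow> real) \<Rightarrow> (nat \<Rightarrow> real) \<Rightarrow> bool" (infix "\<lless>" 50) where
  "a \<lless> b \<longleftrightarrow> (\<lambda>n. a n / b n) \<longlonglongrightarrow> 0"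

end

theory Submission
  imports Defs
begin

text \<open>Indexed by edges, the model is a ferromagnetic Ising model whose interaction has row sums
  \<open>2\<theta>\<close>, so changing one edge changes a conditionally centered sum by a bounded amount.
  Chatterjee's exchangeable pair argument then yields sub-Gaussian concentration for every \<open>\<theta>\<close> and
  every \<open>\<beta>\<close>, while a signal in \<open>\<beta>\<close> shifts the conditional means by a constant multiple of its size;
  this gives the power of both tests.

  For the lower bounds, the second moment of the likelihood ratio against a uniform mixture of
  supports is a mixed second difference of the logarithm of the partition function, that is, a sum of
  covariances in a shifted field. The GHS inequality bounds these by covariances in a homogeneous
  field \<open>c\<close>. Their total is \<open>O(n\<^sup>2)\<close>: for \<open>c > 0\<close> because it is the decreasing derivative of the total
  magnetization, and for \<open>c = 0\<close>, \<open>\<theta> < 1/2\<close> by a Griffiths-type inequality. By exchangeability degrees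
  then have variance \<open>O(n)\<close> and covariance \<open>O(1)\<close>, with no distinction between phases.\<close>

section \<open>Positivity of moments\<close>

text \<open>The exponents come from comparing drifts with fluctuations. A signal \<open>A\<close> on
  \<open>s\<close> vertices moves the null-centered sum by order \<open>n s A\<close> against noise
  of order \<open>n\<close>, and the sum at one signal vertex by order \<open>n A\<close> against
  \<open>sqrt (n ln n)\<close> after a union bound. In the second moment, degree covariances of
  order 1 summed over two supports give \<open>(s A)^2\<close>, and each common vertex adds a
  variance term \<open>n A^2\<close>. The first vanishes if \<open>b + t < 0\<close>; the second
  stays bounded if \<open>2 t + 1 \<le> 0\<close>, and as the overlap is typically of order
  \<open>s^2 / n\<close>, it again contributes order \<open>(s A)^2\<close>.

  Overlaps of uniform \<open>s\<close>-subsets are hypergeometric. Taking one vertex per block makes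
  the overlap a sum of independent indicators, whose exponential moment is an exact power.

  The correlation inequalities multiply by exponentials of functions of both signs, so pointwise
  positivity is of no help. Positivity is tracked through all moments at once: a factor is
  admissible if multiplying by it preserves nonnegativity against every monomial in the chosen
  generators.\<close>

definition moment_pos :: "'x set \<Rightarrow> ('x \<Rightarrow> real) set \<Rightarrow> ('x \<Rightarrow> real) \<Rightarrow> bool" where
  "moment_pos Q G f \<longleftrightarrow> (\<forall>gs\<in>lists G. 0 \<le> (\<Sum>x\<in>Q. f x * (\<Prod>g\<leftarrow>gs. g x)))"

text \<open>Defined as an operator on moment-positive functions, so that a product is a composition
  and no monomials have to be multiplied out. The members form a convex cone closed under products
  and pointwise limits; a member may take negative values.\<close>

definition pos_mult :: "'x set \<Rightarrow> ('x \<Rightarrow> real) set \<Rightarrow> ('x \<Rightarrow> real) \<Rightarrow> bool" where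
  "pos_mult Q G q \<longleftrightarrow> (\<forall>f. moment_pos Q G f \<longrightarrow> moment_pos Q G (\<lambda>x. f x * q x))"

lemma pos_mult_gen:
  assumes "g \<in> G"
  shows "pos_mult Q G g"
  unfolding pos_mult_def moment_pos_def
proof (intro allI impI ballI)
  fix f gs assume "\<forall>gs\<in>lists G. 0 \<le> (\<Sum>x\<in>Q. f x * (\<Prod>g\<leftarrow>gs. g x))" "gs \<in> lists G"
  with assms have "0 \<le> (\<Sum>x\<in>Q. f x * (\<Prod>g\<leftarrow>g # gs. g x))" by (metis lists.Cons)
  then show "0 \<le> (\<Sum>x\<in>Q. f x * g x * (\<Prod>g\<leftarrow>gs. g x))" by (simp add: mult.assoc)
qed

lemma pos_mult_const:
  assumes "0 \<le> c"
  shows "pos_mult Q G (\<lambda>_. c)"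
  unfolding pos_mult_def moment_pos_def
proof (intro allI impI ballI)
  fix f gs assume "\<forall>gs\<in>lists G. 0 \<le> (\<Sum>x\<in>Q. f x * (\<Prod>g\<leftarrow>gs. g x))" "gs \<in> lists G"
  then have "0 \<le> c * (\<Sum>x\<in>Q. f x * (\<Prod>g\<leftarrow>gs. g x))" using assms by simp
  then show "0 \<le> (\<Sum>x\<in>Q. f x * c * (\<Prod>g\<leftarrow>gs. g x))"
    by (simp add: sum_distrib_left mult_ac)
qed

lemma pos_mult_add: "pos_mult Q G p \<Longrightarrow> pos_mult Q G q \<Longrightarrow> pos_mult Q G (\<lambda>x. p x + q x)"
  unfolding pos_mult_def moment_pos_def by (auto simp: algebra_simps sum.distrib)

lemma pos_mult_mult: "pos_mult Q G p \<Longrightarrow> pos_mult Q G q \<Longrightarrow> pos_mult Q G (\<lambda>x. p x * q x)"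
  unfolding pos_mult_def by (simp flip: mult.assoc)

lemma pos_mult_sum:
  assumes "\<And>i. i \<in> I \<Longrightarrow> pos_mult Q G (q i)"
  shows "pos_mult Q G (\<lambda>x. \<Sum>i\<in>I. q i x)"
  using assms
  by (induction I rule: infinite_finite_induct) (auto intro!: pos_mult_add pos_mult_const)

lemma pos_mult_power: "pos_mult Q G q \<Longrightarrow> pos_mult Q G (\<lambda>x. q x ^ k)"
  by (induction k) (auto intro!: pos_mult_mult pos_mult_const)

lemma pos_mult_limit:
  assumes "\<And>N. pos_mult Q G (F N)" and "\<And>x. (\<lambda>N. F N x) \<longlonglongrightarrow> q x"
  shows "pos_mult Q G q"
  unfolding pos_mult_def moment_pos_def
proof (intro allI impI ballI)
  fix f gs assume f: "\<forall>gs\<in>lists G. 0 \<le> (\<Sum>x\<in>Q. f x * (\<Prod>g\<leftarrow>gs. g x))" and gs: "gs \<in> lists G"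
  have "(\<lambda>N. \<Sum>x\<in>Q. f x * F N x * (\<Prod>g\<leftarrow>gs. g x)) \<longlonglongrightarrow> (\<Sum>x\<in>Q. f x * q x * (\<Prod>g\<leftarrow>gs. g x))"
    by (intro tendsto_intros assms)
  moreover have "0 \<le> (\<Sum>x\<in>Q. f x * F N x * (\<Prod>g\<leftarrow>gs. g x))" for N
    using assms(1)[of N] f gs unfolding pos_mult_def moment_pos_def by blast
  ultimately show "0 \<le> (\<Sum>x\<in>Q. f x * q x * (\<Prod>g\<leftarrow>gs. g x))"
    by (intro LIMSEQ_le_const) auto
qed

lemma pos_mult_sums:
  assumes "\<And>k. pos_mult Q G (F k)" and "\<And>x. (\<lambda>k. F k x) sums q x"
  shows "pos_mult Q G q"
proof (rule pos_mult_limit)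
  show "pos_mult Q G (\<lambda>x. \<Sum>k<N. F k x)" for N by (intro pos_mult_sum assms(1))
  show "(\<lambda>N. \<Sum>k<N. F k x) \<longlonglongrightarrow> q x" for x using assms(2) unfolding sums_def .
qed

lemma pos_mult_exp:
  assumes "pos_mult Q G q"
  shows "pos_mult Q G (\<lambda>x. exp (q x))"
proof (rule pos_mult_sums)
  show "(\<lambda>k. inverse (fact k) * q x ^ k) sums exp (q x)" for x
    using exp_converges[of "q x"] by (simp add: field_simps)
qed (intro pos_mult_mult pos_mult_power pos_mult_const assms, simp)

text \<open>The coefficient of \<open>x^(2j+1)\<close> is \<open>1/(2j)! - 1/(2j+1)!\<close>, hence
  nonnegative. This series replaces the inequality \<open>tanh x \<le> x\<close>, which fails for
  negative \<open>x\<close>.\<close>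

lemma cosh_minus_sinh_sums:
  "(\<lambda>k. (if even k then inverse (fact k) - inverse (fact (Suc k)) else 0) * x ^ Suc k)
     sums (x * cosh x - sinh (x::real))"
proof -
  have "(\<lambda>k. x * (if even k then x ^ k /\<^sub>R fact k else 0)) sums (x * cosh x)"
    by (intro sums_mult cosh_converges)
  moreover have "(\<lambda>k. if even (Suc k) then 0 else x ^ Suc k /\<^sub>R fact (Suc k)) sums sinh x"
    using sinh_converges[of x] by (subst sums_Suc_iff) auto
  ultimately have "(\<lambda>k. x * (if even k then x ^ k /\<^sub>R fact k else 0) -
      (if even (Suc k) then 0 else x ^ Suc k /\<^sub>R fact (Suc k))) sums (x * cosh x - sinh x)"
    by (rule sums_diff)
  then show ?thesis
    by (rule sums_cong[THEN iffD1, rotated]) (auto simp: algebra_simps)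
qed

lemma pos_mult_cosh_minus_sinh:
  assumes "pos_mult Q G q"
  shows "pos_mult Q G (\<lambda>x. q x * cosh (q x) - sinh (q x))"
proof (rule pos_mult_sums)
  show "pos_mult Q G
    (\<lambda>x. (if even k then inverse (fact k) - inverse (fact (Suc k)) else 0) * q x ^ Suc k)" for k
    by (intro pos_mult_mult pos_mult_power pos_mult_const assms)
       (auto intro!: le_imp_inverse_le fact_mono simp del: fact_Suc)
qed (rule cosh_minus_sinh_sums)

lemma pos_mult_sum_nonneg:
  assumes "\<And>gs. gs \<in> lists G \<Longrightarrow> 0 \<le> (\<Sum>x\<in>Q. \<Prod>g\<leftarrow>gs. g x)" and "pos_mult Q G q"
  shows "0 \<le> (\<Sum>x\<in>Q. q x)"
proof -
  have "moment_pos Q G (\<lambda>_. 1)" using assms(1) by (simp add: moment_pos_def)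
  then have "moment_pos Q G (\<lambda>x. 1 * q x)" using assms(2) unfolding pos_mult_def by blast
  then show ?thesis unfolding moment_pos_def by (auto dest: bspec[of _ _ "[]"])
qed

lemmas pos_mult_intros = pos_mult_const pos_mult_add pos_mult_mult pos_mult_sum pos_mult_power
  pos_mult_exp pos_mult_cosh_minus_sinh

section \<open>Ising models\<close>

definition spins :: "'v set \<Rightarrow> ('v \<Rightarrow> real) set" where
  "spins V = V \<rightarrow>\<^sub>E {-1, 1}"

definition ising_weight ::
    "'v set \<Rightarrow> ('v \<Rightarrow> 'v \<Rightarrow> real) \<Rightarrow> ('v \<Rightarrow> real) \<Rightarrow> ('v \<Rightarrow> real) \<Rightarrow> real" where
  "ising_weight V J h \<sigma> =
     exp ((\<Sum>a\<in>V. \<Sum>b\<in>V. J a b * (\<sigma> a * \<sigma> b)) / 2 + (\<Sum>a\<in>V. h a * \<sigma> a))"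

definition ising_Z :: "'v set \<Rightarrow> ('v \<Rightarrow> 'v \<Rightarrow> real) \<Rightarrow> ('v \<Rightarrow> real) \<Rightarrow> real" where
  "ising_Z V J h = (\<Sum>\<sigma>\<in>spins V. ising_weight V J h \<sigma>)"

definition ising_exp ::
    "'v set \<Rightarrow> ('v \<Rightarrow> 'v \<Rightarrow> real) \<Rightarrow> ('v \<Rightarrow> real) \<Rightarrow> (('v \<Rightarrow> real) \<Rightarrow> real) \<Rightarrow> real" where
  "ising_exp V J h F = (\<Sum>\<sigma>\<in>spins V. F \<sigma> * ising_weight V J h \<sigma>) / ising_Z V J h"

definition ising_cov ::
    "'v set \<Rightarrow> ('v \<Rightarrow> 'v \<Rightarrow> real) \<Rightarrow> ('v \<Rightarrow> real) \<Rightarrow> 'v \<Rightarrow> 'v \<Rightarrow> real" where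
  "ising_cov V J h a b = ising_exp V J h (\<lambda>\<sigma>. \<sigma> a * \<sigma> b)
     - ising_exp V J h (\<lambda>\<sigma>. \<sigma> a) * ising_exp V J h (\<lambda>\<sigma>. \<sigma> b)"

lemma spin_values: "\<sigma> \<in> spins V \<Longrightarrow> a \<in> V \<Longrightarrow> \<sigma> a = -1 \<or> \<sigma> a = 1"
  unfolding spins_def by (auto simp: PiE_iff)

lemma spin_square: "\<sigma> \<in> spins V \<Longrightarrow> a \<in> V \<Longrightarrow> \<sigma> a * \<sigma> a = 1"
  using spin_values by force

lemma finite_spins: "finite V \<Longrightarrow> finite (spins V)"
  unfolding spins_def by (intro finite_PiE) auto

lemma spins_nonempty: "spins V \<noteq> {}"
  unfolding spins_def by (simp add: PiE_eq_empty_iff)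

lemma ising_weight_pos: "0 < ising_weight V J h \<sigma>"
  by (simp add: ising_weight_def)

lemma ising_Z_pos: "finite V \<Longrightarrow> 0 < ising_Z V J h"
  unfolding ising_Z_def
  by (intro sum_pos finite_spins spins_nonempty ising_weight_pos)

lemma ising_exp_add: "ising_exp V J h (\<lambda>\<sigma>. F \<sigma> + G \<sigma>) = ising_exp V J h F + ising_exp V J h G"
  by (simp add: ising_exp_def algebra_simps sum.distrib add_divide_distrib)

lemma ising_exp_diff: "ising_exp V J h (\<lambda>\<sigma>. F \<sigma> - G \<sigma>) = ising_exp V J h F - ising_exp V J h G"
  by (simp add: ising_exp_def algebra_simps sum_subtractf diff_divide_distrib)

lemma ising_exp_minus: "ising_exp V J h (\<lambda>\<sigma>. - F \<sigma>) = - ising_exp V J h F"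
  by (simp add: ising_exp_def sum_negf)

lemma ising_exp_cmult: "ising_exp V J h (\<lambda>\<sigma>. c * F \<sigma>) = c * ising_exp V J h F"
  by (simp add: ising_exp_def mult.assoc flip: sum_distrib_left)

lemma ising_exp_multc: "ising_exp V J h (\<lambda>\<sigma>. F \<sigma> * c) = ising_exp V J h F * c"
  using ising_exp_cmult[of V J h c F] by (simp add: mult.commute)

lemma ising_exp_const: "finite V \<Longrightarrow> ising_exp V J h (\<lambda>\<sigma>. c) = c"
  using ising_Z_pos[of V J h] by (simp add: ising_exp_def ising_Z_def flip: sum_distrib_left)

lemma ising_exp_sum: "ising_exp V J h (\<lambda>\<sigma>. \<Sum>i\<in>I. F i \<sigma>) = (\<Sum>i\<in>I. ising_exp V J h (F i))"
proof -
  have "(\<Sum>\<sigma>\<in>spins V. (\<Sum>i\<in>I. F i \<sigma>) * ising_weight V J h \<sigma>) =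
      (\<Sum>i\<in>I. \<Sum>\<sigma>\<in>spins V. F i \<sigma> * ising_weight V J h \<sigma>)"
    by (subst sum.swap) (simp add: sum_distrib_right)
  then show ?thesis by (simp add: ising_exp_def sum_divide_distrib)
qed

lemma ising_exp_mono:
  assumes "finite V" "\<And>\<sigma>. \<sigma> \<in> spins V \<Longrightarrow> F \<sigma> \<le> G \<sigma>"
  shows "ising_exp V J h F \<le> ising_exp V J h G"
  unfolding ising_exp_def using assms
  by (intro divide_right_mono sum_mono mult_right_mono less_imp_le[OF ising_Z_pos]
        less_imp_le[OF ising_weight_pos]) auto

lemma ising_exp_cong:
  "(\<And>\<sigma>. \<sigma> \<in> spins V \<Longrightarrow> F \<sigma> = G \<sigma>) \<Longrightarrow> ising_exp V J h F = ising_exp V J h G"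
  unfolding ising_exp_def by (auto intro!: arg_cong2[where f = "(/)"] sum.cong)

lemma ising_exp_nonneg:
  assumes "finite V" "\<And>\<sigma>. \<sigma> \<in> spins V \<Longrightarrow> 0 \<le> F \<sigma>"
  shows "0 \<le> ising_exp V J h F"
  using ising_exp_mono[OF assms(1), of "\<lambda>_. 0" F J h] assms by (simp add: ising_exp_const)

lemma ising_exp_spin_bounds:
  assumes "finite V" "a \<in> V"
  shows "ising_exp V J h (\<lambda>\<sigma>. \<sigma> a) \<le> 1" "-1 \<le> ising_exp V J h (\<lambda>\<sigma>. \<sigma> a)"
  using ising_exp_mono[OF assms(1), of "\<lambda>\<sigma>. \<sigma> a" "\<lambda>_. 1" J h]
    ising_exp_mono[OF assms(1), of "\<lambda>_. -1" "\<lambda>\<sigma>. \<sigma> a" J h] spin_values assms(2)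
  by (force simp: ising_exp_const[OF assms(1)])+

section \<open>The inequality of Griffiths, Hurst and Sherman\<close>

subsection \<open>One replica\<close>

lemma one_replica_monomial:
  assumes "finite V" "gs \<in> lists ((\<lambda>v \<sigma>. \<sigma> v) ` V)"
  shows "\<exists>k. \<forall>\<sigma>. (\<Prod>g\<leftarrow>gs. g \<sigma>) = (\<Prod>v\<in>V. \<sigma> v ^ k v :: real)"
  using assms(2)
proof (induction gs)
  case Nil
  show ?case by (intro exI[of _ "\<lambda>_. 0"]) simp
next
  case (Cons g gs)
  then obtain k where k: "\<And>\<sigma>. (\<Prod>g\<leftarrow>gs. g \<sigma>) = (\<Prod>v\<in>V. \<sigma> v ^ k v)" by blast
  obtain u where u: "u \<in> V" "g = (\<lambda>\<sigma>. \<sigma> u)" using Cons by auto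
  have "(\<Prod>g\<leftarrow>g # gs. g \<sigma>) = (\<Prod>v\<in>V. \<sigma> v ^ (k(u := Suc (k u))) v)" for \<sigma>
    using u assms(1) k[of \<sigma>] by (simp add: prod.remove[OF assms(1) u(1)])
  then show ?case by blast
qed

text \<open>The sum factorizes over the sites, and a single site gives 2 for an even exponent and 0
  for an odd one.\<close>

lemma one_replica_moment:
  assumes "finite V" "gs \<in> lists ((\<lambda>v \<sigma>. \<sigma> v) ` V)"
  shows "0 \<le> (\<Sum>\<sigma>\<in>spins V. \<Prod>g\<leftarrow>gs. g \<sigma>)"
proof -
  obtain k where k: "\<And>\<sigma>. (\<Prod>g\<leftarrow>gs. g \<sigma>) = (\<Prod>v\<in>V. \<sigma> v ^ k v)"
    using one_replica_monomial[OF assms] by blast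
  have "(\<Sum>\<sigma>\<in>spins V. \<Prod>v\<in>V. \<sigma> v ^ k v) = (\<Prod>v\<in>V. \<Sum>s\<in>{-1,1}. s ^ k v)"
    unfolding spins_def using assms(1) by (subst prod_sum_PiE) auto
  also have "\<dots> \<ge> 0" by (intro prod_nonneg) (auto simp: uminus_power_if)
  finally show ?thesis by (simp add: k)
qed

subsection \<open>Four replicas\<close>

type_synonym 'v replicas = "('v \<Rightarrow> real) \<times> ('v \<Rightarrow> real) \<times> ('v \<Rightarrow> real) \<times> ('v \<Rightarrow> real)"

text \<open>The orthogonal change of variables of Ellis and Monroe.\<close>

definition repl1 :: "'v \<Rightarrow> 'v replicas \<Rightarrow> real" where
  "repl1 v = (\<lambda>(p, q, r, s). (p v + q v + r v + s v) / 2)"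
definition repl2 :: "'v \<Rightarrow> 'v replicas \<Rightarrow> real" where
  "repl2 v = (\<lambda>(p, q, r, s). (p v + q v - r v - s v) / 2)"
definition repl3 :: "'v \<Rightarrow> 'v replicas \<Rightarrow> real" where
  "repl3 v = (\<lambda>(p, q, r, s). (p v - q v + r v - s v) / 2)"
definition repl4 :: "'v \<Rightarrow> 'v replicas \<Rightarrow> real" where
  "repl4 v = (\<lambda>(p, q, r, s). (- p v + q v + r v - s v) / 2)"

lemmas repl_defs = repl1_def repl2_def repl3_def repl4_def

abbreviation repl_gens :: "'v set \<Rightarrow> ('v replicas \<Rightarrow> real) set" where
  "repl_gens V \<equiv> repl1 ` V \<union> repl2 ` V \<union> repl3 ` V \<union> repl4 ` V"

lemma replica_monomial:
  assumes "finite V" "gs \<in> lists (repl_gens V)"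
  shows "\<exists>i j k l. \<forall>x. (\<Prod>g\<leftarrow>gs. g x) =
    (\<Prod>v\<in>V. repl1 v x ^ i v * repl2 v x ^ j v * repl3 v x ^ k v * repl4 v x ^ l v)"
  using assms(2)
proof (induction gs)
  case Nil
  show ?case by (intro exI[of _ "\<lambda>_. 0"]) simp
next
  case (Cons g gs)
  then obtain i j k l where e: "\<And>x. (\<Prod>g\<leftarrow>gs. g x) =
    (\<Prod>v\<in>V. repl1 v x ^ i v * repl2 v x ^ j v * repl3 v x ^ k v * repl4 v x ^ l v)" by blast
  from Cons obtain u where u: "u \<in> V" and g: "g = repl1 u \<or> g = repl2 u \<or> g = repl3 u \<or> g = repl4 u"
    by auto
  note rem = prod.remove[OF assms(1) u]
  from g show ?case
  proof (elim disjE)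
    assume "g = repl1 u"
    then have "(\<Prod>g\<leftarrow>g # gs. g x) =
      (\<Prod>v\<in>V. repl1 v x ^ (i(u := Suc (i u))) v * repl2 v x ^ j v * repl3 v x ^ k v * repl4 v x ^ l v)" for x
      using e[of x] by (simp add: rem)
    then show ?thesis by blast
  next
    assume "g = repl2 u"
    then have "(\<Prod>g\<leftarrow>g # gs. g x) =
      (\<Prod>v\<in>V. repl1 v x ^ i v * repl2 v x ^ (j(u := Suc (j u))) v * repl3 v x ^ k v * repl4 v x ^ l v)" for x
      using e[of x] by (simp add: rem)
    then show ?thesis by blast
  next
    assume "g = repl3 u"
    then have "(\<Prod>g\<leftarrow>g # gs. g x) =
      (\<Prod>v\<in>V. repl1 v x ^ i v * repl2 v x ^ j v * repl3 v x ^ (k(u := Suc (k u))) v * repl4 v x ^ l v)" for x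
      using e[of x] by (simp add: rem)
    then show ?thesis by blast
  next
    assume "g = repl4 u"
    then have "(\<Prod>g\<leftarrow>g # gs. g x) =
      (\<Prod>v\<in>V. repl1 v x ^ i v * repl2 v x ^ j v * repl3 v x ^ k v * repl4 v x ^ (l(u := Suc (l u))) v)" for x
      using e[of x] by (simp add: rem)
    then show ?thesis by blast
  qed
qed

text \<open>In the new coordinates the sixteen sign patterns become the eight vectors with one
  nonzero entry, 2 or -2, and the eight sign vectors of product 1. Odd powers cancel on the former;
  the latter form a group, on which a monomial sums to 0 or 8. With the opposite sign in
  \<open>repl4\<close> the product would be -1 and this would fail.\<close>

lemma replica_site_moment:
  "0 \<le> (\<Sum>p\<in>{-1,1}. \<Sum>q\<in>{-1,1}. \<Sum>r\<in>{-1,1}. \<Sum>s\<in>{-1,1::real}.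
     ((p + q + r + s) / 2) ^ i * ((p + q - r - s) / 2) ^ j *
     ((p - q + r - s) / 2) ^ k * ((- p + q + r - s) / 2) ^ l)"
  by (cases "i = 0"; cases "j = 0"; cases "k = 0"; cases "l = 0")
     (auto simp: uminus_power_if power_0_left)

lemma replica_moment:
  assumes "finite V" "gs \<in> lists (repl_gens V)"
  shows "0 \<le> (\<Sum>x\<in>spins V \<times> spins V \<times> spins V \<times> spins V. \<Prod>g\<leftarrow>gs. g x)"
proof -
  obtain i j k l where e: "\<And>x. (\<Prod>g\<leftarrow>gs. g x) =
    (\<Prod>v\<in>V. repl1 v x ^ i v * repl2 v x ^ j v * repl3 v x ^ k v * repl4 v x ^ l v)"
    using replica_monomial[OF assms] by blast
  let ?f = "\<lambda>v p q r s. ((p + q + r + s) / 2) ^ i v * ((p + q - r - s) / 2) ^ j v *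
     ((p - q + r - s) / 2) ^ k v * ((- p + q + r - s) / 2 :: real) ^ l v"
  have "(\<Sum>x\<in>spins V \<times> spins V \<times> spins V \<times> spins V. \<Prod>g\<leftarrow>gs. g x) =
     (\<Sum>p\<in>spins V. \<Sum>q\<in>spins V. \<Sum>r\<in>spins V. \<Sum>s\<in>spins V. \<Prod>v\<in>V. ?f v (p v) (q v) (r v) (s v))"
    unfolding e by (simp add: sum.cartesian_product repl_defs split_beta)
  also have "\<dots> = (\<Prod>v\<in>V. \<Sum>p\<in>{-1,1}. \<Sum>q\<in>{-1,1}. \<Sum>r\<in>{-1,1}. \<Sum>s\<in>{-1,1}. ?f v p q r s)"
    unfolding spins_def using assms(1)
    by (simp only: prod_sum_PiE finite_insert finite.emptyI)
  also have "\<dots> \<ge> 0" by (intro prod_nonneg replica_site_moment)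
  finally show ?thesis .
qed

abbreviation replicas :: "'v set \<Rightarrow> 'v replicas set" where
  "replicas V \<equiv> spins V \<times> spins V \<times> spins V \<times> spins V"

definition replica_weight ::
    "'v set \<Rightarrow> ('v \<Rightarrow> 'v \<Rightarrow> real) \<Rightarrow> ('v \<Rightarrow> real) \<Rightarrow> 'v replicas \<Rightarrow> real" where
  "replica_weight V J h = (\<lambda>(p, q, r, s).
     ising_weight V J h p * ising_weight V J h q * ising_weight V J h r * ising_weight V J h s)"

text \<open>Orthogonality preserves the interaction summed over the four copies, and the field meets
  only \<open>repl1\<close>, since the four copies add up to \<open>2 * repl1\<close>. For
  nonnegative \<open>J\<close> and \<open>h\<close> the exponent is thus a polynomial in the
  generators with nonnegative coefficients.\<close>

lemma replica_weight_repl: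
  "replica_weight V J h x = exp ((\<Sum>a\<in>V. \<Sum>b\<in>V. J a b * (repl1 a x * repl1 b x + repl2 a x * repl2 b x
      + repl3 a x * repl3 b x + repl4 a x * repl4 b x)) / 2 + (\<Sum>a\<in>V. h a * (2 * repl1 a x)))"
proof -
  obtain p q r s where x: "x = (p, q, r, s)" by (metis surj_pair)
  have "J a b * (repl1 a x * repl1 b x + repl2 a x * repl2 b x
      + repl3 a x * repl3 b x + repl4 a x * repl4 b x) =
      J a b * (p a * p b) + J a b * (q a * q b) + J a b * (r a * r b) + J a b * (s a * s b)" for a b
    unfolding x repl_defs by (simp add: field_simps)
  moreover have "h a * (2 * repl1 a x) = h a * p a + h a * q a + h a * r a + h a * s a" for a
    unfolding x repl_defs by (simp add: field_simps)
  ultimately show ?thesis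
    unfolding x replica_weight_def
    by (simp add: ising_weight_def sum.distrib flip: exp_add)
qed

lemma replica_sum_nonneg:
  assumes "finite V" "\<And>a b. a \<in> V \<Longrightarrow> b \<in> V \<Longrightarrow> 0 \<le> J a b" "\<And>a. a \<in> V \<Longrightarrow> 0 \<le> h a"
    and F: "pos_mult (replicas V) (repl_gens V) F"
  shows "0 \<le> (\<Sum>x\<in>replicas V. F x * replica_weight V J h x)"
proof (rule pos_mult_sum_nonneg[OF replica_moment[OF assms(1)]])
  have "pos_mult (replicas V) (repl_gens V) (\<lambda>x. F x *
     exp ((\<Sum>a\<in>V. \<Sum>b\<in>V. J a b * (repl1 a x * repl1 b x + repl2 a x * repl2 b x
      + repl3 a x * repl3 b x + repl4 a x * repl4 b x)) * (1/2) + (\<Sum>a\<in>V. h a * (2 * repl1 a x))))"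
    by (intro F pos_mult_intros pos_mult_gen assms) (auto intro: assms)
  then show "pos_mult (replicas V) (repl_gens V) (\<lambda>x. F x * replica_weight V J h x)"
    unfolding replica_weight_repl by simp
qed

lemma ising_exp_replicas:
  "ising_exp V J h (\<lambda>p. ising_exp V J h (\<lambda>q. ising_exp V J h (\<lambda>r. ising_exp V J h (\<lambda>s. F (p, q, r, s)))))
   = (\<Sum>x\<in>replicas V. F x * replica_weight V J h x) / ising_Z V J h ^ 4"
  unfolding ising_exp_def replica_weight_def
  by (simp add: sum.cartesian_product' sum_distrib_left sum_distrib_right sum_divide_distrib
      power4_eq_xxxx field_simps)

lemma replica_exp_nonneg:
  assumes "finite V" "\<And>a b. a \<in> V \<Longrightarrow> b \<in> V \<Longrightarrow> 0 \<le> J a b" "\<And>a. a \<in> V \<Longrightarrow> 0 \<le> h a"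
    and "pos_mult (replicas V) (repl_gens V) F"
  shows "0 \<le> ising_exp V J h (\<lambda>p. ising_exp V J h (\<lambda>q. ising_exp V J h (\<lambda>r. ising_exp V J h (\<lambda>s. F (p, q, r, s)))))"
  unfolding ising_exp_replicas
  by (intro divide_nonneg_nonneg replica_sum_nonneg assms) (auto intro: less_imp_le[OF ising_Z_pos] assms)

lemma ising_exp_pull:
  "ising_exp V J h (\<lambda>\<sigma>. F \<sigma> * (G \<sigma> * c)) = ising_exp V J h (\<lambda>\<sigma>. F \<sigma> * G \<sigma>) * c"
  "ising_exp V J h (\<lambda>\<sigma>. F \<sigma> * (c * G \<sigma>)) = c * ising_exp V J h (\<lambda>\<sigma>. F \<sigma> * G \<sigma>)"
  using ising_exp_cmult[of V J h c "\<lambda>\<sigma>. F \<sigma> * G \<sigma>"] by (simp_all add: mult_ac)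

lemmas ising_exp_linear = ising_exp_add ising_exp_diff ising_exp_minus ising_exp_cmult
  ising_exp_multc ising_exp_const

text \<open>Twice \<open>repl2\<close> is a signed sum of four independent copies whose means
  cancel, so the product of two of these has expectation four times the covariance.\<close>

lemma ising_cov_nonneg:
  assumes "finite V" "\<And>a b. a \<in> V \<Longrightarrow> b \<in> V \<Longrightarrow> 0 \<le> J a b" "\<And>a. a \<in> V \<Longrightarrow> 0 \<le> h a"
    and "a \<in> V" "b \<in> V"
  shows "0 \<le> ising_cov V J h a b"
proof -
  have 1: "4 * (repl2 a (p, q, r, s) * repl2 b (p, q, r, s)) =
      (p a + q a - r a - s a) * (p b + q b - r b - s b)" for p q r s
    by (simp add: repl_defs)
  have "0 \<le> ising_exp V J h (\<lambda>p. ising_exp V J h (\<lambda>q. ising_exp V J h (\<lambda>r. ising_exp V J h (\<lambda>s.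
    4 * (repl2 a (p, q, r, s) * repl2 b (p, q, r, s))))))"
    using assms(4,5)
    by (intro replica_exp_nonneg assms(1-3) pos_mult_mult pos_mult_gen pos_mult_const) auto
  also have "\<dots> = 4 * ising_cov V J h a b"
    unfolding 1
    by (simp add: ising_cov_def ising_exp_linear ising_exp_pull distrib_left distrib_right
        left_diff_distrib right_diff_distrib mult.assoc assms(1))
  finally show ?thesis by simp
qed

text \<open>The left side is the third joint cumulant. The means of \<open>repl2\<close>,
  \<open>repl3\<close>, \<open>repl4\<close> vanish, and each of the four copies enters their
  product with total sign -1, so \<open>8 * repl2 * repl3 * repl4\<close> has expectation -4 times
  the cumulant.\<close>

lemma ising_GHS:
  assumes "finite V" "\<And>a b. a \<in> V \<Longrightarrow> b \<in> V \<Longrightarrow> 0 \<le> J a b" "\<And>a. a \<in> V \<Longrightarrow> 0 \<le> h a"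
    and "a \<in> V" "b \<in> V" "c \<in> V"
  defines "E \<equiv> ising_exp V J h"
  shows "E (\<lambda>\<sigma>. \<sigma> a * \<sigma> b * \<sigma> c) - E (\<lambda>\<sigma>. \<sigma> a * \<sigma> b) * E (\<lambda>\<sigma>. \<sigma> c)
    - E (\<lambda>\<sigma>. \<sigma> a * \<sigma> c) * E (\<lambda>\<sigma>. \<sigma> b) - E (\<lambda>\<sigma>. \<sigma> b * \<sigma> c) * E (\<lambda>\<sigma>. \<sigma> a)
    + 2 * E (\<lambda>\<sigma>. \<sigma> a) * E (\<lambda>\<sigma>. \<sigma> b) * E (\<lambda>\<sigma>. \<sigma> c) \<le> 0" (is "?u \<le> 0")
proof -
  have 1: "8 * (repl2 a (p, q, r, s) * (repl3 b (p, q, r, s) * repl4 c (p, q, r, s))) =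
      (p a + q a - r a - s a) * ((p b - q b + r b - s b) * (- p c + q c + r c - s c))" for p q r s
    by (simp add: repl_defs)
  have "0 \<le> E (\<lambda>p. E (\<lambda>q. E (\<lambda>r. E (\<lambda>s.
    8 * (repl2 a (p, q, r, s) * (repl3 b (p, q, r, s) * repl4 c (p, q, r, s)))))))"
    unfolding E_def using assms(4-6)
    by (intro replica_exp_nonneg assms(1-3) pos_mult_mult pos_mult_gen pos_mult_const) auto
  also have "\<dots> = - 4 * ?u"
    unfolding 1 E_def
    by (simp add: ising_exp_linear ising_exp_pull distrib_left distrib_right
        left_diff_distrib right_diff_distrib mult.assoc assms(1))
  finally show ?thesis by simp
qed

section \<open>Dependence on the field\<close>

lemma ising_weight_shift:
  "ising_weight V J (\<lambda>a. h a + u a) \<sigma> = ising_weight V J h \<sigma> * exp (\<Sum>a\<in>V. u a * \<sigma> a)"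
  by (simp add: ising_weight_def sum.distrib distrib_right flip: exp_add)

lemma ising_weight_scaled_shift:
  "ising_weight V J (\<lambda>a. h a + x * u a) \<sigma> = ising_weight V J h \<sigma> * exp (x * (\<Sum>a\<in>V. u a * \<sigma> a))"
  using ising_weight_shift[of V J h "\<lambda>a. x * u a" \<sigma>] by (simp add: sum_distrib_left mult.assoc)

lemma ising_sum_deriv:
  "((\<lambda>x. \<Sum>\<sigma>\<in>spins V. F \<sigma> * ising_weight V J (\<lambda>a. h a + x * u a) \<sigma>) has_real_derivative
    (\<Sum>\<sigma>\<in>spins V. F \<sigma> * (\<Sum>a\<in>V. u a * \<sigma> a) * ising_weight V J (\<lambda>a. h a + x * u a) \<sigma>)) (at x)"
  unfolding ising_weight_scaled_shift
  by (auto intro!: derivative_eq_intros sum.cong)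

lemma ising_Z_deriv:
  assumes "finite V"
  shows "((\<lambda>x. ising_Z V J (\<lambda>a. h a + x * u a)) has_real_derivative
    ising_exp V J (\<lambda>a. h a + x * u a) (\<lambda>\<sigma>. \<Sum>a\<in>V. u a * \<sigma> a) * ising_Z V J (\<lambda>a. h a + x * u a)) (at x)"
  using ising_sum_deriv[of "\<lambda>_. 1" V J h u x] ising_Z_pos[OF assms, of J "\<lambda>a. h a + x * u a"]
  by (simp add: ising_Z_def[abs_def] ising_exp_def)

lemma ising_ln_Z_deriv:
  assumes "finite V"
  shows "((\<lambda>x. ln (ising_Z V J (\<lambda>a. h a + x * u a))) has_real_derivative
    ising_exp V J (\<lambda>a. h a + x * u a) (\<lambda>\<sigma>. \<Sum>a\<in>V. u a * \<sigma> a)) (at x)"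
  using ising_Z_pos[OF assms, of J "\<lambda>a. h a + x * u a"]
  by (auto intro!: derivative_eq_intros ising_Z_deriv assms)

lemma ising_exp_deriv:
  fixes h u :: "'v \<Rightarrow> real" and J :: "'v \<Rightarrow> 'v \<Rightarrow> real"
  assumes "finite V"
  defines "E \<equiv> \<lambda>x. ising_exp V J (\<lambda>a. h a + x * u a)"
  shows "((\<lambda>x. E x F) has_real_derivative
     (\<Sum>c\<in>V. u c * (E x (\<lambda>\<sigma>. F \<sigma> * \<sigma> c) - E x F * E x (\<lambda>\<sigma>. \<sigma> c)))) (at x)"
proof -
  let ?U = "\<lambda>\<sigma>. \<Sum>a\<in>V. u a * \<sigma> a"
  note Z = ising_Z_pos[OF assms(1), of J "\<lambda>a. h a + x * u a"]
  have "((\<lambda>x. E x F) has_real_derivative E x (\<lambda>\<sigma>. F \<sigma> * ?U \<sigma>) - E x F * E x ?U) (at x)"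
    unfolding E_def ising_exp_def[of V J _ F]
    by (rule DERIV_cong, rule DERIV_divide[OF ising_sum_deriv ising_Z_deriv[OF assms(1)]])
       (use Z in \<open>auto simp: ising_exp_def field_simps\<close>)
  moreover have "E x (\<lambda>\<sigma>. F \<sigma> * ?U \<sigma>) = (\<Sum>c\<in>V. u c * E x (\<lambda>\<sigma>. F \<sigma> * \<sigma> c))"
    by (simp add: E_def sum_distrib_left ising_exp_sum mult.left_commute[of _ "u _"] ising_exp_cmult)
  moreover have "E x ?U = (\<Sum>c\<in>V. u c * E x (\<lambda>\<sigma>. \<sigma> c))"
    by (simp add: E_def ising_exp_sum ising_exp_cmult)
  ultimately show ?thesis
    by (simp add: sum_subtractf right_diff_distrib sum_distrib_left mult_ac)
qed

lemma ising_spin_deriv: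
  assumes "finite V"
  shows "((\<lambda>x. ising_exp V J (\<lambda>a. h a + x * u a) (\<lambda>\<sigma>. \<sigma> a)) has_real_derivative
     (\<Sum>c\<in>V. u c * ising_cov V J (\<lambda>a. h a + x * u a) a c)) (at x)"
  using ising_exp_deriv[OF assms, of J h u "\<lambda>\<sigma>. \<sigma> a" x] by (simp add: ising_cov_def)

text \<open>On the segment from \<open>h\<close> to \<open>h'\<close> the field stays nonnegative
  and moves in a nonnegative direction; the derivative of a covariance in the field at one site is
  the third cumulant of \<open>ising_GHS\<close>.\<close>

lemma ising_cov_antimono:
  assumes V: "finite V" and J: "\<And>a b. a \<in> V \<Longrightarrow> b \<in> V \<Longrightarrow> 0 \<le> J a b"
    and h: "\<And>a. a \<in> V \<Longrightarrow> 0 \<le> h a" "\<And>a. a \<in> V \<Longrightarrow> h a \<le> h' a"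
    and ab: "a \<in> V" "b \<in> V"
  shows "ising_cov V J h' a b \<le> ising_cov V J h a b"
proof -
  define u where "u = (\<lambda>a. h' a - h a)"
  have "ising_cov V J (\<lambda>a. h a + 1 * u a) a b \<le> ising_cov V J (\<lambda>a. h a + 0 * u a) a b"
  proof (rule DERIV_nonpos_imp_nonincreasing[of 0 1 "\<lambda>x. ising_cov V J (\<lambda>a. h a + x * u a) a b"])
    fix x :: real assume x: "0 \<le> x" "x \<le> 1"
    let ?E = "ising_exp V J (\<lambda>a. h a + x * u a)"
    have hx: "0 \<le> h a + x * u a" if "a \<in> V" for a
      using h[OF that] x by (simp add: u_def)
    let ?D = "(\<Sum>c\<in>V. u c * (?E (\<lambda>\<sigma>. \<sigma> a * \<sigma> b * \<sigma> c) - ?E (\<lambda>\<sigma>. \<sigma> a * \<sigma> b) * ?E (\<lambda>\<sigma>. \<sigma> c)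
      - ?E (\<lambda>\<sigma>. \<sigma> a * \<sigma> c) * ?E (\<lambda>\<sigma>. \<sigma> b) - ?E (\<lambda>\<sigma>. \<sigma> b * \<sigma> c) * ?E (\<lambda>\<sigma>. \<sigma> a)
      + 2 * ?E (\<lambda>\<sigma>. \<sigma> a) * ?E (\<lambda>\<sigma>. \<sigma> b) * ?E (\<lambda>\<sigma>. \<sigma> c)))"
    have "((\<lambda>x. ising_cov V J (\<lambda>a. h a + x * u a) a b) has_real_derivative ?D) (at x)"
      unfolding ising_cov_def
      by (rule DERIV_cong[OF DERIV_diff[OF ising_exp_deriv[OF V, of J h u "\<lambda>\<sigma>. \<sigma> a * \<sigma> b" x]
            DERIV_mult[OF ising_exp_deriv[OF V, of J h u "\<lambda>\<sigma>. \<sigma> a" x]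
              ising_exp_deriv[OF V, of J h u "\<lambda>\<sigma>. \<sigma> b" x]]]])
         (simp add: algebra_simps sum.distrib sum_subtractf sum_distrib_left)
    moreover have "?D \<le> 0"
      using h ab by (intro sum_nonpos mult_nonneg_nonpos ising_GHS V J hx) (auto simp: u_def)
    ultimately show "\<exists>y. ((\<lambda>x. ising_cov V J (\<lambda>a. h a + x * u a) a b) has_real_derivative y) (at x) \<and> y \<le> 0"
      by blast
  qed simp
  then show ?thesis by (simp add: u_def)
qed

text \<open>After taking logarithms this bounds a mixed second difference, by the mean value theorem
  first along \<open>u\<close> and then along \<open>v\<close>. All intermediate fields dominate
  \<open>g\<close>, so the covariances may be evaluated at \<open>g\<close>, which can be chosen
  homogeneous even if \<open>h\<close> is not.\<close>

lemma ising_Z_second_difference: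
  assumes V: "finite V" and J: "\<And>a b. a \<in> V \<Longrightarrow> b \<in> V \<Longrightarrow> 0 \<le> J a b"
    and g: "\<And>a. a \<in> V \<Longrightarrow> 0 \<le> g a" "\<And>a. a \<in> V \<Longrightarrow> g a \<le> h a"
    and u: "\<And>a. a \<in> V \<Longrightarrow> 0 \<le> u a" and v: "\<And>a. a \<in> V \<Longrightarrow> 0 \<le> v a"
  shows "ising_Z V J h * ising_Z V J (\<lambda>a. h a + u a + v a) \<le>
    ising_Z V J (\<lambda>a. h a + u a) * ising_Z V J (\<lambda>a. h a + v a) *
      exp (\<Sum>a\<in>V. \<Sum>b\<in>V. u a * v b * ising_cov V J g a b)"
proof -
  define H where "H = (\<lambda>x y a. h a + x * u a + y * v a)"
  let ?U = "\<lambda>\<sigma>. \<Sum>a\<in>V. u a * \<sigma> a"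
  let ?C = "\<Sum>a\<in>V. \<Sum>b\<in>V. u a * v b * ising_cov V J g a b"
  have "((\<lambda>x. ln (ising_Z V J (H x 1)) - ln (ising_Z V J (H x 0))) has_real_derivative
      ising_exp V J (H x 1) ?U - ising_exp V J (H x 0) ?U) (at x)" for x
    using DERIV_diff[OF ising_ln_Z_deriv[OF V, of J "\<lambda>a. h a + v a" u x] ising_ln_Z_deriv[OF V, of J h u x]]
    by (simp add: H_def add_ac)
  then obtain x where x: "0 < x" "x < 1"
    and xe: "ln (ising_Z V J (H 1 1)) - ln (ising_Z V J (H 1 0)) - (ln (ising_Z V J (H 0 1)) - ln (ising_Z V J (H 0 0)))
      = ising_exp V J (H x 1) ?U - ising_exp V J (H x 0) ?U"
    using MVT2[of 0 1 "\<lambda>x. ln (ising_Z V J (H x 1)) - ln (ising_Z V J (H x 0))"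
      "\<lambda>x. ising_exp V J (H x 1) ?U - ising_exp V J (H x 0) ?U"] by force
  have U: "ising_exp V J h' ?U = (\<Sum>a\<in>V. u a * ising_exp V J h' (\<lambda>\<sigma>. \<sigma> a))" for h'
    by (simp add: ising_exp_sum ising_exp_cmult)
  have "((\<lambda>y. ising_exp V J (H x y) ?U) has_real_derivative
      (\<Sum>a\<in>V. u a * (\<Sum>b\<in>V. v b * ising_cov V J (H x y) a b))) (at y)" for y
    unfolding U H_def by (intro DERIV_sum DERIV_cmult ising_spin_deriv V)
  then obtain y where y: "0 < y" "y < 1"
    and ye: "ising_exp V J (H x 1) ?U - ising_exp V J (H x 0) ?U =
      (\<Sum>a\<in>V. u a * (\<Sum>b\<in>V. v b * ising_cov V J (H x y) a b))"
    using MVT2[of 0 1 "\<lambda>y. ising_exp V J (H x y) ?U"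
      "\<lambda>y. \<Sum>a\<in>V. u a * (\<Sum>b\<in>V. v b * ising_cov V J (H x y) a b)"] by force
  have le: "g a \<le> H x y a" if "a \<in> V" for a
    using g(2)[OF that] u[OF that] v[OF that] x y unfolding H_def
    by (smt (verit) mult_nonneg_nonneg)
  have "(\<Sum>a\<in>V. u a * (\<Sum>b\<in>V. v b * ising_cov V J (H x y) a b)) \<le>
      (\<Sum>a\<in>V. u a * (\<Sum>b\<in>V. v b * ising_cov V J g a b))"
    by (intro sum_mono mult_left_mono ising_cov_antimono V J g le u v) auto
  also have "\<dots> = ?C" by (simp add: sum_distrib_left mult.assoc)
  finally have "ln (ising_Z V J (H 1 1)) + ln (ising_Z V J (H 0 0)) \<le>
     ln (ising_Z V J (H 1 0)) + ln (ising_Z V J (H 0 1)) + ?C"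
    using xe ye by linarith
  then have "exp (ln (ising_Z V J (H 1 1)) + ln (ising_Z V J (H 0 0))) \<le>
     exp (ln (ising_Z V J (H 1 0)) + ln (ising_Z V J (H 0 1)) + ?C)" by simp
  then show ?thesis
    using ising_Z_pos[OF V, of J] by (simp add: exp_add H_def mult.commute)
qed

text \<open>In a positive uniform field the covariances are decreasing by the GHS inequality while
  their total is the derivative of a bounded function.\<close>

lemma ising_cov_sum_uniform_field:
  assumes V: "finite V" and J: "\<And>a b. a \<in> V \<Longrightarrow> b \<in> V \<Longrightarrow> 0 \<le> J a b" and c: "0 < c"
  shows "(\<Sum>a\<in>V. \<Sum>b\<in>V. ising_cov V J (\<lambda>_. c) a b) \<le> 2 * real (card V) / c"
proof -
  define m where "m = (\<lambda>x. \<Sum>a\<in>V. ising_exp V J (\<lambda>_. x) (\<lambda>\<sigma>. \<sigma> a))"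
  have "(m has_real_derivative (\<Sum>a\<in>V. \<Sum>b\<in>V. ising_cov V J (\<lambda>_. x) a b)) (at x)" for x
    unfolding m_def using ising_spin_deriv[OF V, of J "\<lambda>_. 0" "\<lambda>_. 1" _ x]
    by (intro DERIV_sum) simp
  then obtain x where x: "0 < x" "x < c"
    and e: "m c - m 0 = c * (\<Sum>a\<in>V. \<Sum>b\<in>V. ising_cov V J (\<lambda>_. x) a b)"
    using MVT2[OF c, of m "\<lambda>x. \<Sum>a\<in>V. \<Sum>b\<in>V. ising_cov V J (\<lambda>_. x) a b"] by force
  have "\<bar>m y\<bar> \<le> real (card V)" for y
    unfolding m_def using ising_exp_spin_bounds[OF V, of _ J]
    by (intro order.trans[OF sum_abs] order.trans[OF sum_bounded_above[of _ _ 1]])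
       (auto simp: abs_le_iff minus_le_iff)
  then have "m c - m 0 \<le> 2 * real (card V)"
    using abs_triangle_ineq4[of "m c" "m 0"] by (smt (verit))
  moreover have "(\<Sum>a\<in>V. \<Sum>b\<in>V. ising_cov V J (\<lambda>_. c) a b) \<le> (\<Sum>a\<in>V. \<Sum>b\<in>V. ising_cov V J (\<lambda>_. x) a b)"
    using x by (intro sum_mono ising_cov_antimono V J) auto
  ultimately show ?thesis
    using c e by (simp add: pos_le_divide_eq mult.commute)
      (metis mult_left_mono order.strict_implies_order order.trans)
qed

section \<open>Flipping spins\<close>

text \<open>The interaction is quadratic, so flipping every spin only reverses the field.\<close>

lemma ising_Z_minus: "ising_Z V J (\<lambda>a. - h a) = ising_Z V J h"
proof -
  let ?f = "\<lambda>\<sigma>. \<lambda>a\<in>V. - \<sigma> a :: real"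
  have "(\<Sum>\<sigma>\<in>spins V. ising_weight V J h \<sigma>) = (\<Sum>\<sigma>\<in>spins V. ising_weight V J h (?f \<sigma>))"
  proof (rule sum.reindex_bij_witness[of _ ?f ?f])
    fix \<sigma> :: "_ \<Rightarrow> real" assume s: "\<sigma> \<in> spins V"
    show "?f (?f \<sigma>) = \<sigma>" "?f (?f \<sigma>) = \<sigma>"
      using s unfolding spins_def by (auto simp: fun_eq_iff PiE_def extensional_def)
    show "?f \<sigma> \<in> spins V" "?f \<sigma> \<in> spins V"
      using s unfolding spins_def by (auto simp: PiE_iff)
    show "ising_weight V J h (?f (?f \<sigma>)) = ising_weight V J h \<sigma>"
      by (simp add: ising_weight_def)
  qed
  then show ?thesis
    by (simp add: ising_Z_def ising_weight_def sum_negf)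
qed

definition flip_spin :: "'v \<Rightarrow> ('v \<Rightarrow> real) \<Rightarrow> 'v \<Rightarrow> real" where
  "flip_spin e \<sigma> = \<sigma>(e := - \<sigma> e)"

definition local_field ::
    "'v set \<Rightarrow> ('v \<Rightarrow> 'v \<Rightarrow> real) \<Rightarrow> ('v \<Rightarrow> real) \<Rightarrow> 'v \<Rightarrow> ('v \<Rightarrow> real) \<Rightarrow> real" where
  "local_field V J h e \<sigma> = (\<Sum>b\<in>V - {e}. J e b * \<sigma> b) + h e"

text \<open>The diagonal entry \<open>J e e\<close> belongs here because the square of spin
  \<open>e\<close> is 1; the two-star interaction has a nonzero diagonal.\<close>

definition rest_weight ::
    "'v set \<Rightarrow> ('v \<Rightarrow> 'v \<Rightarrow> real) \<Rightarrow> ('v \<Rightarrow> real) \<Rightarrow> 'v \<Rightarrow> ('v \<Rightarrow> real) \<Rightarrow> real" where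
  "rest_weight V J h e \<sigma> =
     exp ((J e e + (\<Sum>a\<in>V - {e}. \<Sum>b\<in>V - {e}. J a b * (\<sigma> a * \<sigma> b))) / 2 + (\<Sum>a\<in>V - {e}. h a * \<sigma> a))"

lemma flip_spin_simps [simp]:
  "flip_spin e \<sigma> e = - \<sigma> e" "a \<noteq> e \<Longrightarrow> flip_spin e \<sigma> a = \<sigma> a" "flip_spin e (flip_spin e \<sigma>) = \<sigma>"
  by (auto simp: flip_spin_def)

lemma flip_spin_in_spins: "e \<in> V \<Longrightarrow> \<sigma> \<in> spins V \<Longrightarrow> flip_spin e \<sigma> \<in> spins V"
  unfolding spins_def flip_spin_def by (auto simp: PiE_iff extensional_def)

lemma sum_flip_spin:
  assumes "e \<in> V"
  shows "(\<Sum>\<sigma>\<in>spins V. F (flip_spin e \<sigma>)) = (\<Sum>\<sigma>\<in>spins V. F \<sigma>)"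
  by (rule sum.reindex_bij_witness[of _ "flip_spin e" "flip_spin e"])
     (use assms in \<open>auto intro: flip_spin_in_spins\<close>)

lemma local_field_flip [simp]: "local_field V J h e (flip_spin e \<sigma>) = local_field V J h e \<sigma>"
  by (simp add: local_field_def)

lemma rest_weight_flip [simp]: "rest_weight V J h e (flip_spin e \<sigma>) = rest_weight V J h e \<sigma>"
  by (simp add: rest_weight_def)

lemma ising_weight_split:
  assumes V: "finite V" and sym: "\<And>a b. a \<in> V \<Longrightarrow> b \<in> V \<Longrightarrow> J a b = J b a"
    and e: "e \<in> V" and \<sigma>: "\<sigma> \<in> spins V"
  shows "ising_weight V J h \<sigma> = rest_weight V J h e \<sigma> * exp (\<sigma> e * local_field V J h e \<sigma>)"
proof -
  let ?W = "V - {e}"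
  have "(\<Sum>a\<in>V. \<Sum>b\<in>V. J a b * (\<sigma> a * \<sigma> b)) = J e e * (\<sigma> e * \<sigma> e) + (\<Sum>b\<in>?W. J e b * (\<sigma> e * \<sigma> b))
      + (\<Sum>a\<in>?W. J a e * (\<sigma> a * \<sigma> e)) + (\<Sum>a\<in>?W. \<Sum>b\<in>?W. J a b * (\<sigma> a * \<sigma> b))"
    by (simp add: sum.remove[OF V e] sum.distrib)
  also have "(\<Sum>a\<in>?W. J a e * (\<sigma> a * \<sigma> e)) = (\<Sum>b\<in>?W. J e b * (\<sigma> e * \<sigma> b))"
    by (intro sum.cong) (auto simp: sym[OF _ e] mult.commute)
  also have "(\<Sum>b\<in>?W. J e b * (\<sigma> e * \<sigma> b)) = \<sigma> e * (\<Sum>b\<in>?W. J e b * \<sigma> b)"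
    by (simp add: sum_distrib_left mult_ac)
  finally show ?thesis
    unfolding ising_weight_def rest_weight_def local_field_def spin_square[OF \<sigma> e]
    by (simp add: sum.remove[OF V e] field_simps flip: exp_add)
qed

section \<open>Covariances in zero field\<close>

abbreviation spin_gens :: "'v set \<Rightarrow> (('v \<Rightarrow> real) \<Rightarrow> real) set" where
  "spin_gens V \<equiv> (\<lambda>v \<sigma>. \<sigma> v) ` V"

lemma spin_gens_intro: "v \<in> V \<Longrightarrow> pos_mult (spins V) (spin_gens V) (\<lambda>\<sigma>. \<sigma> v)"
  by (rule pos_mult_gen) blast

text \<open>Griffiths' first inequality, for every \<open>F\<close> in the cone and not only for
  products of spins: the Gibbs weight is itself in the cone.\<close>

lemma ising_exp_GKS:
  assumes "finite V" "\<And>a b. a \<in> V \<Longrightarrow> b \<in> V \<Longrightarrow> 0 \<le> J a b" "\<And>a. a \<in> V \<Longrightarrow> 0 \<le> h a"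
    and F: "pos_mult (spins V) (spin_gens V) F"
  shows "0 \<le> ising_exp V J h F"
proof -
  have "pos_mult (spins V) (spin_gens V) (\<lambda>\<sigma>. F \<sigma> *
     exp ((\<Sum>a\<in>V. \<Sum>b\<in>V. J a b * (\<sigma> a * \<sigma> b)) * (1/2) + (\<Sum>a\<in>V. h a * \<sigma> a)))"
    by (intro F pos_mult_intros spin_gens_intro assms) auto
  then have "0 \<le> (\<Sum>\<sigma>\<in>spins V. F \<sigma> * ising_weight V J h \<sigma>)"
    using pos_mult_sum_nonneg[OF one_replica_moment[OF assms(1)]] by (simp add: ising_weight_def)
  then show ?thesis
    unfolding ising_exp_def by (intro divide_nonneg_nonneg less_imp_le[OF ising_Z_pos] assms(1))
qed

lemma sum_spins_symmetrize:
  fixes F :: "('v \<Rightarrow> real) \<Rightarrow> real"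
  assumes "e \<in> V"
  shows "(\<Sum>\<sigma>\<in>spins V. F \<sigma>) = (\<Sum>\<sigma>\<in>spins V. (F \<sigma> + F (flip_spin e \<sigma>)) / 2)"
  using sum_flip_spin[OF assms, of F] by (simp add: sum.distrib flip: sum_divide_distrib)

text \<open>Given the other spins, spin \<open>e\<close> has mean \<open>tanh\<close> of its local
  field \<open>H\<close>. Replacing \<open>tanh H\<close> by \<open>H\<close> is not allowed
  pointwise, as both \<open>H\<close> and spin \<open>f\<close> may be negative. But the difference,
  multiplied by \<open>cosh H\<close>, is a series in \<open>H\<close> with nonnegative
  coefficients, to which Griffiths positivity applies.\<close>

lemma ising_pair_le:
  assumes V: "finite V" and sym: "\<And>a b. a \<in> V \<Longrightarrow> b \<in> V \<Longrightarrow> J a b = J b a"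
    and J: "\<And>a b. a \<in> V \<Longrightarrow> b \<in> V \<Longrightarrow> 0 \<le> J a b"
    and ef: "e \<in> V" "f \<in> V" "f \<noteq> e"
  defines "E \<equiv> ising_exp V J (\<lambda>_. 0)"
  shows "E (\<lambda>\<sigma>. \<sigma> f * \<sigma> e) \<le> (\<Sum>g\<in>V - {e}. J e g * E (\<lambda>\<sigma>. \<sigma> f * \<sigma> g))"
proof -
  let ?H = "local_field V J (\<lambda>_. 0) e" and ?R = "rest_weight V J (\<lambda>_. 0) e"
  let ?F = "\<lambda>\<sigma>. \<sigma> f * (?H \<sigma> - \<sigma> e) * ising_weight V J (\<lambda>_. 0) \<sigma>"
  \<comment> \<open>Averaging over the two values of spin \<open>e\<close> produces the hyperbolic
    functions of \<open>?H\<close>; the factor \<open>\<sigma> f\<close> is unaffected because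
    \<open>f\<close> differs from \<open>e\<close>.\<close>
  have eq: "(?F \<sigma> + ?F (flip_spin e \<sigma>)) / 2 = ?R \<sigma> * (\<sigma> f * (?H \<sigma> * cosh (?H \<sigma>) - sinh (?H \<sigma>)))"
    if s: "\<sigma> \<in> spins V" for \<sigma>
    using spin_values[OF s ef(1)] ising_weight_split[OF V sym ef(1) s]
      ising_weight_split[OF V sym ef(1) flip_spin_in_spins[OF ef(1) s]] ef(3)
    by (auto simp: cosh_def sinh_def field_simps)
  have "pos_mult (spins V) (spin_gens V) (\<lambda>\<sigma>. (\<Sum>b\<in>V - {e}. J e b * \<sigma> b) + 0)"
    by (intro pos_mult_intros spin_gens_intro J ef) auto
  then have H: "pos_mult (spins V) (spin_gens V) ?H"
    by (simp add: local_field_def[abs_def])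
  have "pos_mult (spins V) (spin_gens V)
      (\<lambda>\<sigma>. exp ((J e e + (\<Sum>a\<in>V - {e}. \<Sum>b\<in>V - {e}. J a b * (\<sigma> a * \<sigma> b))) * (1/2) + 0))"
    by (intro pos_mult_intros spin_gens_intro J ef) auto
  then have R: "pos_mult (spins V) (spin_gens V) ?R"
    by (simp add: rest_weight_def[abs_def])
  have "0 \<le> (\<Sum>\<sigma>\<in>spins V. ?R \<sigma> * (\<sigma> f * (?H \<sigma> * cosh (?H \<sigma>) - sinh (?H \<sigma>))))"
    by (rule pos_mult_sum_nonneg[OF one_replica_moment[OF V]], assumption)
       (intro pos_mult_mult pos_mult_cosh_minus_sinh R H spin_gens_intro ef(2))
  also have "\<dots> = (\<Sum>\<sigma>\<in>spins V. ?F \<sigma>)"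
    unfolding sum_spins_symmetrize[OF ef(1), of ?F] by (intro sum.cong refl eq[symmetric])
  finally have "0 \<le> E (\<lambda>\<sigma>. \<sigma> f * (?H \<sigma> - \<sigma> e))"
    unfolding E_def ising_exp_def using less_imp_le[OF ising_Z_pos[OF V]]
    by (intro divide_nonneg_nonneg) auto
  also have "\<dots> = (\<Sum>g\<in>V - {e}. J e g * E (\<lambda>\<sigma>. \<sigma> f * \<sigma> g)) - E (\<lambda>\<sigma>. \<sigma> f * \<sigma> e)"
    by (simp add: local_field_def E_def right_diff_distrib ising_exp_diff sum_distrib_left
        ising_exp_sum mult.left_commute[of _ "J _ _"] ising_exp_cmult)
  finally show ?thesis by simp
qed

text \<open>For fixed \<open>f\<close> the pair correlations satisfy a linear system of inequalities
  with matrix \<open>J\<close> and source 1 at \<open>f\<close>. Summed over all sites, it bounds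
  the total by 1 plus \<open>\<kappa>\<close> times itself, which closes since
  \<open>\<kappa> < 1\<close>.\<close>

lemma ising_cov_sum_zero_field:
  assumes V: "finite V" and sym: "\<And>a b. a \<in> V \<Longrightarrow> b \<in> V \<Longrightarrow> J a b = J b a"
    and J: "\<And>a b. a \<in> V \<Longrightarrow> b \<in> V \<Longrightarrow> 0 \<le> J a b"
    and \<kappa>: "\<And>a. a \<in> V \<Longrightarrow> (\<Sum>b\<in>V. J a b) \<le> \<kappa>" "\<kappa> < 1"
  shows "(\<Sum>a\<in>V. \<Sum>b\<in>V. ising_cov V J (\<lambda>_. 0) a b) \<le> real (card V) / (1 - \<kappa>)"
proof -
  let ?E = "ising_exp V J (\<lambda>_. 0)"
  have pos2: "0 \<le> ?E (\<lambda>\<sigma>. \<sigma> a * \<sigma> b)" if "a \<in> V" "b \<in> V" for a b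
    using that by (intro ising_exp_GKS V J pos_mult_mult spin_gens_intro) auto
  have pos1: "0 \<le> ?E (\<lambda>\<sigma>. \<sigma> a)" if "a \<in> V" for a
    using that by (intro ising_exp_GKS V J spin_gens_intro) auto
  have row: "(\<Sum>e\<in>V. ?E (\<lambda>\<sigma>. \<sigma> f * \<sigma> e)) \<le> 1 / (1 - \<kappa>)" if f: "f \<in> V" for f
  proof -
    let ?x = "\<lambda>e. ?E (\<lambda>\<sigma>. \<sigma> f * \<sigma> e)"
    have "?x f = ?E (\<lambda>_. 1)" using f by (intro ising_exp_cong spin_square)
    then have xf: "?x f = 1" by (simp add: ising_exp_const V)
    have le: "?x e \<le> (if e = f then 1 else 0) + (\<Sum>g\<in>V. J e g * ?x g)" if e: "e \<in> V" for e
    proof (cases "e = f")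
      case True
      then show ?thesis using xf f by (auto intro!: sum_nonneg mult_nonneg_nonneg J pos2)
    next
      case False
      then have "?x e \<le> (\<Sum>g\<in>V - {e}. J e g * ?x g)"
        using ising_pair_le[OF V sym J e f] by auto
      also have "\<dots> \<le> (\<Sum>g\<in>V. J e g * ?x g)"
        using V e f by (intro sum_mono2) (auto intro!: mult_nonneg_nonneg J pos2)
      finally show ?thesis using False by simp
    qed
    have "(\<Sum>e\<in>V. ?x e) \<le> (\<Sum>e\<in>V. (if e = f then 1 else 0) + (\<Sum>g\<in>V. J e g * ?x g))"
      by (intro sum_mono le)
    also have "\<dots> = 1 + (\<Sum>g\<in>V. \<Sum>e\<in>V. J e g * ?x g)"
      using V f by (simp add: sum.distrib) (rule sum.swap)
    also have "(\<Sum>g\<in>V. \<Sum>e\<in>V. J e g * ?x g) \<le> (\<Sum>g\<in>V. \<kappa> * ?x g)"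
    proof (intro sum_mono)
      fix g assume g: "g \<in> V"
      have "(\<Sum>e\<in>V. J e g) = (\<Sum>e\<in>V. J g e)" by (intro sum.cong refl sym g)
      then have "(\<Sum>e\<in>V. J e g) * ?x g \<le> \<kappa> * ?x g"
        using \<kappa>(1)[OF g] by (intro mult_right_mono pos2 f g) simp
      then show "(\<Sum>e\<in>V. J e g * ?x g) \<le> \<kappa> * ?x g" by (simp add: sum_distrib_right)
    qed
    finally have "(\<Sum>e\<in>V. ?x e) \<le> 1 + \<kappa> * (\<Sum>e\<in>V. ?x e)"
      by (simp add: sum_distrib_left)
    then have "(\<Sum>e\<in>V. ?x e) * (1 - \<kappa>) \<le> 1"
      by (simp add: right_diff_distrib mult.commute[of _ \<kappa>])
    then show ?thesis using \<kappa>(2) by (simp add: pos_le_divide_eq)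
  qed
  have "(\<Sum>a\<in>V. \<Sum>b\<in>V. ising_cov V J (\<lambda>_. 0) a b) \<le> (\<Sum>a\<in>V. \<Sum>b\<in>V. ?E (\<lambda>\<sigma>. \<sigma> a * \<sigma> b))"
    unfolding ising_cov_def using pos1 by (intro sum_mono) simp
  also have "\<dots> \<le> (\<Sum>a\<in>V. 1 / (1 - \<kappa>))" by (intro sum_mono row)
  finally show ?thesis by simp
qed

section \<open>Concentration of conditionally centered sums\<close>

lemma tanh_diff_MVT:
  fixes x y :: real
  assumes "x < y"
  obtains z where "x < z" "z < y" "tanh y - tanh x = (y - x) * (1 - tanh z ^ 2)"
proof -
  have "\<exists>z>x. z < y \<and> tanh y - tanh x = (y - x) * (1 - tanh z ^ 2)"
    using assms by (intro MVT2) (auto intro!: derivative_eq_intros)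
  then show ?thesis using that by blast
qed

lemma tanh_lipschitz: "\<bar>tanh x - tanh y\<bar> \<le> \<bar>x - y :: real\<bar>"
proof -
  have *: "\<bar>tanh y - tanh x\<bar> \<le> \<bar>y - x\<bar>" if xy: "x < y" for x y :: real
  proof -
    obtain z where "tanh y - tanh x = (y - x) * (1 - tanh z ^ 2)"
      using tanh_diff_MVT[OF xy] by metis
    moreover have "0 \<le> 1 - tanh z ^ 2" "1 - tanh z ^ 2 \<le> 1"
      using tanh_real_bounds[of z] by (auto simp: abs_square_le_1)
    ultimately show ?thesis by (simp add: abs_mult mult_left_le)
  qed
  show ?thesis using *[of x y] *[of y x] by (cases x y rule: linorder_cases) auto
qed

lemma abs_exp_diff_le: "\<bar>exp x - exp y\<bar> \<le> \<bar>x - y\<bar> * (exp x + exp y :: real)"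
proof -
  have *: "exp x - exp y \<le> (x - y) * exp x" for x y :: real
  proof -
    have "(1 + (y - x)) * exp x \<le> exp (y - x) * exp x"
      by (intro mult_right_mono exp_ge_add_one_self) auto
    then show ?thesis by (simp add: exp_diff algebra_simps)
  qed
  have "(x - y) * exp x \<le> \<bar>x - y\<bar> * (exp x + exp y)" "(y - x) * exp y \<le> \<bar>x - y\<bar> * (exp x + exp y)"
    by (intro mult_mono; simp)+
  then show ?thesis using *[of x y] *[of y x] by linarith
qed

definition spin_fluct ::
    "'v set \<Rightarrow> ('v \<Rightarrow> 'v \<Rightarrow> real) \<Rightarrow> ('v \<Rightarrow> real) \<Rightarrow> 'v \<Rightarrow> ('v \<Rightarrow> real) \<Rightarrow> real" where
  "spin_fluct V J h e \<sigma> = \<sigma> e - tanh (local_field V J h e \<sigma>)"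

lemma spin_fluct_bound:
  assumes "\<sigma> \<in> spins V" "e \<in> V"
  shows "\<bar>spin_fluct V J h e \<sigma>\<bar> \<le> 2"
  using spin_values[OF assms] tanh_real_bounds[of "local_field V J h e \<sigma>"]
  by (auto simp: spin_fluct_def)

text \<open>The centered spin has conditional mean zero given the others; as it takes only two
  values, the two weighted deviations are opposite.\<close>

lemma weight_spin_fluct_flip:
  assumes V: "finite V" and sym: "\<And>a b. a \<in> V \<Longrightarrow> b \<in> V \<Longrightarrow> J a b = J b a"
    and e: "e \<in> V" and s: "\<sigma> \<in> spins V"
  shows "ising_weight V J h (flip_spin e \<sigma>) * spin_fluct V J h e (flip_spin e \<sigma>) =
     - (ising_weight V J h \<sigma> * spin_fluct V J h e \<sigma>)"
proof -
  have *: "exp x * (1 - tanh x) = exp (- x) * (1 + tanh x)" for x :: real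
  proof -
    have "1 - tanh x = exp (- x) / cosh x" "1 + tanh x = exp x / cosh x"
      by (simp_all add: tanh_def cosh_minus_sinh[symmetric] cosh_plus_sinh[symmetric]
          diff_divide_distrib add_divide_distrib)
    then show ?thesis by (simp flip: exp_add)
  qed
  let ?H = "local_field V J h e \<sigma>" and ?R = "rest_weight V J h e \<sigma>"
  have w: "ising_weight V J h \<sigma> = ?R * exp (\<sigma> e * ?H)"
    by (rule ising_weight_split[OF V _ e s]) (rule sym)
  have w': "ising_weight V J h (flip_spin e \<sigma>) = ?R * exp (- \<sigma> e * ?H)"
    using ising_weight_split[OF V _ e flip_spin_in_spins[OF e s], of J h] sym by simp
  have "?R * (exp ?H * (1 - tanh ?H)) = ?R * (exp (- ?H) * (1 + tanh ?H))"
    by (simp only: *)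
  then show ?thesis
    using spin_values[OF s e] unfolding w w'
    by (auto simp: spin_fluct_def algebra_simps)
qed

text \<open>By antisymmetry only the change of \<open>g\<close> under the flip survives, so a
  function insensitive to spin \<open>e\<close> sees no centered spin \<open>e\<close>.\<close>

lemma sum_weight_spin_fluct:
  fixes g :: "('v \<Rightarrow> real) \<Rightarrow> real"
  assumes V: "finite V" and sym: "\<And>a b. a \<in> V \<Longrightarrow> b \<in> V \<Longrightarrow> J a b = J b a" and e: "e \<in> V"
  shows "(\<Sum>\<sigma>\<in>spins V. ising_weight V J h \<sigma> * spin_fluct V J h e \<sigma> * g \<sigma>) =
    (\<Sum>\<sigma>\<in>spins V. ising_weight V J h \<sigma> * spin_fluct V J h e \<sigma> * (g \<sigma> - g (flip_spin e \<sigma>)) / 2)"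
  unfolding sum_spins_symmetrize[OF e, of "\<lambda>\<sigma>. ising_weight V J h \<sigma> * spin_fluct V J h e \<sigma> * g \<sigma>"]
  by (intro sum.cong refl) (simp add: weight_spin_fluct_flip[OF V sym e] algebra_simps)

text \<open>Chatterjee's exchangeable pair argument, with the pair given by resampling one spin.\<close>

lemma sum_weight_spin_fluct_exp:
  fixes f :: "('v \<Rightarrow> real) \<Rightarrow> real"
  assumes V: "finite V" and sym: "\<And>a b. a \<in> V \<Longrightarrow> b \<in> V \<Longrightarrow> J a b = J b a" and e: "e \<in> V"
    and K: "\<And>\<sigma>. \<sigma> \<in> spins V \<Longrightarrow> \<bar>f \<sigma> - f (flip_spin e \<sigma>)\<bar> \<le> K" and x: "0 \<le> x"
  shows "\<bar>\<Sum>\<sigma>\<in>spins V. ising_weight V J h \<sigma> * spin_fluct V J h e \<sigma> * exp (x * f \<sigma>)\<bar>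
    \<le> 2 * x * K * (\<Sum>\<sigma>\<in>spins V. ising_weight V J h \<sigma> * exp (x * f \<sigma>))"
proof -
  let ?w = "ising_weight V J h" and ?g = "\<lambda>\<sigma>. exp (x * f \<sigma>)" and ?d = "spin_fluct V J h e"
  let ?r = "flip_spin e"
  have "\<bar>\<Sum>\<sigma>\<in>spins V. ?w \<sigma> * ?d \<sigma> * ?g \<sigma>\<bar> \<le> (\<Sum>\<sigma>\<in>spins V. \<bar>?w \<sigma> * ?d \<sigma> * (?g \<sigma> - ?g (?r \<sigma>)) / 2\<bar>)"
    by (subst sum_weight_spin_fluct[OF V _ e], erule (1) sym) (rule sum_abs)
  also have "\<dots> \<le> (\<Sum>\<sigma>\<in>spins V. x * K * (?w \<sigma> * ?g \<sigma> + ?w (?r \<sigma>) * ?g (?r \<sigma>)))"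
  proof (intro sum_mono)
    fix \<sigma> assume s: "\<sigma> \<in> spins V"
    have K0: "0 \<le> K" using K[OF s] by linarith
    have w1: "\<bar>?w \<sigma> * ?d \<sigma>\<bar> \<le> 2 * ?w t" if t: "t = \<sigma> \<or> t = ?r \<sigma>" for t
    proof -
      have "\<bar>?w \<sigma> * ?d \<sigma>\<bar> = \<bar>?w t * ?d t\<bar>"
        using t weight_spin_fluct_flip[OF V sym e s, where h = h] by auto
      also have "\<dots> = ?w t * \<bar>?d t\<bar>" using ising_weight_pos[of V J h t] by (simp add: abs_mult)
      also have "\<dots> \<le> ?w t * 2"
        using t s e ising_weight_pos[of V J h t]
        by (intro mult_left_mono spin_fluct_bound) (auto intro: flip_spin_in_spins)
      finally show ?thesis by simp
    qed
    have "\<bar>?g \<sigma> - ?g (?r \<sigma>)\<bar> \<le> \<bar>x * f \<sigma> - x * f (?r \<sigma>)\<bar> * (?g \<sigma> + ?g (?r \<sigma>))"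
      by (rule abs_exp_diff_le)
    also have "\<dots> \<le> x * K * (?g \<sigma> + ?g (?r \<sigma>))"
      using K[OF s] x by (intro mult_right_mono) (auto simp: abs_mult mult_left_mono simp flip: right_diff_distrib)
    finally have "\<bar>?w \<sigma> * ?d \<sigma> * (?g \<sigma> - ?g (?r \<sigma>)) / 2\<bar> \<le>
        \<bar>?w \<sigma> * ?d \<sigma>\<bar> * (x * K * (?g \<sigma> + ?g (?r \<sigma>))) / 2"
      unfolding abs_mult[of "?w \<sigma> * ?d \<sigma>"] abs_divide abs_numeral by (intro divide_right_mono mult_left_mono) auto
    also have "\<dots> = x * K * (\<bar>?w \<sigma> * ?d \<sigma>\<bar> * ?g \<sigma> + \<bar>?w \<sigma> * ?d \<sigma>\<bar> * ?g (?r \<sigma>)) / 2"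
      by (simp add: algebra_simps)
    also have "\<dots> \<le> x * K * (2 * ?w \<sigma> * ?g \<sigma> + 2 * ?w (?r \<sigma>) * ?g (?r \<sigma>)) / 2"
      using x K0 by (intro divide_right_mono mult_left_mono add_mono mult_right_mono w1) auto
    finally show "\<bar>?w \<sigma> * ?d \<sigma> * (?g \<sigma> - ?g (?r \<sigma>)) / 2\<bar> \<le> x * K * (?w \<sigma> * ?g \<sigma> + ?w (?r \<sigma>) * ?g (?r \<sigma>))"
      by (simp add: algebra_simps)
  qed
  also have "\<dots> = 2 * x * K * (\<Sum>\<sigma>\<in>spins V. ?w \<sigma> * ?g \<sigma>)"
    using sum_flip_spin[OF e, of "\<lambda>\<sigma>. ?w \<sigma> * ?g \<sigma>"]
    by (simp add: sum.distrib flip: sum_distrib_left)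
  finally show ?thesis .
qed

text \<open>The derivative of the unnormalized generating function \<open>M\<close> brings down
  \<open>f\<close>, a sum of centered spins, each of which is controlled by a factor of order
  \<open>x\<close>. The resulting inequality \<open>M' \<le> 2 * k * x * M\<close> integrates to a
  Gaussian bound. The sign \<open>c\<close> serves both tails.\<close>

lemma ising_mgf_bound:
  fixes h :: "'v \<Rightarrow> real" and J :: "'v \<Rightarrow> 'v \<Rightarrow> real"
  assumes V: "finite V" and sym: "\<And>a b. a \<in> V \<Longrightarrow> b \<in> V \<Longrightarrow> J a b = J b a" and D: "D \<subseteq> V"
    and c: "\<bar>c\<bar> = 1"
  defines "f \<equiv> \<lambda>\<sigma>. c * (\<Sum>e\<in>D. spin_fluct V J h e \<sigma>)"
  assumes K: "\<And>\<sigma> e. \<sigma> \<in> spins V \<Longrightarrow> e \<in> D \<Longrightarrow> \<bar>f \<sigma> - f (flip_spin e \<sigma>)\<bar> \<le> K" and x: "0 \<le> x"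
  shows "ising_exp V J h (\<lambda>\<sigma>. exp (x * f \<sigma>)) \<le> exp (K * real (card D) * x\<^sup>2)"
proof -
  define M where "M = (\<lambda>x. \<Sum>\<sigma>\<in>spins V. ising_weight V J h \<sigma> * exp (x * f \<sigma>))"
  define M' where "M' = (\<lambda>x. \<Sum>\<sigma>\<in>spins V. ising_weight V J h \<sigma> * f \<sigma> * exp (x * f \<sigma>))"
  let ?k = "K * real (card D)"
  have deriv: "(M has_real_derivative M' x) (at x)" for x
    unfolding M_def M'_def by (auto intro!: derivative_eq_intros sum.cong)
  have M': "M' y \<le> 2 * y * ?k * M y" if y: "0 \<le> y" for y
  proof -
    have "M' y = c * (\<Sum>e\<in>D. \<Sum>\<sigma>\<in>spins V. ising_weight V J h \<sigma> * spin_fluct V J h e \<sigma> * exp (y * f \<sigma>))"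
      unfolding M'_def f_def by (subst sum.swap) (simp add: sum_distrib_left sum_distrib_right mult_ac)
    also have "\<dots> \<le> \<bar>c\<bar> * (\<Sum>e\<in>D. \<bar>\<Sum>\<sigma>\<in>spins V. ising_weight V J h \<sigma> * spin_fluct V J h e \<sigma> * exp (y * f \<sigma>)\<bar>)"
      by (rule order.trans[OF abs_ge_self]) (simp add: abs_mult mult_left_mono sum_abs)
    also have "\<dots> \<le> \<bar>c\<bar> * (\<Sum>e\<in>D. 2 * y * K * M y)"
      unfolding M_def using D
      by (intro mult_left_mono sum_mono sum_weight_spin_fluct_exp V sym K y) auto
    finally show ?thesis using c by (simp add: mult_ac)
  qed
  have "M x * exp (- ?k * x\<^sup>2) \<le> M 0 * exp (- ?k * 0\<^sup>2)"
  proof (rule DERIV_nonpos_imp_nonincreasing[OF x])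
    fix y assume y: "0 \<le> y" "y \<le> x"
    have "((\<lambda>x. M x * exp (- ?k * x\<^sup>2)) has_real_derivative
        (M' y - 2 * y * ?k * M y) * exp (- ?k * y\<^sup>2)) (at y)"
      by (auto intro!: derivative_eq_intros deriv simp: algebra_simps)
    then show "\<exists>d. ((\<lambda>x. M x * exp (- ?k * x\<^sup>2)) has_real_derivative d) (at y) \<and> d \<le> 0"
      using M'[OF y(1)] by (intro exI conjI) (assumption, simp add: mult_nonpos_nonneg)
  qed
  then have "M x \<le> M 0 * exp (?k * x\<^sup>2)"
    by (simp add: exp_minus field_simps)
  moreover have "M 0 = ising_Z V J h" by (simp add: M_def ising_Z_def)
  ultimately show ?thesis
    using ising_Z_pos[OF V, of J h]
    by (simp add: ising_exp_def M_def mult.commute pos_divide_le_eq)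
qed

lemma ising_concentration_aux:
  fixes h :: "'v \<Rightarrow> real" and J :: "'v \<Rightarrow> 'v \<Rightarrow> real"
  assumes V: "finite V" and sym: "\<And>a b. a \<in> V \<Longrightarrow> b \<in> V \<Longrightarrow> J a b = J b a" and D: "D \<subseteq> V" "D \<noteq> {}"
    and c: "\<bar>c\<bar> = 1"
  defines "f \<equiv> \<lambda>\<sigma>. c * (\<Sum>e\<in>D. spin_fluct V J h e \<sigma>)"
  assumes K: "\<And>\<sigma> e. \<sigma> \<in> spins V \<Longrightarrow> e \<in> D \<Longrightarrow> \<bar>f \<sigma> - f (flip_spin e \<sigma>)\<bar> \<le> K" "0 < K" and x: "0 \<le> x"
  shows "ising_exp V J h (\<lambda>\<sigma>. of_bool (x \<le> f \<sigma>)) \<le> exp (- (x\<^sup>2) / (4 * K * real (card D)))"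
proof -
  define k where "k = K * real (card D)"
  have k: "0 < k" using D K V finite_subset[OF D(1)] by (simp add: k_def card_gt_0_iff)
  \<comment> \<open>The minimizer of the Chernoff exponent \<open>k * y^2 - y * x\<close>, with
    value \<open>- x^2 / (4 * k)\<close>.\<close>
  define y where "y = x / (2 * k)"
  have y: "0 \<le> y" using x k by (simp add: y_def)
  have "ising_exp V J h (\<lambda>\<sigma>. of_bool (x \<le> f \<sigma>)) \<le> ising_exp V J h (\<lambda>\<sigma>. exp (- y * x) * exp (y * f \<sigma>))"
    using y by (intro ising_exp_mono V) (auto simp: mult_left_mono simp flip: exp_add)
  also have "\<dots> \<le> exp (- y * x) * exp (k * y\<^sup>2)"
    using ising_mgf_bound[OF V sym D(1) c, where h = h and K = K and x = y] K(1) y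
    unfolding ising_exp_cmult k_def f_def by (intro mult_left_mono) auto
  also have "\<dots> = exp (- (x\<^sup>2) / (4 * k))"
    using k by (simp add: y_def power2_eq_square field_simps flip: exp_add)
  finally show ?thesis by (simp add: k_def mult.assoc)
qed

text \<open>The flipped spin changes its own term by 2, and since \<open>tanh\<close> is 1-Lipschitz
  any other term \<open>e\<close> moves by at most \<open>2 * J e g\<close>. The column sums of
  \<open>J\<close> then give a bound that does not grow with \<open>D\<close>, whatever the size of
  \<open>\<kappa>\<close>.\<close>

lemma spin_fluct_sum_flip:
  assumes V: "finite V" and J: "\<And>a b. a \<in> V \<Longrightarrow> b \<in> V \<Longrightarrow> 0 \<le> J a b"
    and \<kappa>: "\<And>b. b \<in> V \<Longrightarrow> (\<Sum>a\<in>V. J a b) \<le> \<kappa>"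
    and D: "D \<subseteq> V" and s: "\<sigma> \<in> spins V" and g: "g \<in> V"
  shows "\<bar>(\<Sum>e\<in>D. spin_fluct V J h e \<sigma>) - (\<Sum>e\<in>D. spin_fluct V J h e (flip_spin g \<sigma>))\<bar> \<le> 2 + 2 * \<kappa>"
proof -
  have gb: "\<bar>\<sigma> g\<bar> = 1" using spin_values[OF s g] by auto
  have le: "\<bar>spin_fluct V J h e \<sigma> - spin_fluct V J h e (flip_spin g \<sigma>)\<bar> \<le> (if e = g then 2 else 0) + 2 * J e g"
    if e: "e \<in> V" for e
  proof (cases "e = g")
    case True
    then show ?thesis using gb J[OF e e] by (simp add: spin_fluct_def)
  next
    case False
    have "local_field V J h e \<sigma> - local_field V J h e (flip_spin g \<sigma>) = (\<Sum>b\<in>V - {e}. if b = g then 2 * J e g * \<sigma> g else 0)"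
      unfolding local_field_def by (simp flip: sum_subtractf) (intro sum.cong, auto)
    also have "\<dots> = 2 * J e g * \<sigma> g" using V g False by simp
    finally have "\<bar>local_field V J h e \<sigma> - local_field V J h e (flip_spin g \<sigma>)\<bar> = 2 * J e g"
      using gb J[OF e g] by (simp add: abs_mult)
    then show ?thesis
      using False tanh_lipschitz[of "local_field V J h e \<sigma>" "local_field V J h e (flip_spin g \<sigma>)"]
      by (simp add: spin_fluct_def abs_minus_commute)
  qed
  have "\<bar>(\<Sum>e\<in>D. spin_fluct V J h e \<sigma>) - (\<Sum>e\<in>D. spin_fluct V J h e (flip_spin g \<sigma>))\<bar>
    \<le> (\<Sum>e\<in>D. \<bar>spin_fluct V J h e \<sigma> - spin_fluct V J h e (flip_spin g \<sigma>)\<bar>)"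
    by (simp add: sum_abs flip: sum_subtractf)
  also have "\<dots> \<le> (\<Sum>e\<in>D. (if e = g then 2 else 0) + 2 * J e g)"
    using D by (intro sum_mono le) auto
  also have "\<dots> \<le> (\<Sum>e\<in>V. (if e = g then 2 else 0) + 2 * J e g)"
    using D by (intro sum_mono2 V) (auto intro!: add_nonneg_nonneg J g)
  also have "\<dots> = 2 + 2 * (\<Sum>e\<in>V. J e g)"
    using V g by (simp add: sum.distrib flip: sum_distrib_left)
  finally show ?thesis using \<kappa>[OF g] by linarith
qed

lemma ising_concentration:
  assumes V: "finite V" and sym: "\<And>a b. a \<in> V \<Longrightarrow> b \<in> V \<Longrightarrow> J a b = J b a"
    and J: "\<And>a b. a \<in> V \<Longrightarrow> b \<in> V \<Longrightarrow> 0 \<le> J a b"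
    and \<kappa>: "\<And>b. b \<in> V \<Longrightarrow> (\<Sum>a\<in>V. J a b) \<le> \<kappa>"
    and D: "D \<subseteq> V" "D \<noteq> {}" and x: "0 \<le> x"
  shows "ising_exp V J h (\<lambda>\<sigma>. of_bool (x \<le> \<bar>\<Sum>e\<in>D. spin_fluct V J h e \<sigma>\<bar>))
    \<le> 2 * exp (- (x\<^sup>2) / (8 * (1 + \<kappa>) * real (card D)))"
proof -
  let ?S = "\<lambda>\<sigma>. \<Sum>e\<in>D. spin_fluct V J h e \<sigma>"
  have "0 \<le> \<kappa>"
    using D \<kappa> J by (metis all_not_in_conv order.trans subsetD sum_nonneg)
  then have K: "0 < 2 + 2 * \<kappa>" by simp
  have *: "ising_exp V J h (\<lambda>\<sigma>. of_bool (x \<le> c * ?S \<sigma>)) \<le> exp (- (x\<^sup>2) / (4 * (2 + 2 * \<kappa>) * real (card D)))"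
    if c: "\<bar>c\<bar> = 1" for c :: real
  proof (rule ising_concentration_aux[OF V sym D c _ K x])
    fix \<sigma> e assume "\<sigma> \<in> spins V" "e \<in> D"
    then show "\<bar>c * ?S \<sigma> - c * ?S (flip_spin e \<sigma>)\<bar> \<le> 2 + 2 * \<kappa>"
      using spin_fluct_sum_flip[OF V J \<kappa> D(1), where \<sigma> = \<sigma> and g = e and h = h] D(1) c
      by (auto simp: abs_mult simp flip: right_diff_distrib)
  qed
  have "ising_exp V J h (\<lambda>\<sigma>. of_bool (x \<le> \<bar>?S \<sigma>\<bar>)) \<le>
      ising_exp V J h (\<lambda>\<sigma>. of_bool (x \<le> 1 * ?S \<sigma>) + of_bool (x \<le> (-1) * ?S \<sigma>))"
    by (intro ising_exp_mono V) (auto simp: abs_if)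
  also have "\<dots> \<le> 2 * exp (- (x\<^sup>2) / (4 * (2 + 2 * \<kappa>) * real (card D)))"
    unfolding ising_exp_add using *[of 1] *[of "-1"] by simp
  finally show ?thesis by (simp add: algebra_simps)
qed

section \<open>The two-star model as an Ising model on the edges\<close>

definition inc :: "nat \<Rightarrow> nat \<times> nat \<Rightarrow> real" where
  "inc i e = of_bool (i = fst e \<or> i = snd e)"

text \<open>Expanding the squared degrees couples two edges once for each shared endpoint. The
  diagonal entry contributes only a constant to the energy, because spins square to 1.\<close>

definition two_star_J :: "nat \<Rightarrow> real \<Rightarrow> nat \<times> nat \<Rightarrow> nat \<times> nat \<Rightarrow> real" where
  "two_star_J n \<theta> e f = \<theta> / (real n - 1) * (\<Sum>i=1..n. inc i e * inc i f)"

definition two_star_h :: "(nat \<Rightarrow> real) \<Rightarrow> nat \<times> nat \<Rightarrow> real" where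
  "two_star_h \<beta> e = (\<beta> (fst e) + \<beta> (snd e)) / 2"

definition to_config :: "nat \<Rightarrow> (nat \<times> nat \<Rightarrow> real) \<Rightarrow> config" where
  "to_config n \<sigma> i j =
     (if (i, j) \<in> edges n then \<sigma> (i, j) else if (j, i) \<in> edges n then \<sigma> (j, i) else 0)"

lemma finite_edges: "finite (edges n)"
  by (rule finite_subset[of _ "{1..n} \<times> {1..n}"]) (auto simp: edges_def)

lemma inc_nonneg: "0 \<le> inc i e"
  by (simp add: inc_def)

lemma inc_square: "inc i e * inc i e = inc i e"
  by (simp add: inc_def)

lemma incident_edges_subset: "incident_edges n i \<subseteq> edges n"
  by (auto simp: incident_edges_def)

lemma sum_incident_edges:
  "(\<Sum>e\<in>incident_edges n i. g e) = (\<Sum>e\<in>edges n. inc i e * g e :: real)"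
  unfolding incident_edges_def inc_def
  by (subst sum.inter_filter[OF finite_edges]) (intro sum.cong, auto)

lemma sum_incident_edges_vertices:
  fixes g :: "nat \<times> nat \<Rightarrow> real"
  assumes "i \<in> {1..n}"
  shows "(\<Sum>e\<in>incident_edges n i. g e) = (\<Sum>j\<in>{1..n} - {i}. g (min i j, max i j))"
  by (rule sum.reindex_bij_witness[of _ "\<lambda>j. (min i j, max i j)" "\<lambda>e. if fst e = i then snd e else fst e"])
     (use assms in \<open>auto simp: incident_edges_def edges_def min_def max_def split: if_splits\<close>)

lemma card_incident_edges: "i \<in> {1..n} \<Longrightarrow> real (card (incident_edges n i)) = real n - 1"
  using sum_incident_edges_vertices[of i n "\<lambda>_. 1"] by (simp add: of_nat_diff)

lemma sum_inc_edges: "i \<in> {1..n} \<Longrightarrow> (\<Sum>e\<in>edges n. inc i e) = real n - 1"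
  using sum_incident_edges[of "\<lambda>_. 1" n i] card_incident_edges[of i n] by simp

lemma sum_inc_vertices:
  assumes "e \<in> edges n"
  shows "(\<Sum>i=1..n. \<beta> i * inc i e) = \<beta> (fst e) + \<beta> (snd e)"
proof -
  obtain a b where e: "e = (a, b)" "1 \<le> a" "a < b" "b \<le> n"
    using assms by (auto simp: edges_def)
  have "(\<Sum>i=1..n. \<beta> i * inc i e) = (\<Sum>i=1..n. (if i = a then \<beta> i else 0) + (if i = b then \<beta> i else 0))"
    using e by (intro sum.cong) (simp_all add: inc_def)
  then show ?thesis using e by (simp add: sum.distrib)
qed

lemma card_edges: "2 * real (card (edges n)) = real n * (real n - 1)"
proof -
  have "(\<Sum>e\<in>edges n. \<Sum>i=1..n. inc i e) = (\<Sum>e\<in>edges n. 2)"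
    using sum_inc_vertices[of _ n "\<lambda>_. 1"] by (intro sum.cong) auto
  then have "2 * real (card (edges n)) = (\<Sum>e\<in>edges n. \<Sum>i=1..n. inc i e)" by simp
  also have "\<dots> = (\<Sum>i=1..n. \<Sum>e\<in>edges n. inc i e)" by (rule sum.swap)
  also have "\<dots> = (\<Sum>i=1..n. real n - 1)" by (intro sum.cong sum_inc_edges) auto
  finally show ?thesis by simp
qed

lemma edge_val_to_config [simp]: "e \<in> edges n \<Longrightarrow> edge_val (to_config n \<sigma>) e = \<sigma> e"
  by (simp add: edge_val_def to_config_def)

lemma to_config_in_configs: "\<sigma> \<in> spins (edges n) \<Longrightarrow> to_config n \<sigma> \<in> configs n"
  using spin_values[of \<sigma> "edges n"]
  by (auto simp: configs_def to_config_def edges_def not_less; force)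

lemma to_config_edge_val:
  assumes "Y \<in> configs n"
  shows "to_config n (restrict (edge_val Y) (edges n)) = Y"
proof (intro ext)
  fix i j
  have sym: "Y i j = Y j i" using assms by (simp add: configs_def)
  have zero: "Y i j = 0" if "(i, j) \<notin> edges n" "(j, i) \<notin> edges n"
    using assms that by (auto simp: configs_def edges_def)
  show "to_config n (restrict (edge_val Y) (edges n)) i j = Y i j"
    using sym zero by (simp add: to_config_def edge_val_def)
qed

lemma bij_betw_to_config: "bij_betw (to_config n) (spins (edges n)) (configs n)"
proof (rule bij_betw_byWitness[where f' = "\<lambda>Y. restrict (edge_val Y) (edges n)"])
  show "\<forall>\<sigma>\<in>spins (edges n). restrict (edge_val (to_config n \<sigma>)) (edges n) = \<sigma>"
    by (auto simp: spins_def fun_eq_iff PiE_iff extensional_def)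
  show "\<forall>Y\<in>configs n. to_config n (restrict (edge_val Y) (edges n)) = Y"
    by (simp add: to_config_edge_val)
  show "to_config n ` spins (edges n) \<subseteq> configs n"
    by (auto intro: to_config_in_configs)
  show "(\<lambda>Y. restrict (edge_val Y) (edges n)) ` configs n \<subseteq> spins (edges n)"
  proof (intro subsetI, elim imageE)
    fix \<sigma> Y assume \<sigma>: "\<sigma> = restrict (edge_val Y) (edges n)" and Y: "Y \<in> configs n"
    have "edge_val Y e \<in> {-1, 1}" if "e \<in> edges n" for e
    proof -
      have "if i \<in> {1..n} \<and> j \<in> {1..n} \<and> i \<noteq> j then Y i j \<in> {-1, 1} else Y i j = 0" for i j
        using Y unfolding configs_def by blast
      from this[of "fst e" "snd e"] show ?thesis
        using that by (auto simp: edges_def edge_val_def)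
    qed
    then show "\<sigma> \<in> spins (edges n)" unfolding \<sigma> spins_def by simp
  qed
qed

lemma sum_configs: "(\<Sum>Y\<in>configs n. F Y) = (\<Sum>\<sigma>\<in>spins (edges n). F (to_config n \<sigma>))"
  by (rule sum.reindex_bij_betw[OF bij_betw_to_config, symmetric])

lemma deg_to_config:
  assumes "i \<in> {1..n}"
  shows "deg n (to_config n \<sigma>) i = (\<Sum>e\<in>incident_edges n i. \<sigma> e)"
proof -
  have "deg n (to_config n \<sigma>) i = (\<Sum>j\<in>{1..n} - {i}. to_config n \<sigma> i j)"
    unfolding deg_def using assms
    by (subst sum.remove[of _ i]) (auto simp: to_config_def edges_def)
  also have "\<dots> = (\<Sum>j\<in>{1..n} - {i}. \<sigma> (min i j, max i j))"
    using assms by (intro sum.cong) (auto simp: to_config_def edges_def min_def max_def)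
  finally show ?thesis using sum_incident_edges_vertices[OF assms] by simp
qed

lemma sum_deg_to_config:
  "(\<Sum>i=1..n. \<beta> i * deg n (to_config n \<sigma>) i) = (\<Sum>e\<in>edges n. (\<beta> (fst e) + \<beta> (snd e)) * \<sigma> e)"
proof -
  have "(\<Sum>i=1..n. \<beta> i * deg n (to_config n \<sigma>) i) = (\<Sum>i=1..n. \<Sum>e\<in>edges n. \<beta> i * inc i e * \<sigma> e)"
    by (intro sum.cong) (auto simp: deg_to_config sum_incident_edges sum_distrib_left mult.assoc)
  also have "\<dots> = (\<Sum>e\<in>edges n. (\<Sum>i=1..n. \<beta> i * inc i e) * \<sigma> e)"
    by (subst sum.swap) (simp add: sum_distrib_right)
  also have "\<dots> = (\<Sum>e\<in>edges n. (\<beta> (fst e) + \<beta> (snd e)) * \<sigma> e)"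
    by (intro sum.cong refl) (simp only: sum_inc_vertices)
  finally show ?thesis .
qed

definition two_star_const :: "nat \<Rightarrow> real \<Rightarrow> real" where
  "two_star_const n \<theta> = exp (\<theta> / (real n - 1) * - (real n * (real n - 1) / 2))"

lemma two_star_weight_to_config:
  "two_star_weight n \<theta> \<beta> (to_config n \<sigma>) =
     two_star_const n \<theta> * ising_weight (edges n) (two_star_J n \<theta>) (two_star_h \<beta>) \<sigma>"
proof -
  have "(\<Sum>i=1..n. (deg n (to_config n \<sigma>) i)\<^sup>2) =
      (\<Sum>i=1..n. \<Sum>e\<in>edges n. \<Sum>f\<in>edges n. inc i e * inc i f * (\<sigma> e * \<sigma> f))"
    by (intro sum.cong) (auto simp: deg_to_config sum_incident_edges power2_eq_square sum_product mult_ac)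
  also have "\<dots> = (\<Sum>e\<in>edges n. \<Sum>i=1..n. \<Sum>f\<in>edges n. inc i e * inc i f * (\<sigma> e * \<sigma> f))"
    by (rule sum.swap)
  also have "\<dots> = (\<Sum>e\<in>edges n. \<Sum>f\<in>edges n. \<Sum>i=1..n. inc i e * inc i f * (\<sigma> e * \<sigma> f))"
    by (rule sum.cong[OF refl], rule sum.swap)
  also have "\<dots> = (\<Sum>e\<in>edges n. \<Sum>f\<in>edges n. (\<Sum>i=1..n. inc i e * inc i f) * (\<sigma> e * \<sigma> f))"
    by (simp add: sum_distrib_right)
  finally have "\<theta> / (real n - 1) * (1/2 * (\<Sum>i=1..n. (deg n (to_config n \<sigma>) i)\<^sup>2)) =
      (\<Sum>e\<in>edges n. \<Sum>f\<in>edges n. two_star_J n \<theta> e f * (\<sigma> e * \<sigma> f)) / 2"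
    by (simp only: two_star_J_def mult.assoc sum_distrib_left[symmetric])
  moreover have "1/2 * (\<Sum>i=1..n. \<beta> i * deg n (to_config n \<sigma>) i) = (\<Sum>e\<in>edges n. two_star_h \<beta> e * \<sigma> e)"
    by (simp only: sum_deg_to_config) (simp add: two_star_h_def sum_distrib_left)
  ultimately show ?thesis
    unfolding two_star_weight_def ising_weight_def two_star_const_def
    by (simp only: right_diff_distrib flip: exp_add) (simp add: algebra_simps)
qed

lemma two_star_Z_ising:
  "two_star_Z n \<theta> \<beta> = two_star_const n \<theta> * ising_Z (edges n) (two_star_J n \<theta>) (two_star_h \<beta>)"
  by (simp add: two_star_Z_def sum_configs two_star_weight_to_config ising_Z_def sum_distrib_left)

lemma sum_two_star_ising:
  "(\<Sum>Y\<in>configs n. F Y * (two_star_weight n \<theta> \<beta> Y / two_star_Z n \<theta> \<beta>)) =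
     ising_exp (edges n) (two_star_J n \<theta>) (two_star_h \<beta>) (\<lambda>\<sigma>. F (to_config n \<sigma>))"
  by (simp add: sum_configs two_star_weight_to_config two_star_Z_ising ising_exp_def
      two_star_const_def sum_divide_distrib)

lemma prob_two_star:
  "measure_pmf.prob (two_star_pmf n \<theta> \<beta>) X =
     (\<Sum>Y\<in>configs n. of_bool (Y \<in> X) * (two_star_weight n \<theta> \<beta> Y / two_star_Z n \<theta> \<beta>))"
proof -
  have "measure_pmf.prob (two_star_pmf n \<theta> \<beta>) X = measure_pmf.prob (two_star_pmf n \<theta> \<beta>) (X \<inter> configs n)"
    by (metis measure_Int_set_pmf set_pmf_two_star)
  also have "\<dots> = (\<Sum>Y\<in>X \<inter> configs n. pmf (two_star_pmf n \<theta> \<beta>) Y)"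
    by (simp add: measure_measure_pmf_finite finite_configs)
  also have "\<dots> = (\<Sum>Y\<in>configs n. if Y \<in> X then pmf (two_star_pmf n \<theta> \<beta>) Y else 0)"
    by (subst sum.inter_filter[symmetric]) (auto simp: finite_configs intro: sum.cong)
  also have "\<dots> = (\<Sum>Y\<in>configs n. of_bool (Y \<in> X) * (two_star_weight n \<theta> \<beta> Y / two_star_Z n \<theta> \<beta>))"
    by (intro sum.cong) (auto simp: pmf_two_star)
  finally show ?thesis .
qed

lemma prob_two_star_ising:
  "measure_pmf.prob (two_star_pmf n \<theta> \<beta>) X =
     ising_exp (edges n) (two_star_J n \<theta>) (two_star_h \<beta>) (\<lambda>\<sigma>. of_bool (to_config n \<sigma> \<in> X))"
  unfolding prob_two_star by (rule sum_two_star_ising)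

lemma two_star_J_sym: "two_star_J n \<theta> e f = two_star_J n \<theta> f e"
  by (simp add: two_star_J_def mult.commute)

lemma two_star_J_nonneg: "0 < \<theta> \<Longrightarrow> 2 \<le> n \<Longrightarrow> 0 \<le> two_star_J n \<theta> e f"
  unfolding two_star_J_def
  by (intro mult_nonneg_nonneg divide_nonneg_nonneg sum_nonneg) (auto simp: inc_nonneg)

text \<open>Each of the two endpoints has \<open>n - 1\<close> incident edges of strength
  \<open>\<theta> / (n - 1)\<close>. The value is free of \<open>n\<close>, so it serves as
  \<open>\<kappa>\<close> in the concentration bound; at zero field, its being below 1 is the
  condition \<open>\<theta> < 1/2\<close>.\<close>

lemma two_star_J_row_sum:
  assumes "2 \<le> n" "e \<in> edges n"
  shows "(\<Sum>f\<in>edges n. two_star_J n \<theta> e f) = 2 * \<theta>"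
proof -
  have "(\<Sum>f\<in>edges n. two_star_J n \<theta> e f) = \<theta> / (real n - 1) * (\<Sum>f\<in>edges n. \<Sum>i=1..n. inc i e * inc i f)"
    unfolding two_star_J_def by (rule sum_distrib_left[symmetric])
  also have "(\<Sum>f\<in>edges n. \<Sum>i=1..n. inc i e * inc i f) = (\<Sum>i=1..n. \<Sum>f\<in>edges n. inc i e * inc i f)"
    by (rule sum.swap)
  also have "\<dots> = (\<Sum>i=1..n. inc i e * (\<Sum>f\<in>edges n. inc i f))"
    by (simp add: sum_distrib_left)
  also have "(\<Sum>i=1..n. inc i e * (\<Sum>f\<in>edges n. inc i f)) = (\<Sum>i=1..n. (real n - 1) * inc i e)"
    by (intro sum.cong) (auto simp: sum_inc_edges)
  also have "\<dots> = (real n - 1) * 2"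
    using sum_inc_vertices[OF assms(2), of "\<lambda>_. 1"] by (simp flip: sum_distrib_left)
  finally show ?thesis using assms(1) by (simp add: divide_eq_eq)
qed

text \<open>A bound uniform in \<open>n\<close> keeps \<open>tanh\<close> away from saturation, so
  that a shift of the field moves the conditional means proportionally.\<close>

lemma two_star_local_field_bound:
  assumes n: "2 \<le> n" and \<theta>: "0 < \<theta>" and e: "e \<in> edges n" and s: "\<sigma> \<in> spins (edges n)"
  shows "\<bar>local_field (edges n) (two_star_J n \<theta>) (two_star_h (\<lambda>_. \<beta>0)) e \<sigma>\<bar> \<le> 2 * \<theta> + \<bar>\<beta>0\<bar>"
proof -
  let ?J = "two_star_J n \<theta>"
  have "\<bar>\<Sum>b\<in>edges n - {e}. ?J e b * \<sigma> b\<bar> \<le> (\<Sum>b\<in>edges n - {e}. \<bar>?J e b * \<sigma> b\<bar>)" by (rule sum_abs)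
  also have "\<dots> = (\<Sum>b\<in>edges n - {e}. ?J e b)"
    using two_star_J_nonneg[OF \<theta> n] by (intro sum.cong refl) (auto simp: abs_mult dest!: spin_values[OF s])
  also have "\<dots> \<le> (\<Sum>b\<in>edges n. ?J e b)"
    by (intro sum_mono2 finite_edges) (auto simp: two_star_J_nonneg \<theta> n)
  finally have "\<bar>\<Sum>b\<in>edges n - {e}. ?J e b * \<sigma> b\<bar> \<le> 2 * \<theta>" using two_star_J_row_sum[OF n e] by simp
  then show ?thesis
    using abs_triangle_ineq[of "\<Sum>b\<in>edges n - {e}. ?J e b * \<sigma> b" \<beta>0]
    by (simp add: local_field_def two_star_h_def)
qed

text \<open>Fixing all other edges leaves two configurations, whose weights share every factor
  except the exponential of plus or minus the local field.\<close>

lemma edge_cond_exp_to_config: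
  assumes e: "e \<in> edges n" and s: "\<sigma> \<in> spins (edges n)"
  shows "edge_cond_exp n \<theta> \<beta> e (to_config n \<sigma>) =
    tanh (local_field (edges n) (two_star_J n \<theta>) (two_star_h \<beta>) e \<sigma>)"
proof -
  let ?J = "two_star_J n \<theta>" and ?h = "two_star_h \<beta>"
  let ?p = "two_star_pmf n \<theta> \<beta>" and ?H = "local_field (edges n) ?J ?h e \<sigma>"
  define B where "B = {Y'. \<forall>f\<in>edges n - {e}. edge_val Y' f = edge_val (to_config n \<sigma>) f}"
  define Y Y' where "Y = to_config n \<sigma>" and "Y' = to_config n (flip_spin e \<sigma>)"
  have s': "flip_spin e \<sigma> \<in> spins (edges n)" using e s by (rule flip_spin_in_spins)
  have Ye: "edge_val Y e = \<sigma> e" "edge_val Y' e = - \<sigma> e" using e by (simp_all add: Y_def Y'_def)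
  then have ne: "Y \<noteq> Y'" using spin_values[OF s e] by force
  have YB: "Y \<in> B" "Y' \<in> B" by (auto simp: B_def Y_def Y'_def)
  have YC: "Y \<in> configs n" "Y' \<in> configs n" using s s' by (auto simp: Y_def Y'_def intro: to_config_in_configs)
  \<comment> \<open>The event \<open>B\<close> also contains matrices that are not configurations,
    so it is first cut down to the support of the law.\<close>
  have cB: "configs n \<inter> B = {Y, Y'}"
  proof
    show "configs n \<inter> B \<subseteq> {Y, Y'}"
    proof
      fix X assume X: "X \<in> configs n \<inter> B"
      then obtain \<tau> where t: "\<tau> \<in> spins (edges n)" "X = to_config n \<tau>"
        using bij_betw_to_config[of n] by (auto simp: bij_betw_def)
      have off: "\<tau> f = \<sigma> f" if "f \<noteq> e" for f
      proof (cases "f \<in> edges n")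
        case True
        then have "edge_val X f = edge_val (to_config n \<sigma>) f" using X that by (simp add: B_def)
        then show ?thesis using True by (simp add: t(2))
      next
        case False
        then show ?thesis using t(1) s unfolding spins_def by (metis PiE_arb)
      qed
      have "\<tau> e = \<sigma> e \<or> \<tau> e = - \<sigma> e"
        using spin_values[OF s e] spin_values[OF t(1) e] by auto
      with off have "\<tau> = \<sigma> \<or> \<tau> = flip_spin e \<sigma>"
        unfolding flip_spin_def by (metis ext fun_upd_other fun_upd_same)
      then show "X \<in> {Y, Y'}" by (auto simp: t(2) Y_def Y'_def)
    qed
  qed (use YB YC in auto)
  have pB: "measure_pmf.prob ?p B = pmf ?p Y + pmf ?p Y'"
  proof -
    have "measure_pmf.prob ?p B = measure_pmf.prob ?p (B \<inter> set_pmf ?p)"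
      by (simp add: measure_Int_set_pmf)
    also have "B \<inter> set_pmf ?p = {Y, Y'}" using cB by (simp add: set_pmf_two_star Int_commute)
    finally show ?thesis using ne by (simp add: measure_measure_pmf_finite)
  qed
  have nonempty: "set_pmf ?p \<inter> B \<noteq> {}" using cB by (auto simp: set_pmf_two_star)
  define k where "k = two_star_const n \<theta> * rest_weight (edges n) ?J ?h e \<sigma> / two_star_Z n \<theta> \<beta>"
  have k: "0 < k"
    unfolding k_def using two_star_Z_pos[of n \<theta> \<beta>] by (simp add: two_star_const_def rest_weight_def)
  have split: "ising_weight (edges n) ?J ?h \<tau> = rest_weight (edges n) ?J ?h e \<tau> *
      exp (\<tau> e * local_field (edges n) ?J ?h e \<tau>)" if "\<tau> \<in> spins (edges n)" for \<tau>
    by (rule ising_weight_split[OF finite_edges _ e that]) (rule two_star_J_sym)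
  have w: "pmf ?p Y = k * exp (\<sigma> e * ?H)" "pmf ?p Y' = k * exp (- \<sigma> e * ?H)"
    using YC split[OF s] split[OF s']
    by (simp_all add: pmf_two_star k_def Y_def Y'_def two_star_weight_to_config)
  have "edge_cond_exp n \<theta> \<beta> e (to_config n \<sigma>) =
      (\<Sum>X\<in>{Y, Y'}. edge_val X e * pmf (cond_pmf ?p B) X)"
    unfolding edge_cond_exp_def B_def[symmetric]
    using cB nonempty by (intro integral_measure_pmf_real) (auto simp: set_cond_pmf set_pmf_two_star)
  also have "\<dots> = (\<sigma> e * pmf ?p Y - \<sigma> e * pmf ?p Y') / (pmf ?p Y + pmf ?p Y')"
    using ne YB by (simp add: pmf_cond[OF nonempty] pB Ye diff_divide_distrib)
  also have "\<dots> = tanh ?H"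
  proof -
    have "k * exp ?H - k * exp (- ?H) = (2 * k) * sinh ?H" "k * exp ?H + k * exp (- ?H) = (2 * k) * cosh ?H"
      by (simp_all add: sinh_def cosh_def algebra_simps)
    then have "(k * exp ?H - k * exp (- ?H)) / (k * exp ?H + k * exp (- ?H)) = tanh ?H"
      using k by (simp add: tanh_def)
    then show ?thesis
      using spin_values[OF s e] unfolding w by (auto simp: add.commute)
  qed
  finally show ?thesis .
qed

lemma sum_centered_to_config:
  assumes "D \<subseteq> edges n" "\<sigma> \<in> spins (edges n)"
  shows "(\<Sum>e\<in>D. edge_val (to_config n \<sigma>) e - edge_cond_exp n \<theta> \<beta> e (to_config n \<sigma>)) =
    (\<Sum>e\<in>D. spin_fluct (edges n) (two_star_J n \<theta>) (two_star_h \<beta>) e \<sigma>)"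
  using assms by (intro sum.cong) (auto simp: edge_cond_exp_to_config spin_fluct_def)

section \<open>Power of the conditionally centered tests\<close>

lemma two_star_concentration:
  assumes n: "2 \<le> n" and \<theta>: "0 < \<theta>" and D: "D \<subseteq> edges n" "D \<noteq> {}" and m: "real (card D) \<le> m"
    and x: "0 \<le> x"
  shows "measure_pmf.prob (two_star_pmf n \<theta> \<beta>)
      {Y. x \<le> \<bar>\<Sum>e\<in>D. edge_val Y e - edge_cond_exp n \<theta> \<beta> e Y\<bar>}
    \<le> 2 * exp (- (x\<^sup>2) / (8 * (1 + 2 * \<theta>) * m))"
proof -
  have "measure_pmf.prob (two_star_pmf n \<theta> \<beta>)
      {Y. x \<le> \<bar>\<Sum>e\<in>D. edge_val Y e - edge_cond_exp n \<theta> \<beta> e Y\<bar>} =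
    ising_exp (edges n) (two_star_J n \<theta>) (two_star_h \<beta>)
      (\<lambda>\<sigma>. of_bool (x \<le> \<bar>\<Sum>e\<in>D. spin_fluct (edges n) (two_star_J n \<theta>) (two_star_h \<beta>) e \<sigma>\<bar>))"
    unfolding prob_two_star_ising
    by (intro ising_exp_cong) (simp add: sum_centered_to_config[OF D(1)])
  also have "\<dots> \<le> 2 * exp (- (x\<^sup>2) / (8 * (1 + 2 * \<theta>) * real (card D)))"
  proof (rule ising_concentration[OF finite_edges _ _ _ D x])
    show "(\<Sum>a\<in>edges n. two_star_J n \<theta> a b) \<le> 2 * \<theta>" if "b \<in> edges n" for b
      using two_star_J_row_sum[OF n that] by (simp add: two_star_J_sym[of n \<theta> _ b])
  qed (auto simp: two_star_J_sym two_star_J_nonneg \<theta> n)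
  also have "\<dots> \<le> 2 * exp (- (x\<^sup>2) / (8 * (1 + 2 * \<theta>) * m))"
  proof -
    have "0 < real (card D)" using D finite_subset[OF D(1) finite_edges] by (simp add: card_gt_0_iff)
    then show ?thesis using \<theta> m
      by (auto simp: divide_minus_left intro!: divide_left_mono mult_left_mono mult_pos_pos)
  qed
  finally show ?thesis .
qed

text \<open>Signal entries have no upper bound, so only a part \<open>d \<le> 1\<close> of the true
  shift \<open>d'\<close> is counted. On that stretch the argument stays within
  \<open>M + 1\<close>, where the slope is bounded below; monotonicity of \<open>tanh\<close> covers
  the rest.\<close>

lemma tanh_shift_lower:
  fixes x d d' M :: real
  assumes x: "\<bar>x\<bar> \<le> M" and d: "0 \<le> d" "d \<le> 1" "d \<le> d'"
  shows "d * (1 - tanh (M + 1) ^ 2) \<le> tanh (x + d') - tanh x"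
proof (cases "d = 0")
  case True
  then show ?thesis using d by simp
next
  case False
  then have "x < x + d" using d by simp
  then obtain z where z: "x < z" "z < x + d" "tanh (x + d) - tanh x = (x + d - x) * (1 - tanh z ^ 2)"
    by (rule tanh_diff_MVT)
  have "\<bar>z\<bar> \<le> M + 1" using x z d by linarith
  then have "\<bar>tanh z\<bar> \<le> tanh (M + 1)"
    by (simp flip: tanh_real_abs)
  then have "\<bar>tanh z\<bar> ^ 2 \<le> tanh (M + 1) ^ 2" by (intro power_mono) auto
  then have "d * (1 - tanh (M + 1) ^ 2) \<le> d * (1 - tanh z ^ 2)"
    using d by (intro mult_left_mono) auto
  also have "\<dots> = tanh (x + d) - tanh x" using z(3) by simp
  also have "\<dots> \<le> tanh (x + d') - tanh x" using d by simp
  finally show ?thesis .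
qed

lemma two_star_h_shift:
  assumes "e \<in> edges n"
  shows "two_star_h (\<lambda>i. \<beta>0 + \<mu> i) e = two_star_h (\<lambda>_. \<beta>0) e + (\<Sum>i=1..n. \<mu> i * inc i e) / 2"
  unfolding sum_inc_vertices[OF assms] two_star_h_def by (simp add: field_simps)

text \<open>The edge values are the same on both sides; only the conditional means change. Under the
  alternative the sum centered with the true parameter concentrates around 0, so the null-centered
  statistic exceeds a small quantity by a deterministic drift.\<close>

lemma centered_sum_drift:
  assumes n: "2 \<le> n" and \<theta>: "0 < \<theta>" and D: "D \<subseteq> edges n" and Y: "Y \<in> configs n"
    and A: "0 < A" "A \<le> 1" and \<mu>: "\<forall>i\<in>supp n \<mu>. A \<le> \<mu> i"
  shows "(\<Sum>e\<in>D. edge_val Y e - edge_cond_exp n \<theta> (\<lambda>_. \<beta>0) e Y) \<ge>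
    (\<Sum>e\<in>D. edge_val Y e - edge_cond_exp n \<theta> (\<lambda>i. \<beta>0 + \<mu> i) e Y) +
    A / 2 * (1 - tanh (2 * \<theta> + \<bar>\<beta>0\<bar> + 1) ^ 2) * (\<Sum>i\<in>supp n \<mu>. \<Sum>e\<in>D. inc i e)"
proof -
  let ?\<kappa> = "1 - tanh (2 * \<theta> + \<bar>\<beta>0\<bar> + 1) ^ 2" and ?S = "supp n \<mu>"
  obtain \<sigma> where s: "\<sigma> \<in> spins (edges n)" "Y = to_config n \<sigma>"
    using Y bij_betw_to_config[of n] by (auto simp: bij_betw_def)
  have S: "?S \<subseteq> {1..n}" by (auto simp: supp_def)
  \<comment> \<open>The counted shift is \<open>A / 2\<close> per endpoint in the support. It is at
    most 1, since an edge has two endpoints and \<open>A \<le> 1\<close>.\<close>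
  have one: "(A / 2 * (\<Sum>i\<in>?S. inc i e)) * ?\<kappa> \<le>
      edge_cond_exp n \<theta> (\<lambda>i. \<beta>0 + \<mu> i) e Y - edge_cond_exp n \<theta> (\<lambda>_. \<beta>0) e Y" if "e \<in> D" for e
  proof -
    have e: "e \<in> edges n" using D that by auto
    let ?H = "local_field (edges n) (two_star_J n \<theta>) (two_star_h (\<lambda>_. \<beta>0)) e \<sigma>"
    have H: "local_field (edges n) (two_star_J n \<theta>) (two_star_h (\<lambda>i. \<beta>0 + \<mu> i)) e \<sigma> =
      ?H + (\<Sum>i=1..n. \<mu> i * inc i e) / 2"
      using two_star_h_shift[OF e] by (simp add: local_field_def)
    have "(\<Sum>i\<in>?S. inc i e) \<le> (\<Sum>i=1..n. inc i e)"
      using S by (intro sum_mono2) (auto simp: inc_nonneg)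
    also have "\<dots> = 2" using sum_inc_vertices[OF e, of "\<lambda>_. 1"] by simp
    finally have "A / 2 * (\<Sum>i\<in>?S. inc i e) \<le> 1 / 2 * 2"
      using A by (intro mult_mono) (auto intro: sum_nonneg simp: inc_nonneg)
    moreover have "A * (\<Sum>i\<in>?S. inc i e) \<le> (\<Sum>i=1..n. \<mu> i * inc i e)"
    proof -
      have "A * (\<Sum>i\<in>?S. inc i e) \<le> (\<Sum>i\<in>?S. \<mu> i * inc i e)"
        unfolding sum_distrib_left using \<mu> by (intro sum_mono mult_right_mono inc_nonneg) auto
      also have "\<dots> = (\<Sum>i=1..n. \<mu> i * inc i e)"
        using S by (intro sum.mono_neutral_left) (auto simp: supp_def)
      finally show ?thesis .
    qed
    ultimately show ?thesis
      unfolding s(2) edge_cond_exp_to_config[OF e s(1)] H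
      using A by (intro tanh_shift_lower two_star_local_field_bound n \<theta> e s)
        (auto intro!: mult_nonneg_nonneg sum_nonneg simp: inc_nonneg)
  qed
  have "(\<Sum>e\<in>D. (A / 2 * (\<Sum>i\<in>?S. inc i e)) * ?\<kappa>) = A / 2 * ?\<kappa> * (\<Sum>e\<in>D. \<Sum>i\<in>?S. inc i e)"
    unfolding sum_distrib_right[symmetric] sum_distrib_left[symmetric] by (simp only: mult_ac)
  also have "(\<Sum>e\<in>D. \<Sum>i\<in>?S. inc i e) = (\<Sum>i\<in>?S. \<Sum>e\<in>D. inc i e)" by (rule sum.swap)
  moreover have "(\<Sum>e\<in>D. (A / 2 * (\<Sum>i\<in>?S. inc i e)) * ?\<kappa>) \<le>
      (\<Sum>e\<in>D. edge_cond_exp n \<theta> (\<lambda>i. \<beta>0 + \<mu> i) e Y - edge_cond_exp n \<theta> (\<lambda>_. \<beta>0) e Y)"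
    by (intro sum_mono one)
  ultimately show ?thesis by (simp only: sum_subtractf)
qed

section \<open>Membership in the alternative, and bounds for the risk of the two tests\<close>

lemma Xi_elim:
  assumes "\<beta> \<in> Xi n \<beta>0 s A" "0 < s"
  obtains \<mu> where "\<beta> = (\<lambda>i. \<beta>0 + \<mu> i)" "s \<le> real (card (supp n \<mu>))" "supp n \<mu> \<noteq> {}"
    "\<forall>i\<in>supp n \<mu>. A \<le> \<mu> i"
proof -
  obtain \<mu> where m: "\<beta> = (\<lambda>i. \<beta>0 + \<mu> i)" "s \<le> real (card (supp n \<mu>))" "A \<le> Min (\<mu> ` supp n \<mu>)"
    using assms(1) by (auto simp: Xi_def)
  have fin: "finite (supp n \<mu>)" by (simp add: supp_def)
  show ?thesis
  proof
    \<comment> \<open>Positivity of \<open>s\<close> excludes the empty support, for which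
      \<open>Min\<close> would carry no information.\<close>
    show "supp n \<mu> \<noteq> {}" using m(2) assms(2) by auto
    show "\<forall>i\<in>supp n \<mu>. A \<le> \<mu> i"
      by (intro ballI order.trans[OF m(3)]) (use fin in \<open>auto intro: Min_le\<close>)
  qed (use m in auto)
qed

lemma Xi_intro:
  assumes "S \<subseteq> {1..n}" "S \<noteq> {}" "s \<le> real (card S)" "0 < A"
  shows "(\<lambda>i. \<beta>0 + A * of_bool (i \<in> S)) \<in> Xi n \<beta>0 s A"
proof -
  have "supp n (\<lambda>i. A * of_bool (i \<in> S)) = S" using assms by (auto simp: supp_def)
  moreover have "(\<lambda>i. A * of_bool (i \<in> S)) ` S = {A}" using assms(2) by auto
  ultimately show ?thesis
    using assms(3) unfolding Xi_def by (intro CollectI exI[of _ "\<lambda>i. A * of_bool (i \<in> S)"]) auto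
qed

lemma Xi_nonempty: "1 \<le> n \<Longrightarrow> s \<le> real n \<Longrightarrow> 0 < A \<Longrightarrow> Xi n \<beta>0 s A \<noteq> {}"
  using Xi_intro[of "{1..n}" n s A \<beta>0] by auto

lemma risk_bdd: "bdd_above ((\<lambda>\<beta>. measure_pmf.prob (two_star_pmf n \<theta> \<beta>) {Y. T Y = 0}) ` X)"
  by (rule bdd_aboveI[of _ 1]) auto

text \<open>A real supremum is informative only over a nonempty bounded family; hence the hypothesis
  on \<open>Xi\<close> and the use of \<open>risk_bdd\<close>.\<close>

lemma risk_nonneg:
  assumes "Xi n \<beta>0 s A \<noteq> {}"
  shows "0 \<le> risk n \<theta> \<beta>0 s A T"
proof -
  obtain \<beta> where "\<beta> \<in> Xi n \<beta>0 s A" using assms by blast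
  then have "measure_pmf.prob (two_star_pmf n \<theta> \<beta>) {Y. T Y = 0} \<le>
      (SUP \<beta>\<in>Xi n \<beta>0 s A. measure_pmf.prob (two_star_pmf n \<theta> \<beta>) {Y. T Y = 0})"
    by (intro cSUP_upper risk_bdd)
  then show ?thesis unfolding risk_def
    by (smt (verit) measure_nonneg)
qed

lemma risk_le:
  assumes "Xi n \<beta>0 s A \<noteq> {}" and "measure_pmf.prob (two_star_pmf n \<theta> (\<lambda>_. \<beta>0)) {Y. T Y = 1} \<le> p"
    and "\<And>\<beta>. \<beta> \<in> Xi n \<beta>0 s A \<Longrightarrow> measure_pmf.prob (two_star_pmf n \<theta> \<beta>) {Y. T Y = 0} \<le> q"
  shows "risk n \<theta> \<beta>0 s A T \<le> p + q"
  unfolding risk_def using assms by (intro add_mono cSUP_least) auto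

lemma prob_two_star_mono:
  assumes "\<And>Y. Y \<in> configs n \<Longrightarrow> Y \<in> X \<Longrightarrow> Y \<in> X'"
  shows "measure_pmf.prob (two_star_pmf n \<theta> \<beta>) X \<le> measure_pmf.prob (two_star_pmf n \<theta> \<beta>) X'"
  unfolding prob_two_star_ising using assms
  by (intro ising_exp_mono finite_edges) (auto intro: to_config_in_configs)

text \<open>The hypothesis on \<open>L n\<close> makes the drift at least \<open>2 * L n\<close>.
  Acceptance under an alternative then forces the correctly centered sum below \<open>- L n\<close>,
  so both errors fall under the same two-sided bound.\<close>

lemma sum_test_risk:
  assumes n: "2 \<le> n" and \<theta>: "0 < \<theta>" and A: "0 < A" "A \<le> 1" and s: "0 < s" "s \<le> real n" and L: "0 < L n"
    and Ls: "L n \<le> (1 - tanh (2 * \<theta> + \<bar>\<beta>0\<bar> + 1) ^ 2) * A * s * (real n - 1) / 4"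
  shows "risk n \<theta> \<beta>0 s A (cond_centered_sum_test \<theta> \<beta>0 L n) \<le> 4 * exp (- (L n ^ 2) / (8 * (1 + 2 * \<theta>) * real n ^ 2))"
proof -
  let ?b = "2 * exp (- (L n ^ 2) / (8 * (1 + 2 * \<theta>) * real n ^ 2))"
  let ?\<kappa> = "1 - tanh (2 * \<theta> + \<bar>\<beta>0\<bar> + 1) ^ 2"
  let ?T = "cond_centered_sum_test \<theta> \<beta>0 L n"
  have \<kappa>: "0 \<le> ?\<kappa>" using tanh_real_bounds[of "2 * \<theta> + \<bar>\<beta>0\<bar> + 1"] by (simp add: abs_square_le_1 abs_le_iff less_imp_le)
  have card: "real (card (edges n)) \<le> real n ^ 2"
  proof -
    have "2 * real (card (edges n)) \<le> 2 * real n ^ 2"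
      unfolding card_edges using n by (simp add: power2_eq_square algebra_simps)
    then show ?thesis by simp
  qed
  have "(1, 2) \<in> edges n" using n by (simp add: edges_def)
  then have ne: "edges n \<noteq> {}" by blast
  note conc = two_star_concentration[OF n \<theta> subset_refl ne card less_imp_le[OF L]]
  let ?f = "\<lambda>\<beta> Y. \<Sum>e\<in>edges n. edge_val Y e - edge_cond_exp n \<theta> \<beta> e Y"
  have T1: "?T Y = 1 \<longleftrightarrow> L n < ?f (\<lambda>_. \<beta>0) Y" and T0: "?T Y = 0 \<longleftrightarrow> ?f (\<lambda>_. \<beta>0) Y \<le> L n" for Y
    unfolding cond_centered_sum_test_def by (simp_all add: not_less)
  have "risk n \<theta> \<beta>0 s A ?T \<le> ?b + ?b"
  proof (rule risk_le)
    show "Xi n \<beta>0 s A \<noteq> {}" using n s A by (intro Xi_nonempty) auto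
    show "measure_pmf.prob (two_star_pmf n \<theta> (\<lambda>_. \<beta>0)) {Y. ?T Y = 1} \<le> ?b"
      unfolding T1 by (rule order.trans[OF prob_two_star_mono conc[of "\<lambda>_. \<beta>0"]]) auto
    fix \<beta> assume "\<beta> \<in> Xi n \<beta>0 s A"
    then obtain \<mu> where \<mu>: "\<beta> = (\<lambda>i. \<beta>0 + \<mu> i)" "s \<le> real (card (supp n \<mu>))" "supp n \<mu> \<noteq> {}"
      "\<forall>i\<in>supp n \<mu>. A \<le> \<mu> i"
      using s(1) by (rule Xi_elim)
    have "(\<Sum>i\<in>supp n \<mu>. \<Sum>e\<in>edges n. inc i e) = (\<Sum>i\<in>supp n \<mu>. real n - 1)"
      by (intro sum.cong refl sum_inc_edges) (auto simp: supp_def)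
    then have S: "(\<Sum>i\<in>supp n \<mu>. \<Sum>e\<in>edges n. inc i e) = real (card (supp n \<mu>)) * (real n - 1)"
      by simp
    have "2 * L n \<le> 2 * (?\<kappa> * A * s * (real n - 1) / 4)" using Ls by (rule mult_left_mono) simp
    also have "\<dots> = A / 2 * ?\<kappa> * (s * (real n - 1))" by simp
    also have "\<dots> \<le> A / 2 * ?\<kappa> * (\<Sum>i\<in>supp n \<mu>. \<Sum>e\<in>edges n. inc i e)"
      unfolding S using A \<kappa> n \<mu>(2) by (intro mult_left_mono mult_right_mono) auto
    finally have drift: "2 * L n \<le> A / 2 * ?\<kappa> * (\<Sum>i\<in>supp n \<mu>. \<Sum>e\<in>edges n. inc i e)" .
    show "measure_pmf.prob (two_star_pmf n \<theta> \<beta>) {Y. ?T Y = 0} \<le> ?b"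
    proof (rule order.trans[OF prob_two_star_mono conc[of \<beta>]])
      fix Y assume Y: "Y \<in> configs n" "Y \<in> {Y. ?T Y = 0}"
      then have "?f (\<lambda>_. \<beta>0) Y \<le> L n" by (simp add: T0)
      then have "?f \<beta> Y \<le> - L n"
        using drift centered_sum_drift[OF n \<theta> subset_refl Y(1) A \<mu>(4), of \<beta>0]
        unfolding \<mu>(1) by linarith
      then show "Y \<in> {Y. L n \<le> \<bar>?f \<beta> Y\<bar>}" by simp
    qed
  qed
  then show ?thesis by simp
qed

text \<open>The constant \<open>C\<close> makes the tail probability of a single vertex at most
  \<open>2 / n^2\<close>, so a union over all vertices costs \<open>2 / n\<close>. Under the
  alternative one support vertex is enough for detection, which is why \<open>s\<close> is absent
  from the drift condition.\<close>

lemma max_test_risk: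
  fixes \<theta> :: real
  defines "C \<equiv> 4 * sqrt (1 + 2 * \<theta>)"
  assumes n: "2 \<le> n" and \<theta>: "0 < \<theta>" and A: "0 < A" "A \<le> 1" and s: "0 < s" "s \<le> real n"
    and Ls: "C * sqrt (real n * ln (real n)) \<le> (1 - tanh (2 * \<theta> + \<bar>\<beta>0\<bar> + 1) ^ 2) * A * (real n - 1) / 4"
  shows "risk n \<theta> \<beta>0 s A (cond_centered_max_test \<theta> \<beta>0 C n) \<le> 4 / real n"
proof -
  let ?x = "C * sqrt (real n * ln (real n))"
  let ?\<kappa> = "1 - tanh (2 * \<theta> + \<bar>\<beta>0\<bar> + 1) ^ 2"
  let ?T = "cond_centered_max_test \<theta> \<beta>0 C n"
  let ?f = "\<lambda>\<beta> i Y. \<Sum>e\<in>incident_edges n i. edge_val Y e - edge_cond_exp n \<theta> \<beta> e Y"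
  have \<kappa>: "0 \<le> ?\<kappa>" using tanh_real_bounds[of "2 * \<theta> + \<bar>\<beta>0\<bar> + 1"] by (simp add: abs_square_le_1 abs_le_iff less_imp_le)
  have x0: "0 \<le> ?x" using n \<theta> by (simp add: C_def)
  have C2: "C\<^sup>2 = 16 * (1 + 2 * \<theta>)" using \<theta> by (simp add: C_def power_mult_distrib)
  have x2: "?x\<^sup>2 = 16 * (1 + 2 * \<theta>) * (real n * ln (real n))"
    using n by (simp add: power_mult_distrib C2)
  have eb: "2 * exp (- (?x\<^sup>2) / (8 * (1 + 2 * \<theta>) * real n)) = 2 / (real n)\<^sup>2"
  proof -
    have "?x\<^sup>2 / (8 * (1 + 2 * \<theta>) * real n) = 2 * ln (real n)"
    proof -
      have "8 * (1 + 2 * \<theta>) * real n \<noteq> 0" using n \<theta> by simp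
      then show ?thesis unfolding x2 by (simp only: nonzero_divide_eq_eq[OF \<open>8 * (1 + 2 * \<theta>) * real n \<noteq> 0\<close>]) simp
    qed
    then have "exp (- (?x\<^sup>2) / (8 * (1 + 2 * \<theta>) * real n)) = inverse (exp (2 * ln (real n)))"
      by (simp add: exp_minus)
    also have "exp (2 * ln (real n)) = (real n)\<^sup>2" using n by (simp add: exp_double)
    finally show ?thesis by (simp add: divide_inverse)
  qed
  have conc: "measure_pmf.prob (two_star_pmf n \<theta> \<beta>) {Y. ?x \<le> \<bar>?f \<beta> i Y\<bar>} \<le> 2 / (real n)\<^sup>2"
    if i: "i \<in> {1..n}" for \<beta> i
  proof -
    have "real (card (incident_edges n i)) > 0" using card_incident_edges[OF i] n by simp
    then have "incident_edges n i \<noteq> {}" by auto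
    then show ?thesis
      using two_star_concentration[OF n \<theta> incident_edges_subset _ _ x0, of i "real n" \<beta>]
        card_incident_edges[OF i] eb by simp
  qed
  have max_less: "?x < (MAX i\<in>{1..n}. ?f (\<lambda>_. \<beta>0) i Y) \<longleftrightarrow> (\<exists>i\<in>{1..n}. ?x < ?f (\<lambda>_. \<beta>0) i Y)" for Y
    using n by (subst Max_gr_iff) auto
  have T1: "?T Y = 1 \<longleftrightarrow> (\<exists>i\<in>{1..n}. ?x < ?f (\<lambda>_. \<beta>0) i Y)" for Y
    unfolding cond_centered_max_test_def max_less by simp
  have T0: "?T Y = 0 \<longleftrightarrow> \<not> (\<exists>i\<in>{1..n}. ?x < ?f (\<lambda>_. \<beta>0) i Y)" for Y
    unfolding cond_centered_max_test_def max_less by simp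
  have "risk n \<theta> \<beta>0 s A ?T \<le> 2 / real n + 2 / real n"
  proof (rule risk_le)
    show "Xi n \<beta>0 s A \<noteq> {}" using n s A by (intro Xi_nonempty) auto
    have "measure_pmf.prob (two_star_pmf n \<theta> (\<lambda>_. \<beta>0)) {Y. ?T Y = 1} \<le>
      measure_pmf.prob (two_star_pmf n \<theta> (\<lambda>_. \<beta>0)) (\<Union>i\<in>{1..n}. {Y. ?x \<le> \<bar>?f (\<lambda>_. \<beta>0) i Y\<bar>})"
      unfolding T1 by (intro measure_pmf.finite_measure_mono) force+
    also have "\<dots> \<le> (\<Sum>i\<in>{1..n}. measure_pmf.prob (two_star_pmf n \<theta> (\<lambda>_. \<beta>0)) {Y. ?x \<le> \<bar>?f (\<lambda>_. \<beta>0) i Y\<bar>})"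
      by (rule measure_pmf.finite_measure_subadditive_finite) auto
    also have "\<dots> \<le> (\<Sum>i\<in>{1..n}. 2 / (real n)\<^sup>2)" by (intro sum_mono conc)
    also have "\<dots> = 2 / real n" by (simp add: power2_eq_square)
    finally show "measure_pmf.prob (two_star_pmf n \<theta> (\<lambda>_. \<beta>0)) {Y. ?T Y = 1} \<le> 2 / real n" .
    fix \<beta> assume "\<beta> \<in> Xi n \<beta>0 s A"
    then obtain \<mu> where \<mu>: "\<beta> = (\<lambda>i. \<beta>0 + \<mu> i)" "s \<le> real (card (supp n \<mu>))" "supp n \<mu> \<noteq> {}"
      "\<forall>i\<in>supp n \<mu>. A \<le> \<mu> i"
      using s(1) by (rule Xi_elim)
    obtain i where i: "i \<in> supp n \<mu>" using \<mu>(3) by blast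
    then have i': "i \<in> {1..n}" by (simp add: supp_def)
    \<comment> \<open>Further support vertices can only add to the drift of the sum at
      \<open>i\<close>.\<close>
    have "(\<Sum>e\<in>incident_edges n i. inc i e) \<le> (\<Sum>j\<in>supp n \<mu>. \<Sum>e\<in>incident_edges n i. inc j e)"
      using i by (intro member_le_sum) (auto intro: sum_nonneg simp: inc_nonneg supp_def)
    moreover have "(\<Sum>e\<in>incident_edges n i. inc i e) = real n - 1"
      using sum_inc_edges[OF i'] by (simp add: sum_incident_edges inc_square)
    ultimately have "A / 2 * ?\<kappa> * (real n - 1) \<le> A / 2 * ?\<kappa> * (\<Sum>j\<in>supp n \<mu>. \<Sum>e\<in>incident_edges n i. inc j e)"
      using A \<kappa> by (intro mult_left_mono) auto
    then have drift: "2 * ?x \<le> A / 2 * ?\<kappa> * (\<Sum>j\<in>supp n \<mu>. \<Sum>e\<in>incident_edges n i. inc j e)"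
      using Ls by (simp add: mult_ac)
    have "measure_pmf.prob (two_star_pmf n \<theta> \<beta>) {Y. ?T Y = 0} \<le>
       measure_pmf.prob (two_star_pmf n \<theta> \<beta>) {Y. ?x \<le> \<bar>?f \<beta> i Y\<bar>}"
    proof (rule prob_two_star_mono)
      fix Y assume Y: "Y \<in> configs n" "Y \<in> {Y. ?T Y = 0}"
      then have "?f (\<lambda>_. \<beta>0) i Y \<le> ?x" using i' by (auto simp: T0 not_less)
      then have "?f \<beta> i Y \<le> - ?x"
        using drift centered_sum_drift[OF n \<theta> incident_edges_subset Y(1) A \<mu>(4), of \<beta>0 i]
        unfolding \<mu>(1) by linarith
      then show "Y \<in> {Y. ?x \<le> \<bar>?f \<beta> i Y\<bar>}" by simp
    qed
    also have "\<dots> \<le> 2 / (real n)\<^sup>2" by (rule conc[OF i'])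
    also have "\<dots> \<le> 2 / real n"
      using n by (intro divide_left_mono) (auto simp: power2_eq_square)
    finally show "measure_pmf.prob (two_star_pmf n \<theta> \<beta>) {Y. ?T Y = 0} \<le> 2 / real n" .
  qed
  then show ?thesis by simp
qed

lemma sum_test_powerful:
  fixes s A L :: "nat \<Rightarrow> real"
  assumes \<theta>: "0 < \<theta>" and b: "0 < b" "b < 1" and t: "t < 0"
    and s: "\<And>n. s n = real n powr b" and A: "\<And>n. A n = real n powr t"
    and L: "\<forall>\<^sub>F n in sequentially. 0 < L n" "(\<lambda>n. real n) \<lless> L" "L \<lless> (\<lambda>n. real n * s n * A n)"
  shows "asymp_powerful \<theta> \<beta>0 s A (cond_centered_sum_test \<theta> \<beta>0 L)"
proof -
  let ?\<kappa> = "1 - tanh (2 * \<theta> + \<bar>\<beta>0\<bar> + 1) ^ 2"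
  have "tanh (2 * \<theta> + \<bar>\<beta>0\<bar> + 1) ^ 2 < 1"
    using tanh_real_bounds[of "2 * \<theta> + \<bar>\<beta>0\<bar> + 1"] by (simp add: abs_square_less_1 abs_less_iff)
  \<comment> \<open>The 8 combines the 4 in the hypothesis of \<open>sum_test_risk\<close> with
    \<open>n - 1 \<ge> n / 2\<close>.\<close>
  then have \<kappa>: "0 < ?\<kappa> / 8" by simp
  have "\<forall>\<^sub>F n in sequentially. L n / (real n * s n * A n) < ?\<kappa> / 8"
    using L(3) \<kappa> unfolding much_less_def by (rule order_tendstoD)
  with L(1) eventually_ge_at_top[of 2]
  have bound: "\<forall>\<^sub>F n in sequentially. 0 \<le> risk n \<theta> \<beta>0 (s n) (A n) (cond_centered_sum_test \<theta> \<beta>0 L n) \<and>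
     risk n \<theta> \<beta>0 (s n) (A n) (cond_centered_sum_test \<theta> \<beta>0 L n) \<le> 32 * (1 + 2 * \<theta>) * (real n / L n)\<^sup>2"
  proof eventually_elim
    case (elim n)
    have s0: "0 < s n" "s n \<le> real n"
      using elim b powr_mono[of b 1 "real n"] by (auto simp: s)
    have A0: "0 < A n" "A n \<le> 1"
      using elim t powr_mono[of t 0 "real n"] by (auto simp: A)
    have "L n < ?\<kappa> / 8 * (real n * s n * A n)"
      using elim s0 A0 by (simp add: pos_divide_less_eq)
    also have "\<dots> = ?\<kappa> * A n * s n * (real n / 2) / 4" by simp
    also have "\<dots> \<le> ?\<kappa> * A n * s n * (real n - 1) / 4"
      using elim s0 A0 \<kappa> by (intro divide_right_mono mult_left_mono mult_nonneg_nonneg) auto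
    finally have "risk n \<theta> \<beta>0 (s n) (A n) (cond_centered_sum_test \<theta> \<beta>0 L n)
        \<le> 4 * exp (- (L n ^ 2) / (8 * (1 + 2 * \<theta>) * real n ^ 2))"
      using elim \<theta> s0 A0 by (intro sum_test_risk) auto
    also have "\<dots> \<le> 4 * (8 * (1 + 2 * \<theta>) * real n ^ 2 / L n ^ 2)"
    proof -
      \<comment> \<open>The crude estimate \<open>exp (- z) \<le> 1 / z\<close> is enough, because
        \<open>n / L n\<close> tends to 0.\<close>
      let ?z = "L n ^ 2 / (8 * (1 + 2 * \<theta>) * real n ^ 2)"
      have z: "0 < ?z" using elim \<theta> by simp
      have "?z \<le> exp ?z" using exp_ge_add_one_self[of ?z] by linarith
      then have "inverse (exp ?z) \<le> inverse ?z" using z by (rule le_imp_inverse_le)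
      then show ?thesis by (simp add: exp_minus)
    qed
    also have "\<dots> = 32 * (1 + 2 * \<theta>) * (real n / L n)\<^sup>2"
      by (simp add: power_divide algebra_simps add_divide_distrib)
    finally show ?case
      using Xi_nonempty[OF _ s0(2) A0(1)] elim by (simp add: risk_nonneg)
  qed
  have "(\<lambda>n. 32 * (1 + 2 * \<theta>) * (real n / L n)\<^sup>2) \<longlonglongrightarrow> 32 * (1 + 2 * \<theta>) * 0\<^sup>2"
    using L(2) unfolding much_less_def by (intro tendsto_intros)
  then have lim: "(\<lambda>n. 32 * (1 + 2 * \<theta>) * (real n / L n)\<^sup>2) \<longlonglongrightarrow> 0" by simp
  show ?thesis
    unfolding asymp_powerful_def
  proof (rule tendsto_sandwich[OF _ _ tendsto_const lim])
  qed (use bound in \<open>eventually_elim; simp\<close>)+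
qed

lemma max_test_powerful:
  fixes s A :: "nat \<Rightarrow> real"
  assumes \<theta>: "0 < \<theta>" and b: "0 < b" "b < 1" and t: "t < 0" "0 < t + 1/2"
    and s: "\<And>n. s n = real n powr b" and A: "\<And>n. A n = real n powr t"
  shows "asymp_powerful \<theta> \<beta>0 s A (cond_centered_max_test \<theta> \<beta>0 (4 * sqrt (1 + 2 * \<theta>)))"
proof -
  let ?\<kappa> = "1 - tanh (2 * \<theta> + \<bar>\<beta>0\<bar> + 1) ^ 2" and ?C = "4 * sqrt (1 + 2 * \<theta>)"
  have "tanh (2 * \<theta> + \<bar>\<beta>0\<bar> + 1) ^ 2 < 1"
    using tanh_real_bounds[of "2 * \<theta> + \<bar>\<beta>0\<bar> + 1"] by (simp add: abs_square_less_1 abs_less_iff)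
  then have \<kappa>: "0 < ?\<kappa>" by simp
  have C: "0 < ?C" using \<theta> by simp
  \<comment> \<open>Squared and divided by \<open>n\<close>, the requirement that
    \<open>sqrt (n ln n)\<close> be small against \<open>n * A n\<close> says that
    \<open>ln n\<close> is small against \<open>n powr (2 * t + 1)\<close>.\<close>
  have "(\<lambda>n. ln (real n) / real n powr (2 * t + 1)) \<longlonglongrightarrow> 0"
    using t by (intro lim_ln_over_power) simp
  then have "\<forall>\<^sub>F n in sequentially. ln (real n) / real n powr (2 * t + 1) < (?\<kappa> / (8 * ?C))\<^sup>2"
    by (rule order_tendstoD) (use \<kappa> C in simp)
  with eventually_ge_at_top[of 2]
  have bound: "\<forall>\<^sub>F n in sequentially. 0 \<le> risk n \<theta> \<beta>0 (s n) (A n) (cond_centered_max_test \<theta> \<beta>0 ?C n) \<and>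
     risk n \<theta> \<beta>0 (s n) (A n) (cond_centered_max_test \<theta> \<beta>0 ?C n) \<le> 4 / real n"
  proof eventually_elim
    case (elim n)
    have s0: "0 < s n" "s n \<le> real n"
      using elim b powr_mono[of b 1 "real n"] by (auto simp: s)
    have A0: "0 < A n" "A n \<le> 1"
      using elim t powr_mono[of t 0 "real n"] by (auto simp: A)
    have "ln (real n) \<le> (?\<kappa> / (8 * ?C))\<^sup>2 * real n powr (2 * t + 1)"
      using elim by (simp add: pos_divide_less_eq less_imp_le)
    also have "real n powr (2 * t + 1) = (A n)\<^sup>2 * real n"
    proof -
      have "real n powr (2 * t + 1) = real n powr (t + t) * real n powr 1"
        by (subst powr_add[symmetric]) simp
      then show ?thesis by (simp only: powr_add A power2_eq_square) simp
    qed
    finally have "real n * ln (real n) \<le> real n * ((?\<kappa> / (8 * ?C))\<^sup>2 * ((A n)\<^sup>2 * real n))"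
      by (intro mult_left_mono) auto
    also have "\<dots> = (?\<kappa> / (8 * ?C) * A n * real n)\<^sup>2"
      by (simp add: power_mult_distrib power2_eq_square mult_ac)
    finally have "sqrt (real n * ln (real n)) \<le> ?\<kappa> / (8 * ?C) * A n * real n"
      using \<kappa> C A0 by (intro real_le_lsqrt) auto
    then have "?C * sqrt (real n * ln (real n)) \<le> ?C * (?\<kappa> / (8 * ?C) * A n * real n)"
      using C by (intro mult_left_mono) auto
    also have "\<dots> = ?\<kappa> * A n * (real n / 2) / 4" using C \<theta> by simp
    also have "\<dots> \<le> ?\<kappa> * A n * (real n - 1) / 4"
      using elim A0 \<kappa> by (intro divide_right_mono mult_left_mono mult_nonneg_nonneg) auto
    finally have "risk n \<theta> \<beta>0 (s n) (A n) (cond_centered_max_test \<theta> \<beta>0 ?C n) \<le> 4 / real n"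
      using elim \<theta> s0 A0 by (intro max_test_risk) auto
    then show ?case
      using Xi_nonempty[OF _ s0(2) A0(1)] elim by (simp add: risk_nonneg)
  qed
  have lim: "(\<lambda>n. 4 / real n) \<longlonglongrightarrow> 0" by (rule lim_const_over_n)
  show ?thesis
    unfolding asymp_powerful_def
  proof (rule tendsto_sandwich[OF _ _ tendsto_const lim])
  qed (use bound in \<open>eventually_elim; simp\<close>)+
qed

section \<open>Degree covariances\<close>

lemma ising_cov_sum_linear:
  assumes V: "finite V"
  shows "ising_exp V J h (\<lambda>\<sigma>. (\<Sum>e\<in>V. p e * \<sigma> e) * (\<Sum>f\<in>V. q f * \<sigma> f))
      - ising_exp V J h (\<lambda>\<sigma>. \<Sum>e\<in>V. p e * \<sigma> e) * ising_exp V J h (\<lambda>\<sigma>. \<Sum>f\<in>V. q f * \<sigma> f)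
    = (\<Sum>e\<in>V. \<Sum>f\<in>V. p e * q f * ising_cov V J h e f)"
proof -
  have "ising_exp V J h (\<lambda>\<sigma>. (\<Sum>e\<in>V. p e * \<sigma> e) * (\<Sum>f\<in>V. q f * \<sigma> f)) =
      (\<Sum>e\<in>V. \<Sum>f\<in>V. p e * q f * ising_exp V J h (\<lambda>\<sigma>. \<sigma> e * \<sigma> f))"
  proof -
    have "(\<lambda>\<sigma>. (\<Sum>e\<in>V. p e * \<sigma> e) * (\<Sum>f\<in>V. q f * \<sigma> f)) =
        (\<lambda>\<sigma>. \<Sum>e\<in>V. \<Sum>f\<in>V. p e * q f * (\<sigma> e * \<sigma> f))"
      by (simp add: sum_product mult_ac)
    then show ?thesis by (simp only: ising_exp_sum ising_exp_cmult)
  qed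
  moreover have "ising_exp V J h (\<lambda>\<sigma>. \<Sum>e\<in>V. p e * \<sigma> e) * ising_exp V J h (\<lambda>\<sigma>. \<Sum>f\<in>V. q f * \<sigma> f) =
     (\<Sum>e\<in>V. \<Sum>f\<in>V. p e * q f * (ising_exp V J h (\<lambda>\<sigma>. \<sigma> e) * ising_exp V J h (\<lambda>\<sigma>. \<sigma> f)))"
    by (simp only: ising_exp_sum ising_exp_cmult sum_product) (simp add: mult_ac)
  ultimately show ?thesis
    by (simp add: ising_cov_def right_diff_distrib sum_subtractf)
qed

section \<open>Exchangeability of the vertices in a homogeneous field\<close>

definition relabel :: "(nat \<Rightarrow> nat) \<Rightarrow> config \<Rightarrow> config" where
  "relabel \<tau> Y i j = Y (\<tau> i) (\<tau> j)"

lemma relabel_in_configs: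
  assumes "\<tau> permutes {1..n}" "Y \<in> configs n"
  shows "relabel \<tau> Y \<in> configs n"
proof -
  have "\<tau> i \<in> {1..n} \<longleftrightarrow> i \<in> {1..n}" "\<tau> i = \<tau> j \<longleftrightarrow> i = j" for i j
    using permutes_in_image[OF assms(1)] permutes_inj[OF assms(1)] by (auto dest: injD)
  then show ?thesis using assms(2) unfolding configs_def relabel_def mem_Collect_eq by metis
qed

lemma sum_configs_relabel:
  assumes "\<tau> permutes {1..n}"
  shows "(\<Sum>Y\<in>configs n. F (relabel \<tau> Y)) = (\<Sum>Y\<in>configs n. F Y)"
  by (rule sum.reindex_bij_witness[of _ "relabel (inv \<tau>)" "relabel \<tau>"])
     (use relabel_in_configs[OF assms] relabel_in_configs[OF permutes_inv[OF assms]] in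
       \<open>auto simp: relabel_def fun_eq_iff permutes_inverses[OF assms]\<close>)

lemma deg_relabel:
  assumes "\<tau> permutes {1..n}"
  shows "deg n (relabel \<tau> Y) i = deg n Y (\<tau> i)"
  unfolding deg_def relabel_def by (rule sum.permute[OF assms, symmetric, unfolded o_def])

lemma two_star_weight_relabel:
  assumes "\<tau> permutes {1..n}"
  shows "two_star_weight n \<theta> (\<lambda>_. c) (relabel \<tau> Y) = two_star_weight n \<theta> (\<lambda>_. c) Y"
  unfolding two_star_weight_def deg_relabel[OF assms]
  using sum.permute[OF assms, of "\<lambda>i. (deg n Y i)\<^sup>2"] sum.permute[OF assms, of "\<lambda>i. c * deg n Y i"]
  by (simp add: o_def)

lemma two_star_exp_relabel:
  fixes F :: "config \<Rightarrow> real"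
  assumes "\<tau> permutes {1..n}"
  shows "ising_exp (edges n) (two_star_J n \<theta>) (two_star_h (\<lambda>_. c)) (\<lambda>\<sigma>. F (relabel \<tau> (to_config n \<sigma>))) =
    ising_exp (edges n) (two_star_J n \<theta>) (two_star_h (\<lambda>_. c)) (\<lambda>\<sigma>. F (to_config n \<sigma>))"
  using sum_configs_relabel[OF assms, of "\<lambda>Y. F Y * (two_star_weight n \<theta> (\<lambda>_. c) Y / two_star_Z n \<theta> (\<lambda>_. c))"]
  by (simp only: two_star_weight_relabel[OF assms] sum_two_star_ising)

definition deg_cov :: "nat \<Rightarrow> real \<Rightarrow> real \<Rightarrow> nat \<Rightarrow> nat \<Rightarrow> real" where
  "deg_cov n \<theta> c i j = (\<Sum>e\<in>edges n. \<Sum>f\<in>edges n.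
     inc i e * inc j f * ising_cov (edges n) (two_star_J n \<theta>) (\<lambda>_. c) e f)"

lemma two_star_h_const: "two_star_h (\<lambda>_. c) = (\<lambda>_. c)"
  by (simp add: two_star_h_def fun_eq_iff)

text \<open>Vertex permutations act directly on matrices and their degrees, whereas on edges, stored
  as increasing pairs, they would require reordering. Symmetry is therefore derived from this form,
  while sums over supports use the definition.\<close>

lemma deg_cov_eq:
  fixes \<theta> c :: real
  assumes "i \<in> {1..n}" "j \<in> {1..n}"
  defines "E \<equiv> ising_exp (edges n) (two_star_J n \<theta>) (two_star_h (\<lambda>_. c))"
  shows "deg_cov n \<theta> c i j =
    E (\<lambda>\<sigma>. deg n (to_config n \<sigma>) i * deg n (to_config n \<sigma>) j)
    - E (\<lambda>\<sigma>. deg n (to_config n \<sigma>) i) * E (\<lambda>\<sigma>. deg n (to_config n \<sigma>) j)"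
  unfolding E_def deg_cov_def two_star_h_const using assms(1,2)
  by (simp add: deg_to_config sum_incident_edges ising_cov_sum_linear[OF finite_edges])

lemma deg_cov_relabel:
  assumes "\<tau> permutes {1..n}" "i \<in> {1..n}" "j \<in> {1..n}"
  shows "deg_cov n \<theta> c (\<tau> i) (\<tau> j) = deg_cov n \<theta> c i j"
proof -
  have "\<tau> i \<in> {1..n}" "\<tau> j \<in> {1..n}" using assms permutes_in_image by metis+
  then show ?thesis
    using two_star_exp_relabel[OF assms(1), of \<theta> c "\<lambda>Y. deg n Y i * deg n Y j"]
      two_star_exp_relabel[OF assms(1), of \<theta> c "\<lambda>Y. deg n Y i"]
      two_star_exp_relabel[OF assms(1), of \<theta> c "\<lambda>Y. deg n Y j"]
    by (simp only: deg_cov_eq[OF assms(2,3)] deg_cov_eq deg_relabel[OF assms(1)])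
qed

lemma deg_cov_diag_eq:
  assumes "i \<in> {1..n}" "a \<in> {1..n}"
  shows "deg_cov n \<theta> c a a = deg_cov n \<theta> c i i"
  using deg_cov_relabel[OF permutes_swap_id[OF assms] assms(1) assms(1), of \<theta> c]
  by (simp add: transpose_apply_first)

text \<open>Two transpositions carry \<open>(i, j)\<close> to \<open>(a, b)\<close>: the first sends
  \<open>i\<close> to \<open>a\<close>, the second sends the image of \<open>j\<close> to
  \<open>b\<close> and fixes \<open>a\<close>.\<close>

lemma deg_cov_offdiag_eq:
  assumes i: "i \<in> {1..n}" "j \<in> {1..n}" "i \<noteq> j" and a: "a \<in> {1..n}" "b \<in> {1..n}" "a \<noteq> b"
  shows "deg_cov n \<theta> c a b = deg_cov n \<theta> c i j"
proof -
  let ?\<tau> = "Transposition.transpose i a"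
  have p: "?\<tau> permutes {1..n}" by (rule permutes_swap_id[OF i(1) a(1)])
  have j': "?\<tau> j \<in> {1..n}" "?\<tau> j \<noteq> a"
    using i permutes_in_image[OF p] by (auto simp: transpose_eq_iff)
  have "deg_cov n \<theta> c i j = deg_cov n \<theta> c a (?\<tau> j)"
    using deg_cov_relabel[OF p i(1,2), of \<theta> c] by (simp add: transpose_apply_first)
  also have "\<dots> = deg_cov n \<theta> c a b"
    using deg_cov_relabel[OF permutes_swap_id[OF j'(1) a(2)] a(1) j'(1), of \<theta> c] j'(2) a(3)
    by (simp add: transpose_apply_first transpose_apply_other)
  finally show ?thesis by simp
qed

text \<open>Each edge is counted once at each of its two endpoints, in both arguments of the
  covariance.\<close>

lemma sum_deg_cov:
  "(\<Sum>i=1..n. \<Sum>j=1..n. deg_cov n \<theta> c i j) =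
     4 * (\<Sum>e\<in>edges n. \<Sum>f\<in>edges n. ising_cov (edges n) (two_star_J n \<theta>) (\<lambda>_. c) e f)"
proof -
  let ?c = "ising_cov (edges n) (two_star_J n \<theta>) (\<lambda>_. c)"
  have inc2: "(\<Sum>i=1..n. inc i e) = 2" if "e \<in> edges n" for e
    using sum_inc_vertices[OF that, of "\<lambda>_. 1"] by simp
  have "(\<Sum>j=1..n. deg_cov n \<theta> c i j) = (\<Sum>e\<in>edges n. \<Sum>f\<in>edges n. inc i e * (2 * ?c e f))" for i
  proof -
    have "(\<Sum>j=1..n. deg_cov n \<theta> c i j) =
        (\<Sum>e\<in>edges n. \<Sum>f\<in>edges n. \<Sum>j=1..n. inc i e * inc j f * ?c e f)"
      unfolding deg_cov_def by (subst sum.swap, rule sum.cong[OF refl], rule sum.swap)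
    also have "\<dots> = (\<Sum>e\<in>edges n. \<Sum>f\<in>edges n. inc i e * ((\<Sum>j=1..n. inc j f) * ?c e f))"
      by (simp add: sum_distrib_left sum_distrib_right mult_ac)
    finally show ?thesis using inc2 by simp
  qed
  then have "(\<Sum>i=1..n. \<Sum>j=1..n. deg_cov n \<theta> c i j) =
      (\<Sum>i=1..n. \<Sum>e\<in>edges n. \<Sum>f\<in>edges n. inc i e * (2 * ?c e f))" by simp
  also have "\<dots> = (\<Sum>e\<in>edges n. \<Sum>f\<in>edges n. \<Sum>i=1..n. inc i e * (2 * ?c e f))"
    by (subst sum.swap, rule sum.cong[OF refl], rule sum.swap)
  also have "\<dots> = (\<Sum>e\<in>edges n. \<Sum>f\<in>edges n. (\<Sum>i=1..n. inc i e) * (2 * ?c e f))"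
    by (simp add: sum_distrib_right)
  also have "\<dots> = (\<Sum>e\<in>edges n. \<Sum>f\<in>edges n. 4 * ?c e f)"
    using inc2 by (intro sum.cong) auto
  finally show ?thesis by (simp add: sum_distrib_left)
qed

lemma deg_cov_nonneg:
  assumes "0 < \<theta>" "2 \<le> n" "0 \<le> c"
  shows "0 \<le> deg_cov n \<theta> c i j"
  unfolding deg_cov_def using assms
  by (intro sum_nonneg mult_nonneg_nonneg inc_nonneg ising_cov_nonneg finite_edges)
     (auto intro: two_star_J_nonneg)

text \<open>The total over all pairs is at most \<open>4 * K * n^2\<close> and all terms are
  nonnegative. By exchangeability it contains \<open>n\<close> equal variances and
  \<open>n * (n - 1)\<close> equal covariances; the 8 comes from
  \<open>n \<le> 2 * (n - 1)\<close>.\<close>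

lemma deg_cov_bounds:
  assumes \<theta>: "0 < \<theta>" and n: "2 \<le> n" and c: "0 \<le> c"
    and K: "(\<Sum>e\<in>edges n. \<Sum>f\<in>edges n. ising_cov (edges n) (two_star_J n \<theta>) (\<lambda>_. c) e f) \<le> K * real n ^ 2"
    and ij: "i \<in> {1..n}" "j \<in> {1..n}"
  shows "deg_cov n \<theta> c i j \<le> 4 * K * real n * of_bool (i = j) + 8 * K"
proof -
  let ?d = "deg_cov n \<theta> c"
  note nn = deg_cov_nonneg[OF \<theta> n c]
  have tot: "(\<Sum>i=1..n. \<Sum>j=1..n. ?d i j) \<le> 4 * K * real n ^ 2"
    unfolding sum_deg_cov using K by simp
  have "0 \<le> 4 * K * real n ^ 2"
    by (rule order.trans[OF _ tot]) (intro sum_nonneg nn)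
  then have K0: "0 \<le> K" using n by (simp add: zero_le_mult_iff)
  show ?thesis
  proof (cases "i = j")
    case True
    have "real n * ?d i i = (\<Sum>a=1..n. ?d a a)"
      using ij(1) by (subst sum.cong[OF refl deg_cov_diag_eq[of i]]) auto
    also have "\<dots> \<le> (\<Sum>a=1..n. \<Sum>b=1..n. ?d a b)"
      by (intro sum_mono member_le_sum nn) auto
    also have "\<dots> \<le> real n * (4 * K * real n)" using tot by (simp add: power2_eq_square mult_ac)
    finally have "?d i i \<le> 4 * K * real n" using n by simp
    then show ?thesis using True K0 by simp
  next
    case False
    have row: "(\<Sum>b\<in>{1..n} - {a}. ?d a b) = (real n - 1) * ?d i j" if a: "a \<in> {1..n}" for a
    proof -
      have "(\<Sum>b\<in>{1..n} - {a}. ?d a b) = (\<Sum>b\<in>{1..n} - {a}. ?d i j)"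
        using a by (intro sum.cong refl deg_cov_offdiag_eq ij False) auto
      then show ?thesis using a n by (simp add: of_nat_diff)
    qed
    have "real n * ((real n - 1) * ?d i j) = (\<Sum>a=1..n. (real n - 1) * ?d i j)" by simp
    also have "\<dots> = (\<Sum>a=1..n. \<Sum>b\<in>{1..n} - {a}. ?d a b)"
      by (intro sum.cong refl row[symmetric])
    also have "\<dots> \<le> (\<Sum>a=1..n. \<Sum>b=1..n. ?d a b)"
      by (intro sum_mono sum_mono2 nn) auto
    also have "\<dots> \<le> real n * (4 * K * real n)" using tot by (simp add: power2_eq_square mult_ac)
    finally have "(real n - 1) * ?d i j \<le> 4 * K * real n" using n by simp
    also have "\<dots> \<le> 4 * K * (2 * (real n - 1))" using n K0 by (intro mult_left_mono) auto
    finally have "(real n - 1) * ?d i j \<le> (real n - 1) * (8 * K)" by (simp add: mult_ac)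
    then show ?thesis using False n by simp
  qed
qed

text \<open>The point is that \<open>K\<close> is free of \<open>n\<close>. A positive field gives
  \<open>1 / c\<close> at every \<open>\<theta>\<close>; at zero field the row sum
  \<open>2 * \<theta> < 1\<close> gives \<open>1 / (1 - 2 * \<theta>)\<close>.\<close>

lemma two_star_cov_sum_bound:
  assumes \<theta>: "0 < \<theta>" and c: "0 < c \<or> c = 0 \<and> \<theta> < 1/2"
  obtains K where "0 \<le> K" "\<And>n. 2 \<le> n \<Longrightarrow>
    (\<Sum>e\<in>edges n. \<Sum>f\<in>edges n. ising_cov (edges n) (two_star_J n \<theta>) (\<lambda>_. c) e f) \<le> K * real n ^ 2"
proof -
  have card: "2 * real (card (edges n)) \<le> real n ^ 2" for n
    unfolding card_edges by (simp add: power2_eq_square algebra_simps)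
  show ?thesis
  proof (cases "0 < c")
    case True
    show ?thesis
    proof
      show "0 \<le> 1 / c" using True by simp
      fix n :: nat assume n: "2 \<le> n"
      have "(\<Sum>e\<in>edges n. \<Sum>f\<in>edges n. ising_cov (edges n) (two_star_J n \<theta>) (\<lambda>_. c) e f) \<le> 2 * real (card (edges n)) / c"
        by (intro ising_cov_sum_uniform_field finite_edges two_star_J_nonneg \<theta> n True)
      also have "\<dots> \<le> real n ^ 2 / c" using card True by (intro divide_right_mono) auto
      finally show "(\<Sum>e\<in>edges n. \<Sum>f\<in>edges n. ising_cov (edges n) (two_star_J n \<theta>) (\<lambda>_. c) e f) \<le> 1 / c * real n ^ 2"
        by simp
    qed
  next
    case False
    then have c0: "c = 0" and \<theta>': "2 * \<theta> < 1" using c by auto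
    show ?thesis
    proof
      show "0 \<le> 1 / (1 - 2 * \<theta>)" using \<theta>' by simp
      fix n :: nat assume n: "2 \<le> n"
      have "(\<Sum>e\<in>edges n. \<Sum>f\<in>edges n. ising_cov (edges n) (two_star_J n \<theta>) (\<lambda>_. c) e f) \<le> real (card (edges n)) / (1 - 2 * \<theta>)"
        unfolding c0
        by (intro ising_cov_sum_zero_field finite_edges two_star_J_nonneg two_star_J_sym \<theta> n \<theta>')
           (simp add: two_star_J_row_sum n)
      also have "\<dots> \<le> real n ^ 2 / (1 - 2 * \<theta>)" using card[of n] \<theta>' by (intro divide_right_mono order.trans[OF _ card[of n]]) auto
      finally show "(\<Sum>e\<in>edges n. \<Sum>f\<in>edges n. ising_cov (edges n) (two_star_J n \<theta>) (\<lambda>_. c) e f) \<le> 1 / (1 - 2 * \<theta>) * real n ^ 2"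
        by simp
    qed
  qed
qed

section \<open>The second moment of the likelihood ratio\<close>

text \<open>The increment of \<open>two_star_h\<close> when \<open>A\<close> is added to the
  parameter of every vertex in \<open>S\<close>.\<close>

definition vertex_field :: "real \<Rightarrow> nat set \<Rightarrow> nat \<times> nat \<Rightarrow> real" where
  "vertex_field A S e = A / 2 * (\<Sum>i\<in>S. inc i e)"

lemma vertex_field_nonneg: "0 \<le> A \<Longrightarrow> 0 \<le> vertex_field A S e"
  unfolding vertex_field_def by (intro mult_nonneg_nonneg sum_nonneg inc_nonneg) auto

lemma vertex_field_le:
  assumes "0 \<le> A" "S \<subseteq> {1..n}" "e \<in> edges n"
  shows "vertex_field A S e \<le> A"
proof -
  have "(\<Sum>i\<in>S. inc i e) \<le> (\<Sum>i=1..n. inc i e)"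
    using assms by (intro sum_mono2) (auto simp: inc_nonneg)
  also have "\<dots> = 2" using sum_inc_vertices[OF assms(3), of "\<lambda>_. 1"] by simp
  finally have "A / 2 * (\<Sum>i\<in>S. inc i e) \<le> A / 2 * 2" using assms(1) by (intro mult_left_mono) auto
  then show ?thesis by (simp add: vertex_field_def)
qed

text \<open>Expanding both fields over vertices leaves \<open>(A / 2)^2\<close> times the degree
  covariances between \<open>S\<close> and \<open>S'\<close>. Variances, of order \<open>n\<close>,
  occur only at common vertices.\<close>

lemma vertex_field_cov_sum:
  assumes \<theta>: "0 < \<theta>" and n: "2 \<le> n" and c: "0 \<le> c"
    and K: "0 \<le> K" "(\<Sum>e\<in>edges n. \<Sum>f\<in>edges n. ising_cov (edges n) (two_star_J n \<theta>) (\<lambda>_. c) e f) \<le> K * real n ^ 2"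
    and S: "S \<subseteq> {1..n}" "S' \<subseteq> {1..n}"
  shows "(\<Sum>e\<in>edges n. \<Sum>f\<in>edges n. vertex_field A S e * vertex_field A S' f *
      ising_cov (edges n) (two_star_J n \<theta>) (\<lambda>_. c) e f)
    \<le> A\<^sup>2 * K * (real n * real (card (S \<inter> S')) + 2 * (real (card S) * real (card S')))"
proof -
  let ?c = "ising_cov (edges n) (two_star_J n \<theta>) (\<lambda>_. c)"
  have fin: "finite S" "finite S'" using S finite_subset by blast+
  have "(\<Sum>e\<in>edges n. \<Sum>f\<in>edges n. vertex_field A S e * vertex_field A S' f * ?c e f) =
      (\<Sum>e\<in>edges n. \<Sum>f\<in>edges n. \<Sum>i\<in>S. \<Sum>j\<in>S'. (A / 2)\<^sup>2 * (inc i e * inc j f * ?c e f))"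
  proof (intro sum.cong refl)
    fix e f
    have "vertex_field A S e * vertex_field A S' f * ?c e f =
        (A / 2)\<^sup>2 * ((\<Sum>i\<in>S. inc i e) * (\<Sum>j\<in>S'. inc j f) * ?c e f)"
      by (simp add: vertex_field_def power2_eq_square)
    then show "vertex_field A S e * vertex_field A S' f * ?c e f =
        (\<Sum>i\<in>S. \<Sum>j\<in>S'. (A / 2)\<^sup>2 * (inc i e * inc j f * ?c e f))"
      by (simp only: sum_product) (simp only: sum_distrib_left sum_distrib_right)
  qed
  also have "\<dots> = (\<Sum>e\<in>edges n. \<Sum>i\<in>S. \<Sum>f\<in>edges n. \<Sum>j\<in>S'. (A / 2)\<^sup>2 * (inc i e * inc j f * ?c e f))"
    by (rule sum.cong[OF refl], rule sum.swap)
  also have "\<dots> = (\<Sum>i\<in>S. \<Sum>e\<in>edges n. \<Sum>f\<in>edges n. \<Sum>j\<in>S'. (A / 2)\<^sup>2 * (inc i e * inc j f * ?c e f))"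
    by (rule sum.swap)
  also have "\<dots> = (\<Sum>i\<in>S. \<Sum>e\<in>edges n. \<Sum>j\<in>S'. \<Sum>f\<in>edges n. (A / 2)\<^sup>2 * (inc i e * inc j f * ?c e f))"
    by (rule sum.cong[OF refl], rule sum.cong[OF refl], rule sum.swap)
  also have "\<dots> = (\<Sum>i\<in>S. \<Sum>j\<in>S'. \<Sum>e\<in>edges n. \<Sum>f\<in>edges n. (A / 2)\<^sup>2 * (inc i e * inc j f * ?c e f))"
    by (rule sum.cong[OF refl], rule sum.swap)
  also have "\<dots> = (\<Sum>i\<in>S. \<Sum>j\<in>S'. (A / 2)\<^sup>2 * deg_cov n \<theta> c i j)"
    by (simp add: deg_cov_def sum_distrib_left)
  also have "\<dots> \<le> (\<Sum>i\<in>S. \<Sum>j\<in>S'. (A / 2)\<^sup>2 * (4 * K * real n * of_bool (i = j) + 8 * K))"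
    using S by (intro sum_mono mult_left_mono deg_cov_bounds \<theta> n c K) auto
  also have "\<dots> = (\<Sum>i\<in>S. \<Sum>j\<in>S'. A\<^sup>2 * K * real n * of_bool (i = j) + 2 * A\<^sup>2 * K)"
    by (simp add: power2_eq_square algebra_simps)
  also have "\<dots> = A\<^sup>2 * K * real n * (\<Sum>i\<in>S. \<Sum>j\<in>S'. of_bool (i = j)) + real (card S) * real (card S') * (2 * A\<^sup>2 * K)"
    by (simp add: sum.distrib flip: sum_distrib_left)
  also have "(\<Sum>i\<in>S. \<Sum>j\<in>S'. of_bool (i = j)) = real (card (S \<inter> S'))"
  proof -
    have "(\<Sum>j\<in>S'. of_bool (i = j)) = (of_bool (i \<in> S') :: real)" for i
      using fin by (simp add: of_bool_def)
    then show ?thesis using fin by (simp add: of_bool_def flip: sum.inter_restrict)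
  qed
  finally show ?thesis by (simp add: algebra_simps)
qed

section \<open>Change of measure and the likelihood ratio of a mixture\<close>

lemma ising_weight_field_cong:
  "(\<And>a. a \<in> V \<Longrightarrow> h a = h' a) \<Longrightarrow> ising_weight V J h = ising_weight V J h'"
  by (simp add: ising_weight_def fun_eq_iff cong: sum.cong)

lemma ising_Z_field_cong: "(\<And>a. a \<in> V \<Longrightarrow> h a = h' a) \<Longrightarrow> ising_Z V J h = ising_Z V J h'"
  using ising_weight_field_cong[of V h h' J] by (simp add: ising_Z_def)

lemma ising_exp_field_cong: "(\<And>a. a \<in> V \<Longrightarrow> h a = h' a) \<Longrightarrow> ising_exp V J h = ising_exp V J h'"
  using ising_weight_field_cong[of V h h' J] ising_Z_field_cong[of V h h' J]
  by (simp add: ising_exp_def fun_eq_iff)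

lemma ising_exp_exp_linear:
  "ising_exp V J h (\<lambda>\<sigma>. exp (\<Sum>a\<in>V. u a * \<sigma> a)) = ising_Z V J (\<lambda>a. h a + u a) / ising_Z V J h"
  by (simp add: ising_exp_def ising_Z_def ising_weight_shift mult.commute)

lemma ising_exp_shift:
  assumes "finite V"
  shows "ising_exp V J (\<lambda>a. h a + u a) F = ising_exp V J h
    (\<lambda>\<sigma>. F \<sigma> * (ising_Z V J h / ising_Z V J (\<lambda>a. h a + u a) * exp (\<Sum>a\<in>V. u a * \<sigma> a)))"
proof -
  have "ising_exp V J h (\<lambda>\<sigma>. F \<sigma> * (ising_Z V J h / ising_Z V J (\<lambda>a. h a + u a) * exp (\<Sum>a\<in>V. u a * \<sigma> a)))
      = ising_Z V J h / ising_Z V J (\<lambda>a. h a + u a) * ising_exp V J h (\<lambda>\<sigma>. F \<sigma> * exp (\<Sum>a\<in>V. u a * \<sigma> a))"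
    by (rule ising_exp_pull)
  then show ?thesis
    using ising_Z_pos[OF assms, of J h]
    by (simp add: ising_exp_def ising_weight_shift mult_ac)
qed

lemma ising_exp_square_le:
  assumes "finite V"
  shows "(ising_exp V J h F)\<^sup>2 \<le> ising_exp V J h (\<lambda>\<sigma>. (F \<sigma>)\<^sup>2)"
proof -
  define m where "m = ising_exp V J h F"
  have "0 \<le> ising_exp V J h (\<lambda>\<sigma>. (F \<sigma> - m)\<^sup>2)" by (intro ising_exp_nonneg assms) auto
  also have "(\<lambda>\<sigma>. (F \<sigma> - m)\<^sup>2) = (\<lambda>\<sigma>. (F \<sigma>)\<^sup>2 + (m\<^sup>2 - (2 * m) * F \<sigma>))"
    by (simp add: power2_diff fun_eq_iff algebra_simps)
  also have "ising_exp V J h \<dots> = ising_exp V J h (\<lambda>\<sigma>. (F \<sigma>)\<^sup>2) - m\<^sup>2"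
    unfolding ising_exp_add ising_exp_diff ising_exp_cmult ising_exp_const[OF assms] m_def[symmetric]
    by (simp add: power2_eq_square)
  finally show ?thesis by (simp add: m_def)
qed

text \<open>The hypothesis bounds the second moment of the mixture likelihood ratio \<open>L\<close>
  by \<open>1 + \<epsilon>\<close>. As \<open>L\<close> has mean 1, its variance is at most
  \<open>\<epsilon>\<close>, hence its mean distance from 1 is at most
  \<open>sqrt \<epsilon>\<close>, and no test function bounded by 1 separates better than
  that.\<close>

lemma ising_mixture_bound:
  fixes u :: "'i \<Rightarrow> 'v \<Rightarrow> real"
  assumes V: "finite V" and I: "finite I" "I \<noteq> {}"
    and \<phi>: "\<And>\<sigma>. \<sigma> \<in> spins V \<Longrightarrow> \<bar>\<phi> \<sigma>\<bar> \<le> 1"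
    and M: "(\<Sum>i\<in>I. \<Sum>j\<in>I. ising_Z V J h * ising_Z V J (\<lambda>a. h a + u i a + u j a) /
        (ising_Z V J (\<lambda>a. h a + u i a) * ising_Z V J (\<lambda>a. h a + u j a))) \<le> (1 + \<epsilon>) * (real (card I))\<^sup>2"
  shows "(\<Sum>i\<in>I. ising_exp V J (\<lambda>a. h a + u i a) \<phi>) / real (card I) - ising_exp V J h \<phi> \<le> sqrt \<epsilon>"
proof -
  let ?E = "ising_exp V J h" and ?N = "real (card I)"
  define r where "r = (\<lambda>i. ising_Z V J h / ising_Z V J (\<lambda>a. h a + u i a))"
  \<comment> \<open>\<open>X i\<close> is the density of the model with field \<open>h + u i\<close>
    relative to the one with field \<open>h\<close>; \<open>L\<close> averages these over
    \<open>I\<close>.\<close>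
  define X where "X = (\<lambda>i \<sigma>. r i * exp (\<Sum>a\<in>V. u i a * \<sigma> a))"
  define L where "L = (\<lambda>\<sigma>. (1 / ?N) * (\<Sum>i\<in>I. X i \<sigma>))"
  have N: "0 < ?N" using I by (simp add: card_gt_0_iff)
  note Z = ising_Z_pos[OF V, of J]
  have EX: "?E (X i) = 1" for i
    unfolding X_def ising_exp_cmult ising_exp_exp_linear r_def
    using Z[of h] Z[of "\<lambda>a. h a + u i a"] by simp
  have EXX: "?E (\<lambda>\<sigma>. X i \<sigma> * X j \<sigma>) = ising_Z V J h * ising_Z V J (\<lambda>a. h a + u i a + u j a) /
        (ising_Z V J (\<lambda>a. h a + u i a) * ising_Z V J (\<lambda>a. h a + u j a))" for i j
  proof -
    have "(\<lambda>\<sigma>. X i \<sigma> * X j \<sigma>) = (\<lambda>\<sigma>. (r i * r j) * exp (\<Sum>a\<in>V. (u i a + u j a) * \<sigma> a))"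
      by (simp add: X_def fun_eq_iff distrib_right sum.distrib exp_add)
    then have "?E (\<lambda>\<sigma>. X i \<sigma> * X j \<sigma>) = r i * r j * (ising_Z V J (\<lambda>a. h a + (u i a + u j a)) / ising_Z V J h)"
      by (simp only: ising_exp_cmult ising_exp_exp_linear)
    then show ?thesis using Z[of h] by (simp add: r_def add.assoc)
  qed
  have EL: "?E L = 1"
    unfolding L_def ising_exp_cmult ising_exp_sum EX using N by simp
  have "(\<lambda>\<sigma>. (L \<sigma>)\<^sup>2) = (\<lambda>\<sigma>. (1 / ?N)\<^sup>2 * (\<Sum>i\<in>I. \<Sum>j\<in>I. X i \<sigma> * X j \<sigma>))"
    by (simp add: L_def power_mult_distrib power2_eq_square sum_product)
  then have "?E (\<lambda>\<sigma>. (L \<sigma>)\<^sup>2) = (1 / ?N)\<^sup>2 * (\<Sum>i\<in>I. \<Sum>j\<in>I. ?E (\<lambda>\<sigma>. X i \<sigma> * X j \<sigma>))"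
    by (simp only: ising_exp_cmult ising_exp_sum)
  also have "\<dots> \<le> (1 / ?N)\<^sup>2 * ((1 + \<epsilon>) * ?N\<^sup>2)"
    unfolding EXX by (intro mult_left_mono M) simp
  also have "\<dots> = 1 + \<epsilon>" using N by (simp add: power_divide)
  finally have EL2: "?E (\<lambda>\<sigma>. (L \<sigma>)\<^sup>2) \<le> 1 + \<epsilon>" .
  have "(\<lambda>\<sigma>. \<bar>L \<sigma> - 1\<bar>\<^sup>2) = (\<lambda>\<sigma>. (L \<sigma>)\<^sup>2 + (1 - 2 * L \<sigma>))"
    by (simp add: power2_diff fun_eq_iff)
  then have "?E (\<lambda>\<sigma>. \<bar>L \<sigma> - 1\<bar>\<^sup>2) = ?E (\<lambda>\<sigma>. (L \<sigma>)\<^sup>2) - 1"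
    by (simp only: ising_exp_add ising_exp_diff ising_exp_cmult ising_exp_const[OF V] EL)
  then have "(?E (\<lambda>\<sigma>. \<bar>L \<sigma> - 1\<bar>))\<^sup>2 \<le> \<epsilon>"
    using EL2 ising_exp_square_le[OF V, of J h "\<lambda>\<sigma>. \<bar>L \<sigma> - 1\<bar>"] by simp
  then have bound: "?E (\<lambda>\<sigma>. \<bar>L \<sigma> - 1\<bar>) \<le> sqrt \<epsilon>" by (rule real_le_rsqrt)
  have "(\<Sum>i\<in>I. ising_exp V J (\<lambda>a. h a + u i a) \<phi>) = ?E (\<lambda>\<sigma>. \<Sum>i\<in>I. \<phi> \<sigma> * X i \<sigma>)"
    unfolding ising_exp_sum X_def r_def by (simp only: ising_exp_shift[OF V, of J h _ \<phi>])
  also have "\<dots> / ?N = ?E (\<lambda>\<sigma>. \<phi> \<sigma> * L \<sigma>)"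
    using ising_exp_cmult[of V J h "1 / ?N" "\<lambda>\<sigma>. \<Sum>i\<in>I. \<phi> \<sigma> * X i \<sigma>"]
    by (simp add: L_def sum_distrib_left)
  finally have "(\<Sum>i\<in>I. ising_exp V J (\<lambda>a. h a + u i a) \<phi>) / ?N - ?E \<phi> = ?E (\<lambda>\<sigma>. \<phi> \<sigma> * (L \<sigma> - 1))"
    by (simp add: right_diff_distrib ising_exp_diff)
  also have "\<dots> \<le> ?E (\<lambda>\<sigma>. \<bar>L \<sigma> - 1\<bar>)"
  proof (intro ising_exp_mono V)
    fix \<sigma> :: "'v \<Rightarrow> real" assume "\<sigma> \<in> spins V"
    then have "\<bar>\<phi> \<sigma>\<bar> * \<bar>L \<sigma> - 1\<bar> \<le> 1 * \<bar>L \<sigma> - 1\<bar>" by (intro mult_right_mono \<phi>) auto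
    then show "\<phi> \<sigma> * (L \<sigma> - 1) \<le> \<bar>L \<sigma> - 1\<bar>"
      using abs_ge_self[of "\<phi> \<sigma> * (L \<sigma> - 1)"] by (simp add: abs_mult)
  qed
  finally show ?thesis using bound by linarith
qed

text \<open>The supremum over \<open>Xi\<close> dominates the average over the family
  \<open>\<beta>\<close>, so the risk is at least 1 minus the advantage of the test against the
  uniform mixture.\<close>

lemma risk_ge_mixture:
  fixes \<theta> :: real and u :: "'i \<Rightarrow> nat \<times> nat \<Rightarrow> real"
  assumes I: "finite I" "I \<noteq> {}" and T: "T \<in> tests n"
    and \<beta>: "\<And>i. i \<in> I \<Longrightarrow> \<beta> i \<in> Xi n \<beta>0 s A"
    and u: "\<And>i e. i \<in> I \<Longrightarrow> e \<in> edges n \<Longrightarrow> two_star_h (\<beta> i) e = \<beta>0 + u i e"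
  defines "Z \<equiv> ising_Z (edges n) (two_star_J n \<theta>)"
  assumes M: "(\<Sum>i\<in>I. \<Sum>j\<in>I. Z (\<lambda>_. \<beta>0) * Z (\<lambda>e. \<beta>0 + u i e + u j e) /
        (Z (\<lambda>e. \<beta>0 + u i e) * Z (\<lambda>e. \<beta>0 + u j e))) \<le> (1 + \<epsilon>) * (real (card I))\<^sup>2"
  shows "1 - sqrt \<epsilon> \<le> risk n \<theta> \<beta>0 s A T"
proof -
  let ?P = "\<lambda>\<beta>. measure_pmf.prob (two_star_pmf n \<theta> \<beta>)" and ?N = "real (card I)"
  define \<phi> :: "(nat \<times> nat \<Rightarrow> real) \<Rightarrow> real" where "\<phi> = (\<lambda>\<sigma>. of_bool (T (to_config n \<sigma>) = 1))"
  let ?R = "SUP \<beta>\<in>Xi n \<beta>0 s A. ?P \<beta> {Y. T Y = 0}"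
  have N: "0 < ?N" using I by (simp add: card_gt_0_iff)
  have P1: "?P b {Y. T Y = 1} = ising_exp (edges n) (two_star_J n \<theta>) (two_star_h b) \<phi>" for b
    by (simp add: prob_two_star_ising \<phi>_def)
  have P0: "?P b {Y. T Y = 0} = 1 - ising_exp (edges n) (two_star_J n \<theta>) (two_star_h b) \<phi>" for b
  proof -
    have "?P b {Y. T Y = 0} = ising_exp (edges n) (two_star_J n \<theta>) (two_star_h b) (\<lambda>\<sigma>. 1 - \<phi> \<sigma>)"
      unfolding prob_two_star_ising \<phi>_def using T
      by (intro ising_exp_cong) (auto simp: tests_def Pi_iff dest!: to_config_in_configs)
    then show ?thesis by (simp only: ising_exp_diff ising_exp_const[OF finite_edges])
  qed
  have "(\<Sum>i\<in>I. 1 - ising_exp (edges n) (two_star_J n \<theta>) (\<lambda>e. \<beta>0 + u i e) \<phi>) \<le> (\<Sum>i\<in>I. ?R)"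
  proof (intro sum_mono)
    fix i assume i: "i \<in> I"
    have "1 - ising_exp (edges n) (two_star_J n \<theta>) (\<lambda>e. \<beta>0 + u i e) \<phi> = ?P (\<beta> i) {Y. T Y = 0}"
      unfolding P0 using ising_exp_field_cong[of "edges n" "two_star_h (\<beta> i)" "\<lambda>e. \<beta>0 + u i e"] u[OF i] by simp
    also have "\<dots> \<le> ?R" by (intro cSUP_upper risk_bdd \<beta> i)
    finally show "1 - ising_exp (edges n) (two_star_J n \<theta>) (\<lambda>e. \<beta>0 + u i e) \<phi> \<le> ?R" .
  qed
  then have "?N - (\<Sum>i\<in>I. ising_exp (edges n) (two_star_J n \<theta>) (\<lambda>e. \<beta>0 + u i e) \<phi>) \<le> ?N * ?R"
    by (simp add: sum_subtractf)
  then have "1 - (\<Sum>i\<in>I. ising_exp (edges n) (two_star_J n \<theta>) (\<lambda>e. \<beta>0 + u i e) \<phi>) / ?N \<le> ?R"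
    using N by (simp add: field_simps)
  moreover have "(\<Sum>i\<in>I. ising_exp (edges n) (two_star_J n \<theta>) (\<lambda>e. \<beta>0 + u i e) \<phi>) / ?N
      - ising_exp (edges n) (two_star_J n \<theta>) (\<lambda>_. \<beta>0) \<phi> \<le> sqrt \<epsilon>"
    using M unfolding Z_def by (intro ising_mixture_bound finite_edges I) (auto simp: \<phi>_def)
  ultimately show ?thesis
    unfolding risk_def P1 two_star_h_const by linarith
qed

text \<open>For negative \<open>\<beta>0\<close> all spins are flipped first, since the GHS inequality requires a
  nonnegative field; the signal then lowers the field, but not below half its size.\<close>

lemma vertex_field_Z_ratio:
  assumes regime: "(\<beta>0 = 0 \<and> 0 < \<theta> \<and> \<theta> < 1/2) \<or> (\<beta>0 \<noteq> 0 \<and> \<theta> > 0)"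
  obtains K A0 where "0 \<le> K" "0 < A0"
    "\<And>n A S S'. 2 \<le> n \<Longrightarrow> 0 < A \<Longrightarrow> A \<le> A0 \<Longrightarrow> S \<subseteq> {1..n} \<Longrightarrow> S' \<subseteq> {1..n} \<Longrightarrow>
      ising_Z (edges n) (two_star_J n \<theta>) (\<lambda>_. \<beta>0) *
      ising_Z (edges n) (two_star_J n \<theta>) (\<lambda>e. \<beta>0 + vertex_field A S e + vertex_field A S' e)
      \<le> ising_Z (edges n) (two_star_J n \<theta>) (\<lambda>e. \<beta>0 + vertex_field A S e) *
      ising_Z (edges n) (two_star_J n \<theta>) (\<lambda>e. \<beta>0 + vertex_field A S' e) *
      exp (A\<^sup>2 * K * (real n * real (card (S \<inter> S')) + 2 * (real (card S) * real (card S'))))"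
proof -
  have \<theta>: "0 < \<theta>" using regime by auto
  define c where "c = (if 0 \<le> \<beta>0 then \<beta>0 else - \<beta>0 / 2)"
  have c: "0 < c \<or> c = 0 \<and> \<theta> < 1/2" "0 \<le> c" using regime by (auto simp: c_def)
  obtain K where K: "0 \<le> K" "\<And>n. 2 \<le> n \<Longrightarrow>
    (\<Sum>e\<in>edges n. \<Sum>f\<in>edges n. ising_cov (edges n) (two_star_J n \<theta>) (\<lambda>_. c) e f) \<le> K * real n ^ 2"
    using two_star_cov_sum_bound[OF \<theta> c(1)] by blast
  show ?thesis
  proof
    show "0 \<le> K" by (rule K)
    \<comment> \<open>For negative \<open>\<beta>0\<close>, two signals of size at most
      \<open>- \<beta>0 / 4\<close> lower the flipped field \<open>- \<beta>0\<close> to no less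
      than \<open>c\<close>.\<close>
    show "0 < (if 0 \<le> \<beta>0 then 1 else - \<beta>0 / 4)" by simp
    fix n :: nat and A and S S' :: "nat set"
    assume n: "2 \<le> n" and A: "0 < A" "A \<le> (if 0 \<le> \<beta>0 then 1 else - \<beta>0 / 4)"
      and S: "S \<subseteq> {1..n}" "S' \<subseteq> {1..n}"
    let ?Z = "ising_Z (edges n) (two_star_J n \<theta>)" and ?u = "vertex_field A S" and ?v = "vertex_field A S'"
    let ?C = "\<Sum>e\<in>edges n. \<Sum>f\<in>edges n. ?u e * ?v f * ising_cov (edges n) (two_star_J n \<theta>) (\<lambda>_. c) e f"
    let ?b = "A\<^sup>2 * K * (real n * real (card (S \<inter> S')) + 2 * (real (card S) * real (card S')))"
    have "?Z (\<lambda>_. \<beta>0) * ?Z (\<lambda>e. \<beta>0 + ?u e + ?v e) \<le> ?Z (\<lambda>e. \<beta>0 + ?u e) * ?Z (\<lambda>e. \<beta>0 + ?v e) * exp ?C"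
    proof (cases "0 \<le> \<beta>0")
      case True
      then show ?thesis using A
        by (intro ising_Z_second_difference finite_edges)
           (auto simp: c_def intro: two_star_J_nonneg \<theta> n vertex_field_nonneg)
    next
      case False
      \<comment> \<open>After the flip, the smallest of the four fields is the one carrying both
        signals, so it becomes the base point; adding \<open>?u\<close> or \<open>?v\<close> removes
        a signal. The corners of the second difference are permuted within each side, and the
        inequality is unchanged.\<close>
      let ?h = "\<lambda>e. - \<beta>0 - ?u e - ?v e"
      have "?Z ?h * ?Z (\<lambda>e. ?h e + ?u e + ?v e) \<le> ?Z (\<lambda>e. ?h e + ?u e) * ?Z (\<lambda>e. ?h e + ?v e) * exp ?C"
      proof (rule ising_Z_second_difference[OF finite_edges])
        fix e assume e: "e \<in> edges n"
        show "c \<le> ?h e"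
          using False A vertex_field_le[OF _ S(1) e, of A] vertex_field_le[OF _ S(2) e, of A]
          by (simp add: c_def)
      qed (use A c in \<open>auto intro: two_star_J_nonneg \<theta> n vertex_field_nonneg\<close>)
      moreover have "?Z ?h = ?Z (\<lambda>e. \<beta>0 + ?u e + ?v e)"
        using ising_Z_minus[of "edges n" "two_star_J n \<theta>" "\<lambda>e. \<beta>0 + ?u e + ?v e"] by (simp add: algebra_simps)
      moreover have "?Z (\<lambda>e. ?h e + ?u e + ?v e) = ?Z (\<lambda>_. \<beta>0)"
        using ising_Z_minus[of "edges n" "two_star_J n \<theta>" "\<lambda>_. \<beta>0"] by simp
      moreover have "?Z (\<lambda>e. ?h e + ?u e) = ?Z (\<lambda>e. \<beta>0 + ?v e)"
        using ising_Z_minus[of "edges n" "two_star_J n \<theta>" "\<lambda>e. \<beta>0 + ?v e"] by (simp add: algebra_simps)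
      moreover have "?Z (\<lambda>e. ?h e + ?v e) = ?Z (\<lambda>e. \<beta>0 + ?u e)"
        using ising_Z_minus[of "edges n" "two_star_J n \<theta>" "\<lambda>e. \<beta>0 + ?u e"] by (simp add: algebra_simps)
      ultimately show ?thesis by (simp add: mult_ac)
    qed
    also have "\<dots> \<le> ?Z (\<lambda>e. \<beta>0 + ?u e) * ?Z (\<lambda>e. \<beta>0 + ?v e) * exp ?b"
      using vertex_field_cov_sum[OF \<theta> n c(2) K(1) K(2)[OF n] S, of A]
      by (intro mult_left_mono) (auto intro!: mult_nonneg_nonneg less_imp_le[OF ising_Z_pos] finite_edges)
    finally show "?Z (\<lambda>_. \<beta>0) * ?Z (\<lambda>e. \<beta>0 + ?u e + ?v e) \<le>
      ?Z (\<lambda>e. \<beta>0 + ?u e) * ?Z (\<lambda>e. \<beta>0 + ?v e) * exp ?b" .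
  qed
qed

section \<open>The least favourable prior\<close>

text \<open>The support contains one vertex of each of \<open>k\<close> consecutive blocks of length \<open>m\<close>, chosen
  independently and uniformly.\<close>

definition block_choices :: "nat \<Rightarrow> nat \<Rightarrow> (nat \<Rightarrow> nat) set" where
  "block_choices k m = {..<k} \<rightarrow>\<^sub>E {..<m}"

definition block_set :: "nat \<Rightarrow> nat \<Rightarrow> (nat \<Rightarrow> nat) \<Rightarrow> nat set" where
  "block_set k m f = (\<lambda>j. 1 + j * m + f j) ` {..<k}"

lemma block_index_eq:
  fixes m :: nat
  assumes "x < m" "y < m" "1 + i * m + x = 1 + j * m + y"
  shows "i = j \<and> x = y"
proof -
  have eq: "i * m + x = j * m + y" using assms(3) by simp
  have "(i * m + x) div m = i" "(j * m + y) div m = j" using assms(1,2) by auto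
  then have "i = j" unfolding eq by simp
  then show ?thesis using eq by simp
qed

lemma card_block_set:
  assumes "f \<in> block_choices k m"
  shows "card (block_set k m f) = k"
proof -
  have "inj_on (\<lambda>j. 1 + j * m + f j) {..<k}"
    using assms block_index_eq[of _ m] unfolding block_choices_def inj_on_def PiE_iff
    by (metis lessThan_iff)
  then show ?thesis by (simp add: block_set_def card_image)
qed

lemma block_set_subset:
  assumes "f \<in> block_choices k m" "k * m \<le> n"
  shows "block_set k m f \<subseteq> {1..n}"
proof
  fix x assume "x \<in> block_set k m f"
  then obtain j where j: "j < k" "x = 1 + j * m + f j" by (auto simp: block_set_def)
  then have "f j < m" using assms(1) by (auto simp: block_choices_def)
  then have "x \<le> Suc j * m" using j(2) by simp
  also have "\<dots> \<le> k * m" using j(1) by (intro mult_right_mono) auto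
  finally show "x \<in> {1..n}" using j(2) assms(2) by simp
qed

text \<open>Blocks are disjoint, so a common vertex must be the same choice in the same
  block.\<close>

lemma card_block_set_Int:
  assumes "f \<in> block_choices k m" "g \<in> block_choices k m"
  shows "real (card (block_set k m f \<inter> block_set k m g)) \<le> (\<Sum>j<k. of_bool (f j = g j))"
proof -
  have "block_set k m f \<inter> block_set k m g \<subseteq> (\<lambda>j. 1 + j * m + f j) ` {j \<in> {..<k}. f j = g j}"
  proof
    fix x assume "x \<in> block_set k m f \<inter> block_set k m g"
    then obtain i j where ij: "i < k" "x = 1 + i * m + f i" "j < k" "x = 1 + j * m + g j"
      by (auto simp: block_set_def)
    moreover have "f i < m" "g j < m" using assms ij by (auto simp: block_choices_def)
    ultimately have "i = j \<and> f i = g j" by (intro block_index_eq) auto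
    then have "i \<in> {j \<in> {..<k}. f j = g j}" using ij(1) by auto
    then show "x \<in> (\<lambda>j. 1 + j * m + f j) ` {j \<in> {..<k}. f j = g j}" using ij(2) by blast
  qed
  then have "card (block_set k m f \<inter> block_set k m g) \<le> card {j \<in> {..<k}. f j = g j}"
    by (rule surj_card_le[rotated]) simp
  also have "real \<dots> = (\<Sum>j<k. of_bool (f j = g j))"
    by (simp add: of_bool_def flip: sum.inter_filter)
  finally show ?thesis by simp
qed

text \<open>For fixed \<open>f\<close> the coordinates of \<open>g\<close> vary independently, and
  each agrees with \<open>f\<close> at one value out of \<open>m\<close>. The inner sum is therefore
  an exact power, and \<open>1 + x \<le> exp x\<close> bounds its normalized form.\<close>

lemma sum_block_choices:
  assumes m: "1 \<le> m"
  shows "(\<Sum>f\<in>block_choices k m. \<Sum>g\<in>block_choices k m. exp (l * (\<Sum>j<k. of_bool (f j = g j))))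
    \<le> exp (real k * (exp l - 1) / real m) * (real (card (block_choices k m)))\<^sup>2"
proof -
  have card: "real (card (block_choices k m)) = real m ^ k"
    by (simp add: block_choices_def card_PiE)
  have "(\<Sum>g\<in>block_choices k m. exp (l * (\<Sum>j<k. of_bool (f j = g j)))) = (real m - 1 + exp l) ^ k"
    if f: "f \<in> block_choices k m" for f
  proof -
    have "(\<Sum>g\<in>block_choices k m. exp (l * (\<Sum>j<k. of_bool (f j = g j)))) =
        (\<Sum>g\<in>{..<k} \<rightarrow>\<^sub>E {..<m}. \<Prod>j<k. exp (l * of_bool (f j = g j)))"
      by (simp only: block_choices_def sum_distrib_left exp_sum[OF finite_lessThan])
    also have "\<dots> = (\<Prod>j<k. \<Sum>y<m. exp (l * of_bool (f j = y)))"
      by (subst prod_sum_PiE) auto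
    also have "\<dots> = (\<Prod>j<k. real m - 1 + exp l)"
    proof (intro prod.cong refl)
      fix j assume "j \<in> {..<k}"
      then have fj: "f j \<in> {..<m}" using f by (auto simp: block_choices_def)
      have "(\<Sum>y<m. exp (l * of_bool (f j = y))) = exp l + (\<Sum>y\<in>{..<m} - {f j}. 1)"
        using fj by (subst sum.remove[of _ "f j"]) auto
      then show "(\<Sum>y<m. exp (l * of_bool (f j = y))) = real m - 1 + exp l"
        using fj m by (simp add: of_nat_diff)
    qed
    finally show ?thesis by simp
  qed
  then have "(\<Sum>f\<in>block_choices k m. \<Sum>g\<in>block_choices k m. exp (l * (\<Sum>j<k. of_bool (f j = g j)))) =
      real m ^ k * (real m - 1 + exp l) ^ k"
    by (simp add: card)
  also have "real m - 1 + exp l = real m * (1 + (exp l - 1) / real m)"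
    using m by (simp add: field_simps)
  also have "real m ^ k * (real m * (1 + (exp l - 1) / real m)) ^ k =
      (real m ^ k)\<^sup>2 * (1 + (exp l - 1) / real m) ^ k"
    by (simp add: power_mult_distrib power2_eq_square)
  also have "\<dots> \<le> (real m ^ k)\<^sup>2 * exp ((exp l - 1) / real m) ^ k"
  proof (intro mult_left_mono power_mono exp_ge_add_one_self)
    have "0 \<le> real m - 1 + exp l" using m by (intro add_nonneg_nonneg) auto
    then show "0 \<le> 1 + (exp l - 1) / real m" using m by (simp add: field_simps)
  qed simp
  also have "exp ((exp l - 1) / real m) ^ k = exp (real k * (exp l - 1) / real m)"
    by (simp flip: exp_of_nat_mult)
  finally show ?thesis by (simp only: card mult.commute)
qed

lemma two_star_h_block:
  assumes "S \<subseteq> {1..n}" "e \<in> edges n"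
  shows "two_star_h (\<lambda>i. \<beta>0 + A * of_bool (i \<in> S)) e = \<beta>0 + vertex_field A S e"
proof -
  have "(\<Sum>i=1..n. A * of_bool (i \<in> S) * inc i e) = A * (\<Sum>i\<in>S. inc i e)"
    unfolding sum_distrib_left using assms(1) by (intro sum.mono_neutral_cong_right) auto
  then show ?thesis
    using two_star_h_shift[OF assms(2), of \<beta>0 "\<lambda>i. A * of_bool (i \<in> S)"]
    by (simp add: two_star_h_const vertex_field_def)
qed

text \<open>In the exponent, the first term comes from the covariances of distinct degrees and is
  the same for every pair of supports; the second is the exponential moment of the overlap, at
  \<open>K * A^2 * n\<close> per common vertex.\<close>

lemma risk_lower_bound:
  assumes regime: "(\<beta>0 = 0 \<and> 0 < \<theta> \<and> \<theta> < 1/2) \<or> (\<beta>0 \<noteq> 0 \<and> \<theta> > 0)"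
  obtains K A0 where "0 \<le> K" "0 < A0"
    "\<And>n A s k m T. 2 \<le> n \<Longrightarrow> 0 < A \<Longrightarrow> A \<le> A0 \<Longrightarrow> 1 \<le> k \<Longrightarrow> 1 \<le> m \<Longrightarrow> k * m \<le> n \<Longrightarrow>
      s \<le> real k \<Longrightarrow> T \<in> tests n \<Longrightarrow>
      1 - sqrt (exp (2 * K * A\<^sup>2 * (real k)\<^sup>2 + real k * (exp (K * A\<^sup>2 * real n) - 1) / real m) - 1)
        \<le> risk n \<theta> \<beta>0 s A T"
proof (rule vertex_field_Z_ratio[OF regime])
  fix K A0 :: real
  assume K: "0 \<le> K" "0 < A0" and ratio:
    "\<And>n A S S'. 2 \<le> n \<Longrightarrow> 0 < A \<Longrightarrow> A \<le> A0 \<Longrightarrow> S \<subseteq> {1..n} \<Longrightarrow> S' \<subseteq> {1..n} \<Longrightarrow>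
      ising_Z (edges n) (two_star_J n \<theta>) (\<lambda>_. \<beta>0) *
      ising_Z (edges n) (two_star_J n \<theta>) (\<lambda>e. \<beta>0 + vertex_field A S e + vertex_field A S' e)
      \<le> ising_Z (edges n) (two_star_J n \<theta>) (\<lambda>e. \<beta>0 + vertex_field A S e) *
      ising_Z (edges n) (two_star_J n \<theta>) (\<lambda>e. \<beta>0 + vertex_field A S' e) *
      exp (A\<^sup>2 * K * (real n * real (card (S \<inter> S')) + 2 * (real (card S) * real (card S'))))"
  show ?thesis
  proof (rule that)
    show "0 \<le> K" "0 < A0" by (rule K)+
    fix n k m :: nat and A s :: real and T
    assume n: "2 \<le> n" and A: "0 < A" "A \<le> A0" and k: "1 \<le> k" and m: "1 \<le> m" and km: "k * m \<le> n"
      and s: "s \<le> real k" and T: "T \<in> tests n"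
    let ?I = "block_choices k m" and ?S = "block_set k m" and ?Z = "ising_Z (edges n) (two_star_J n \<theta>)"
    let ?u = "\<lambda>f. vertex_field A (?S f)" and ?l = "K * A\<^sup>2 * real n" and ?q = "2 * K * A\<^sup>2 * (real k)\<^sup>2"
    note S = block_set_subset[OF _ km]
    have fin: "finite ?I" by (auto simp: block_choices_def intro!: finite_PiE)
    have ne: "?I \<noteq> {}" using m by (auto simp: block_choices_def PiE_eq_empty_iff lessThan_empty_iff)
    have "(\<Sum>f\<in>?I. \<Sum>g\<in>?I. ?Z (\<lambda>_. \<beta>0) * ?Z (\<lambda>e. \<beta>0 + ?u f e + ?u g e) /
        (?Z (\<lambda>e. \<beta>0 + ?u f e) * ?Z (\<lambda>e. \<beta>0 + ?u g e))) \<le>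
      (\<Sum>f\<in>?I. \<Sum>g\<in>?I. exp ?q * exp (?l * (\<Sum>j<k. of_bool (f j = g j))))"
    proof (intro sum_mono)
      fix f g assume f: "f \<in> ?I" and g: "g \<in> ?I"
      have "?Z (\<lambda>_. \<beta>0) * ?Z (\<lambda>e. \<beta>0 + ?u f e + ?u g e) / (?Z (\<lambda>e. \<beta>0 + ?u f e) * ?Z (\<lambda>e. \<beta>0 + ?u g e))
        \<le> exp (A\<^sup>2 * K * (real n * real (card (?S f \<inter> ?S g)) + 2 * (real k * real k)))"
        using ratio[OF n A S[OF f] S[OF g]] ising_Z_pos[OF finite_edges, of n "two_star_J n \<theta>"]
        by (simp add: card_block_set[OF f] card_block_set[OF g] pos_divide_le_eq mult_ac)
      also have "\<dots> \<le> exp (A\<^sup>2 * K * (real n * (\<Sum>j<k. of_bool (f j = g j)) + 2 * (real k * real k)))"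
        using card_block_set_Int[OF f g] K(1) by (simp add: mult_left_mono)
      also have "\<dots> = exp ?q * exp (?l * (\<Sum>j<k. of_bool (f j = g j)))"
        by (simp add: algebra_simps power2_eq_square flip: exp_add)
      finally show "?Z (\<lambda>_. \<beta>0) * ?Z (\<lambda>e. \<beta>0 + ?u f e + ?u g e) /
        (?Z (\<lambda>e. \<beta>0 + ?u f e) * ?Z (\<lambda>e. \<beta>0 + ?u g e)) \<le> exp ?q * exp (?l * (\<Sum>j<k. of_bool (f j = g j)))" .
    qed
    also have "\<dots> = exp ?q * (\<Sum>f\<in>?I. \<Sum>g\<in>?I. exp (?l * (\<Sum>j<k. of_bool (f j = g j))))"
      by (simp add: sum_distrib_left)
    also have "\<dots> \<le> exp ?q * (exp (real k * (exp ?l - 1) / real m) * (real (card ?I))\<^sup>2)"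
      by (intro mult_left_mono sum_block_choices m) simp
    also have "\<dots> = (1 + (exp (?q + real k * (exp ?l - 1) / real m) - 1)) * (real (card ?I))\<^sup>2"
      by (simp add: exp_add)
    finally have M: "(\<Sum>f\<in>?I. \<Sum>g\<in>?I. ?Z (\<lambda>_. \<beta>0) * ?Z (\<lambda>e. \<beta>0 + ?u f e + ?u g e) /
        (?Z (\<lambda>e. \<beta>0 + ?u f e) * ?Z (\<lambda>e. \<beta>0 + ?u g e))) \<le>
      (1 + (exp (?q + real k * (exp ?l - 1) / real m) - 1)) * (real (card ?I))\<^sup>2" .
    show "1 - sqrt (exp (?q + real k * (exp ?l - 1) / real m) - 1) \<le> risk n \<theta> \<beta>0 s A T"
    proof (rule risk_ge_mixture[OF fin ne T _ _ M])
      fix f assume f: "f \<in> ?I"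
      show "(\<lambda>i. \<beta>0 + A * of_bool (i \<in> ?S f)) \<in> Xi n \<beta>0 s A"
        using card_block_set[OF f] k s A S[OF f] by (intro Xi_intro) auto
      show "two_star_h (\<lambda>i. \<beta>0 + A * of_bool (i \<in> ?S f)) e = \<beta>0 + vertex_field A (?S f) e" if "e \<in> edges n" for e
        by (rule two_star_h_block[OF S[OF f] that])
    qed
  qed
qed

lemma exp_minus_one_le:
  fixes x y :: real
  assumes "0 \<le> x" "x \<le> y"
  shows "exp x - 1 \<le> x * exp y"
proof -
  have "(1 + (- x)) * exp x \<le> exp (- x) * exp x" by (intro mult_right_mono exp_ge_add_one_self) auto
  then have "exp x - 1 \<le> x * exp x" by (simp add: algebra_simps flip: exp_add)
  also have "\<dots> \<le> x * exp y" using assms by (intro mult_left_mono) auto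
  finally show ?thesis .
qed

text \<open>The hypotheses on \<open>t\<close> cover both powerless regimes:
  \<open>b \<ge> 1/2\<close> and \<open>b + t < 0\<close> imply \<open>t < -1/2\<close>, while
  \<open>b < 1/2\<close> and \<open>t \<le> -1/2\<close> imply \<open>b + t < 0\<close>.\<close>

lemma all_tests_powerless:
  fixes s A :: "nat \<Rightarrow> real"
  assumes regime: "(\<beta>0 = 0 \<and> 0 < \<theta> \<and> \<theta> < 1/2) \<or> (\<beta>0 \<noteq> 0 \<and> \<theta> > 0)"
    and b: "0 < b" "b < 1" and t: "t < 0" "2 * t + 1 \<le> 0" "b + t < 0"
    and s: "\<And>n. s n = real n powr b" and A: "\<And>n. A n = real n powr t"
  shows "all_tests_asymp_powerless \<theta> \<beta>0 s A"
proof -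
  obtain K A0 where K: "0 \<le> K" "0 < A0" and lower:
    "\<And>n A s k m T. 2 \<le> n \<Longrightarrow> 0 < A \<Longrightarrow> A \<le> A0 \<Longrightarrow> 1 \<le> k \<Longrightarrow> 1 \<le> m \<Longrightarrow> k * m \<le> n \<Longrightarrow>
      s \<le> real k \<Longrightarrow> T \<in> tests n \<Longrightarrow>
      1 - sqrt (exp (2 * K * A\<^sup>2 * (real k)\<^sup>2 + real k * (exp (K * A\<^sup>2 * real n) - 1) / real m) - 1)
        \<le> risk n \<theta> \<beta>0 s A T"
    using risk_lower_bound[OF regime] by metis
  \<comment> \<open>The two terms of the exponent are bounded by \<open>2 * K\<close> and
    \<open>2 * K * exp K\<close> times \<open>(A n * k)^2\<close>; rounding \<open>s n\<close> up to
    \<open>k\<close> costs the remaining factor 4.\<close>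
  define B where "B = 8 * K + 8 * K * exp K"
  define \<delta> where "\<delta> = (\<lambda>n. sqrt (exp (B * real n powr (2 * (b + t))) - 1))"
  have pw0: "(\<lambda>n. real n powr a) \<longlonglongrightarrow> 0" if "a < 0" for a :: real
    using tendsto_neg_powr[OF that filterlim_real_sequentially] by (simp add: o_def)
  have "(\<lambda>n. 1 - \<delta> n) \<longlonglongrightarrow> 1 - sqrt (exp (B * 0) - 1)"
    unfolding \<delta>_def using t by (intro tendsto_intros pw0) auto
  then have lim: "(\<lambda>n. 1 - \<delta> n) \<longlonglongrightarrow> 1" by simp
  have A0ev: "\<forall>\<^sub>F n in sequentially. A n < A0"
    unfolding A using pw0[OF t(1)] K(2) by (rule order_tendstoD)
  have bound: "1 - \<delta> n \<le> risk n \<theta> \<beta>0 (s n) (A n) T" if n: "2 \<le> n" and An: "A n < A0" and T: "T \<in> tests n" for n T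
  proof -
    \<comment> \<open>Rounding up makes the support large enough for \<open>Xi\<close> and at most
      doubles \<open>s n\<close>, since \<open>s n \<ge> 1\<close>. Rounding down in
      \<open>m\<close> loses at most another factor 2, as \<open>n \<le> 2 * k * m\<close>.\<close>
    define k where "k = nat \<lceil>s n\<rceil>"
    define m where "m = n div k"
    have s1: "1 \<le> s n" "s n \<le> real n"
      using n b powr_mono[of b 1 "real n"] powr_mono[of 0 b "real n"] by (auto simp: s)
    have A0: "0 < A n" using n by (simp add: A)
    have k: "s n \<le> real k" "real k \<le> 2 * s n" "1 \<le> k" "k \<le> n"
      using s1 by (simp_all add: k_def) linarith+
    have m: "1 \<le> m" "k * m \<le> n"
      using k by (auto simp: m_def div_greater_zero_iff Suc_le_eq)
    have "n < k * m + k" using k(3) unfolding m_def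
      by (metis add.commute dividend_less_times_div le_zero_eq mult.commute not_gr_zero not_one_le_zero)
    also have "\<dots> \<le> 2 * (k * m)" using m(1) by simp
    finally have "real n \<le> 2 * (real k * real m)" by (simp flip: of_nat_mult)
    then have nm: "1 / real m \<le> 2 * real k / real n" using m n by (simp add: field_simps)
    let ?l = "K * (A n)\<^sup>2 * real n"
    have As: "(A n)\<^sup>2 * (s n)\<^sup>2 = real n powr (2 * (b + t))"
    proof -
      have "real n powr (2 * (b + t)) = real n powr ((t + t) + (b + b))"
        by (rule arg_cong[where f = "(powr) (real n)"]) simp
      then show ?thesis by (simp only: powr_add A s power2_eq_square)
    qed
    have An1: "(A n)\<^sup>2 * real n \<le> 1"
    proof -
      have "(A n)\<^sup>2 * real n = real n powr (t + t) * real n powr 1"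
        unfolding powr_add A power2_eq_square by simp
      also have "\<dots> = real n powr (t + t + 1)" by (rule powr_add[symmetric])
      also have "\<dots> \<le> real n powr 0" using n t by (intro powr_mono) auto
      finally show ?thesis using n by simp
    qed
    have k2: "(real k)\<^sup>2 \<le> 4 * (s n)\<^sup>2"
      using power_mono[OF k(2), of 2] by (simp add: power_mult_distrib)
    \<comment> \<open>Because \<open>?l\<close> stays bounded, even at \<open>t = -1/2\<close>, the
      quantity \<open>exp ?l - 1\<close> is at most a constant times \<open>?l\<close>. The
      \<open>n\<close> in \<open>?l\<close> then cancels against
      \<open>1 / m \<le> 2 * k / n\<close>.\<close>
    have "?l \<le> K" using An1 K(1) by (simp add: mult.assoc mult_left_le)
    then have "exp ?l - 1 \<le> ?l * exp K" using K(1) by (intro exp_minus_one_le) auto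
    then have "real k * (exp ?l - 1) * (1 / real m) \<le> real k * (?l * exp K) * (2 * real k / real n)"
      using nm K(1) by (intro mult_mono) auto
    also have "\<dots> = 2 * K * exp K * (A n)\<^sup>2 * (real k)\<^sup>2" using n by (simp add: power2_eq_square)
    finally have "2 * K * (A n)\<^sup>2 * (real k)\<^sup>2 + real k * (exp ?l - 1) / real m
        \<le> 2 * K * (A n)\<^sup>2 * (real k)\<^sup>2 + 2 * K * exp K * (A n)\<^sup>2 * (real k)\<^sup>2" by simp
    also have "\<dots> = (2 * K + 2 * K * exp K) * ((A n)\<^sup>2 * (real k)\<^sup>2)" by (simp add: algebra_simps)
    also have "\<dots> \<le> (2 * K + 2 * K * exp K) * ((A n)\<^sup>2 * (4 * (s n)\<^sup>2))"
      using k2 K(1) by (intro mult_left_mono) auto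
    also have "\<dots> = B * ((A n)\<^sup>2 * (s n)\<^sup>2)" by (simp add: B_def algebra_simps)
    finally have "sqrt (exp (2 * K * (A n)\<^sup>2 * (real k)\<^sup>2 + real k * (exp ?l - 1) / real m) - 1) \<le> \<delta> n"
      unfolding \<delta>_def As by simp
    then show ?thesis
      using lower[OF n A0 less_imp_le[OF An] k(3) m k(1) T] by linarith
  qed
  show ?thesis
    unfolding all_tests_asymp_powerless_def
  proof (intro allI impI conjI)
    fix T assume T: "\<forall>n. T n \<in> tests n"
    let ?r = "\<lambda>n. risk n \<theta> \<beta>0 (s n) (A n) (T n)"
    have ev: "\<forall>\<^sub>F n in sequentially. 1 - \<delta> n \<le> ?r n"
      using eventually_ge_at_top[of 2] A0ev by eventually_elim (use bound T in auto)
    have "(\<lambda>n. ereal (1 - \<delta> n)) \<longlonglongrightarrow> 1" using lim by (simp add: one_ereal_def)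
    then have "1 = liminf (\<lambda>n. ereal (1 - \<delta> n))" by (intro lim_imp_Liminf[symmetric]) auto
    also have "\<dots> \<le> liminf (\<lambda>n. ereal (?r n))" using ev by (intro Liminf_mono) simp
    finally show "1 \<le> liminf (\<lambda>n. ereal (?r n))" .
    assume "\<forall>\<^sub>F n in sequentially. ?r n \<le> 1"
    then show "asymp_powerless \<theta> \<beta>0 s A T"
      unfolding asymp_powerless_def using tendsto_sandwich[OF ev _ lim tendsto_const] by blast
  qed
qed

theorem theorem1p6:
  fixes \<theta> \<beta>0 b t :: real and s A :: "nat \<Rightarrow> real"
  assumes regime: "(\<beta>0 = 0 \<and> 0 < \<theta> \<and> \<theta> < 1/2) \<or> (\<beta>0 \<noteq> 0 \<and> \<theta> > 0)"
    and b: "0 < b" "b < 1" and t: "t < 0"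
    and s: "\<And>n. s n = real n powr b" and A: "\<And>n. A n = real n powr t"
  shows
    "(b \<ge> 1/2 \<and> b + t < 0 \<longrightarrow> all_tests_asymp_powerless \<theta> \<beta>0 s A) \<and>
     (b \<ge> 1/2 \<and> b + t > 0 \<longrightarrow>
        (\<forall>L. (\<forall>\<^sub>F n in sequentially. L n > 0) \<and>
             (\<lambda>n. real n) \<lless> L \<and> L \<lless> (\<lambda>n. real n * s n * A n) \<longrightarrow>
           asymp_powerful \<theta> \<beta>0 s A (cond_centered_sum_test \<theta> \<beta>0 L))) \<and>
     (b < 1/2 \<and> t + 1/2 \<le> 0 \<longrightarrow> all_tests_asymp_powerless \<theta> \<beta>0 s A) \<and>
     (b < 1/2 \<and> t + 1/2 > 0 \<longrightarrow>
        (\<exists>C. asymp_powerful \<theta> \<beta>0 s A (cond_centered_max_test \<theta> \<beta>0 C)))"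
proof -
  have \<theta>: "0 < \<theta>" using regime by auto
  show ?thesis
    using all_tests_powerless[OF regime b t _ _ s A] sum_test_powerful[OF \<theta> b t s A]
      max_test_powerful[OF \<theta> b t _ s A] by auto
qed

end
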